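(* Let $\beta\in(0,1)$ be fixed, observations noiseless, $\Psi=\Psi_M$ (Matérn with $\nu>d/2$), and let $\widehat{CI}_{n,\beta}$ be the confidence interval centered at $\hat f_n$ with $\hat\sigma^2=1$, i.e. $|\widehat{CI}_{n,\beta}(x)|=2q\sqrt{1-r(x)^TR^{-1}r(x)}$, $q=\Phi^{-1}(1-\beta/2)$. For any sampling scheme $\mathcal{X}$ satisfying the fill distance condition, for all $n$ $$\sup_{\|f\|_{\mathcal{N}_\Psi(\Omega)}\le1}\big\|(f-\hat f_n)/|\widehat{CI}_{n,\beta}|\big\|_{L_\infty(\Omega)}\le\frac{1}{2q},$$ and for any increasing sequence $\{a_n\}$ with $a_n\to\infty$ there is a constant $C>0$ (depending on $\beta,\Omega,\Psi$ and the fill distance constants, not on $n$) such that for all $n$ $$\sup_{\|f\|_{\mathcal{N}_\Psi(\Omega)}\le a_n}\big\|(f-\hat f_n)/|\widehat{CI}_{n,\beta}|\big\|_{L_\infty(\Omega)}\ge Ca_n.$$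
   Context: $\Omega\subset\mathbb{R}^d$ is convex and compact with positive Lebesgue measure. Matérn correlation: $\Psi_M(h)=\frac{1}{\Gamma(\nu-d/2)2^{\nu-d/2-1}}\|h\|_2^{\nu-d/2}K_{\nu-d/2}(\|h\|_2)$. $\mathcal{N}_\Psi(\Omega)$: RKHS of $\Psi$ on $\Omega$, defined as restrictions of $\mathcal{N}_\Psi(\mathbb{R}^d)=\{f\in L_2\cap C:\mathcal{F}(f)/\sqrt{\mathcal{F}(\Psi)}\in L_2\}$ (norm$^2$ $(2\pi)^{-d/2}\int|\mathcal{F}(f)|^2/\mathcal{F}(\Psi)$) with the infimum-over-extensions norm. Sampling scheme: sequence $\{X_n\}$ of sets of $n$ distinct points of $\Omega$; fill distance condition: $\sup_{x\in\Omega}\min_{x_j\in X}\|x-x_j\|_2\asymp n^{-1/d}$. For $X=\{x_1,\dots,x_n\}$: $Y=(f(x_k))_k$, $r(x)=(\Psi(x-x_k))_k$, $R=(\Psi(x_j-x_k))_{jk}$, $\hat f_n(x)=r(x)^TR^{-1}Y$. Convention $0/0=0$. *)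

theory Defs
  imports "HOL-Probability.Probability"
begin

definition besselK :: "real \<Rightarrow> real \<Rightarrow> real" where
  "besselK \<alpha> x = (LINT t:{0<..}|lborel. exp (- x * cosh t) * cosh (\<alpha> * t))"

text \<open>Matern correlation Psi_M on R^d (d = DIM('a)) with smoothness parameter nu;
  the value at h = 0 is the (continuous) limit 1.\<close>
definition matern :: "real \<Rightarrow> 'a::euclidean_space \<Rightarrow> real" where
  "matern \<nu> h = (let \<alpha> = \<nu> - real DIM('a) / 2 in
     if h = 0 then 1
     else 1 / (Gamma \<alpha> * 2 powr (\<alpha> - 1)) * norm h powr \<alpha> * besselK \<alpha> (norm h))"

definition fourier :: "('a::euclidean_space \<Rightarrow> complex) \<Rightarrow> 'a \<Rightarrow> complex" where
  "fourier f \<omega> = complex_of_real ((2 * pi) powr (- real DIM('a) / 2)) *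
     (\<integral>x. f x * exp (- \<i> * complex_of_real (x \<bullet> \<omega>)) \<partial>lborel)"

text \<open>g is the L2 (Plancherel) Fourier transform of the L2 function f: the L2-limit of the
  Fourier transforms of the truncations f * 1_{ball 0 R} as R tends to infinity.\<close>
definition L2_fourier :: "('a::euclidean_space \<Rightarrow> real) \<Rightarrow> ('a \<Rightarrow> complex) \<Rightarrow> bool" where
  "L2_fourier f g \<longleftrightarrow> g \<in> borel_measurable lborel \<and>
     integrable lborel (\<lambda>\<omega>. (cmod (g \<omega>))\<^sup>2) \<and>
     ((\<lambda>R. \<integral>\<omega>. (cmod (fourier (\<lambda>x. complex_of_real (indicator (ball 0 R) x * f x)) \<omega> - g \<omega>))\<^sup>2 \<partial>lborel)
        \<longlongrightarrow> 0) at_top"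

definition native_space :: "('a::euclidean_space \<Rightarrow> real) \<Rightarrow> ('a \<Rightarrow> real) set" where
  "native_space \<Psi> = {f. continuous_on UNIV f \<and> f \<in> borel_measurable lborel \<and>
     integrable lborel (\<lambda>x. (f x)\<^sup>2) \<and>
     (\<exists>g. L2_fourier f g \<and>
        integrable lborel (\<lambda>\<omega>. (cmod (g \<omega> / csqrt (fourier (\<lambda>x. complex_of_real (\<Psi> x)) \<omega>)))\<^sup>2))}"

definition native_norm :: "('a::euclidean_space \<Rightarrow> real) \<Rightarrow> ('a \<Rightarrow> real) \<Rightarrow> real" where
  "native_norm \<Psi> f = (let g = (SOME g. L2_fourier f g) in
     sqrt ((2 * pi) powr (- real DIM('a) / 2) *
       (\<integral>\<omega>. (cmod (g \<omega> / csqrt (fourier (\<lambda>x. complex_of_real (\<Psi> x)) \<omega>)))\<^sup>2 \<partial>lborel)))"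

definition in_native_on :: "('a::euclidean_space \<Rightarrow> real) \<Rightarrow> 'a set \<Rightarrow> ('a \<Rightarrow> real) \<Rightarrow> bool" where
  "in_native_on \<Psi> \<Omega> f \<longleftrightarrow> (\<exists>F\<in>native_space \<Psi>. \<forall>x\<in>\<Omega>. F x = f x)"

definition native_norm_on :: "('a::euclidean_space \<Rightarrow> real) \<Rightarrow> 'a set \<Rightarrow> ('a \<Rightarrow> real) \<Rightarrow> real" where
  "native_norm_on \<Psi> \<Omega> f = Inf {native_norm \<Psi> F | F. F \<in> native_space \<Psi> \<and> (\<forall>x\<in>\<Omega>. F x = f x)}"

definition native_ball :: "('a::euclidean_space \<Rightarrow> real) \<Rightarrow> 'a set \<Rightarrow> real \<Rightarrow> ('a \<Rightarrow> real) set" where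
  "native_ball \<Psi> \<Omega> a = {f. in_native_on \<Psi> \<Omega> f \<and> native_norm_on \<Psi> \<Omega> f \<le> a}"

definition sampling_scheme :: "'a set \<Rightarrow> (nat \<Rightarrow> 'a list) \<Rightarrow> bool" where
  "sampling_scheme \<Omega> X \<longleftrightarrow> (\<forall>n\<ge>1. length (X n) = n \<and> distinct (X n) \<and> set (X n) \<subseteq> \<Omega>)"

definition fill_distance :: "'a::metric_space set \<Rightarrow> 'a list \<Rightarrow> real" where
  "fill_distance \<Omega> xs = (SUP x\<in>\<Omega>. Min ((\<lambda>y. dist x y) ` set xs))"

definition fill_condition_with :: "'a::euclidean_space set \<Rightarrow> real \<Rightarrow> real \<Rightarrow> (nat \<Rightarrow> 'a list) \<Rightarrow> bool" where
  "fill_condition_with \<Omega> c1 c2 X \<longleftrightarrow> (\<forall>n\<ge>1.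
     c1 * real n powr (- 1 / real DIM('a)) \<le> fill_distance \<Omega> (X n) \<and>
     fill_distance \<Omega> (X n) \<le> c2 * real n powr (- 1 / real DIM('a)))"

definition fill_condition :: "'a::euclidean_space set \<Rightarrow> (nat \<Rightarrow> 'a list) \<Rightarrow> bool" where
  "fill_condition \<Omega> X \<longleftrightarrow> (\<exists>c1 c2. 0 < c1 \<and> 0 < c2 \<and> fill_condition_with \<Omega> c1 c2 X)"

text \<open>M^{-1} y for an n x n matrix M (indices < n), written as the unique solution c of M c = y
  (entries at indices >= n set to 0).\<close>
definition mat_inv_mult :: "nat \<Rightarrow> (nat \<Rightarrow> nat \<Rightarrow> real) \<Rightarrow> (nat \<Rightarrow> real) \<Rightarrow> (nat \<Rightarrow> real)" where
  "mat_inv_mult n M y = (THE c. (\<forall>j<n. (\<Sum>k<n. M j k * c k) = y j) \<and> (\<forall>k\<ge>n. c k = 0))"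

definition kmat :: "('a::real_normed_vector \<Rightarrow> real) \<Rightarrow> 'a list \<Rightarrow> nat \<Rightarrow> nat \<Rightarrow> real" where
  "kmat \<Psi> xs j k = \<Psi> (xs ! j - xs ! k)"

definition kvec :: "('a::real_normed_vector \<Rightarrow> real) \<Rightarrow> 'a list \<Rightarrow> 'a \<Rightarrow> nat \<Rightarrow> real" where
  "kvec \<Psi> xs x k = \<Psi> (x - xs ! k)"

definition interpolant :: "('a::real_normed_vector \<Rightarrow> real) \<Rightarrow> 'a list \<Rightarrow> ('a \<Rightarrow> real) \<Rightarrow> 'a \<Rightarrow> real" where
  "interpolant \<Psi> xs f x = (let n = length xs in
     \<Sum>j<n. kvec \<Psi> xs x j * mat_inv_mult n (kmat \<Psi> xs) (\<lambda>k. f (xs ! k)) j)"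

definition post_var :: "('a::real_normed_vector \<Rightarrow> real) \<Rightarrow> 'a list \<Rightarrow> 'a \<Rightarrow> real" where
  "post_var \<Psi> xs x = (let n = length xs in
     1 - (\<Sum>j<n. kvec \<Psi> xs x j * mat_inv_mult n (kmat \<Psi> xs) (kvec \<Psi> xs x) j))"

definition std_normal_cdf :: "real \<Rightarrow> real" where
  "std_normal_cdf t = (LINT x:{..t}|lborel. std_normal_density x)"

definition normal_quantile :: "real \<Rightarrow> real" where
  "normal_quantile p = (THE t. std_normal_cdf t = p)"

definition CI_length :: "('a::real_normed_vector \<Rightarrow> real) \<Rightarrow> real \<Rightarrow> 'a list \<Rightarrow> 'a \<Rightarrow> real" where
  "CI_length \<Psi> \<beta> xs x = 2 * normal_quantile (1 - \<beta> / 2) * sqrt (post_var \<Psi> xs x)"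

text \<open>|| (f - hat f_n) / |CI| ||_{L_infty(Omega)} (essential sup w.r.t. Lebesgue measure on Omega);
  division by 0 yields 0 in Isabelle, matching the convention 0/0 = 0.\<close>
definition ci_ratio_Linf :: "('a::euclidean_space \<Rightarrow> real) \<Rightarrow> real \<Rightarrow> 'a set \<Rightarrow> 'a list \<Rightarrow> ('a \<Rightarrow> real) \<Rightarrow> ereal" where
  "ci_ratio_Linf \<Psi> \<beta> \<Omega> xs f = esssup (restrict_space lborel \<Omega>)
     (\<lambda>x. ereal \<bar>(f x - interpolant \<Psi> xs f x) / CI_length \<Psi> \<beta> xs x\<bar>)"

end

theory Submission
  imports Defs "HOL-Real_Asymp.Real_Asymp"
begin

text \<open>
  The substitution \<open>s = (r / 2) e\<^sup>t\<close> in the Bessel integral exhibits the Matern kernel \<open>\<Psi>\<close> as a mixture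
  of Gaussians \<open>exp (- |h|\<^sup>2 / (4 s))\<close> with Gamma distributed \<open>s\<close>. By Fubini its Fourier transform \<open>p\<close> is
  positive and integrable, and \<open>\<Psi>\<close> is recovered from \<open>p\<close> by Fourier inversion. Consequently
  \<open>\<Sum>\<^sub>i\<^sub>j c\<^sub>i c\<^sub>j \<Psi> (y\<^sub>i - y\<^sub>j)\<close> is, up to a constant, the squared \<open>L\<^sup>2(p)\<close> norm of \<open>\<Sum>\<^sub>i c\<^sub>i exp (\<i> y\<^sub>i \<bullet> \<omega>)\<close>,
  and Cauchy-Schwarz bounds \<open>\<Sum>\<^sub>i c\<^sub>i F (y\<^sub>i)\<close> by the native norm of \<open>F\<close> times the square root of this form.
  Applied to the interpolation error at \<open>x\<close>, whose form is exactly the posterior variance, this gives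
  the upper bound. The bound is sharp at any point \<open>x\<^sub>0\<close> outside the design: the residual of
  \<open>\<Psi> (\<cdot> - x\<^sub>0)\<close> attains it, and continuity near an interior \<open>x\<^sub>0\<close> turns the pointwise value into a
  lower bound for the essential supremum. Hence \<open>C = 1 / (2 q)\<close> works for every design.
\<close>

section \<open>Gaussian integrals\<close>

text \<open>Of Plancherel's theorem only the contraction half, \<open>bessel_fourier\<close>, is
  used. It makes the L2 transform unique almost everywhere, which neutralises the arbitrary choice
  in \<open>native_norm\<close>, and it identifies the L2 transform of an integrable,
  square-integrable function with its Fourier integral. The second obstacle is that a native-space
  function is only continuous and square integrable, so its Fourier integral need not exist and its
  point values must be recovered from an L2 limit. This works because its transform \<open>g\<close>
  is integrable: \<open>g / sqrt p\<close> and \<open>sqrt p\<close> are both square integrable.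
  Pointwise inversion then follows by Gaussian summation, and Cauchy-Schwarz is applied to the same
  two factors. Finally, the matrix inverse is a definite description, so nothing can be said about
  the interpolant before strict positive definiteness is known; this is where distinctness of the
  sample points enters.\<close>

lemma fourier_cis:
  fixes f :: "'a::euclidean_space \<Rightarrow> complex"
  shows "fourier f \<omega> = complex_of_real ((2 * pi) powr (- real DIM('a) / 2)) *
     (\<integral>x. f x * cis (- (x \<bullet> \<omega>)) \<partial>lborel)"
  unfolding fourier_def by (simp add: cis_conv_exp)

lemma integrable_mult_cis:
  fixes f :: "'a::euclidean_space \<Rightarrow> complex"
  assumes "integrable lborel f" and [measurable]: "\<theta> \<in> borel_measurable borel"
  shows "integrable lborel (\<lambda>x. f x * cis (\<theta> x))"
proof (rule Bochner_Integration.integrable_bound[OF assms(1)])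
  have [measurable]: "f \<in> borel_measurable borel" using assms(1) by simp
  show "(\<lambda>x. f x * cis (\<theta> x)) \<in> borel_measurable lborel"
    by (simp add: cis_conv_exp)
qed (simp add: norm_mult)

text \<open>\<open>lborel\<close> is the image of the product of one-dimensional Lebesgue measures
  under \<open>?T\<close>, which rebuilds a vector from its coordinates; the rest is Fubini for
  finite products.\<close>

lemma
  fixes f :: "'a::euclidean_space \<Rightarrow> real \<Rightarrow> complex"
  assumes int: "\<And>b. b \<in> Basis \<Longrightarrow> integrable lborel (f b)"
  shows integrable_lborel_prod: "integrable lborel (\<lambda>x::'a. \<Prod>b\<in>Basis. f b (x \<bullet> b))" (is ?A)
    and integral_lborel_prod:
      "(\<integral>x. (\<Prod>b\<in>Basis. f b (x \<bullet> b)) \<partial>(lborel :: 'a measure)) = (\<Prod>b\<in>Basis. \<integral>t. f b t \<partial>lborel)" (is ?B)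
proof -
  interpret product_sigma_finite "\<lambda>_::'a. lborel :: real measure" ..
  let ?T = "\<lambda>y::'a \<Rightarrow> real. \<Sum>b\<in>Basis. y b *\<^sub>R b"
  have [measurable]: "f b \<in> borel_measurable borel" if "b \<in> Basis" for b
    using int[OF that] by simp
  have [measurable]: "(\<lambda>x::'a. \<Prod>b\<in>Basis. f b (x \<bullet> b)) \<in> borel_measurable borel"
    by measurable
  have T[measurable]: "?T \<in> measurable (\<Pi>\<^sub>M b\<in>Basis. lborel) borel"
    by (intro borel_measurable_sum borel_measurable_scaleR) auto
  have eq: "(\<Prod>b\<in>Basis. f b (?T y \<bullet> b)) = (\<Prod>b\<in>Basis. f b (y b))" for y
    by (rule prod.cong) auto
  show ?A
    by (subst lborel_eq, subst integrable_distr_eq)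
       (auto simp only: eq intro!: product_integrable_prod int, measurable)
  show ?B
    by (subst lborel_eq, subst integral_distr)
       (auto simp only: eq intro!: product_integral_prod int, measurable)
qed

text \<open>The choice \<open>\<sigma> = 1 / sqrt (2 * s)\<close> makes the Gaussian a multiple of a
  centred normal density; rescaling by \<open>\<sigma>\<close> leaves the characteristic function of
  the standard normal distribution at \<open>\<sigma> * u\<close>.\<close>

lemma gaussian_real_fourier:
  fixes s u :: real
  assumes "s > 0"
  shows "integrable lborel (\<lambda>x. complex_of_real (exp (- s * x\<^sup>2)) * cis (x * u))"
    and "(\<integral>x. complex_of_real (exp (- s * x\<^sup>2)) * cis (x * u) \<partial>lborel)
          = complex_of_real (sqrt (pi / s) * exp (- u\<^sup>2 / (4 * s)))"
proof -
  define \<sigma> where "\<sigma> = 1 / sqrt (2 * s)"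
  have \<sigma>: "\<sigma> > 0" "s * \<sigma>\<^sup>2 = 1 / 2" using assms by (auto simp: \<sigma>_def power_divide)
  have nd: "normal_density 0 \<sigma> x = sqrt (s / pi) * exp (- s * x\<^sup>2)" for x
  proof -
    have s2: "\<sigma>\<^sup>2 = 1 / (2 * s)" using assms by (simp add: \<sigma>_def power_divide)
    show ?thesis using assms unfolding normal_density_def s2 by (simp add: real_sqrt_divide)
  qed
  have "integrable lborel (\<lambda>x. sqrt (pi / s) * normal_density 0 \<sigma> x)"
    using \<sigma>(1) by (intro integrable_mult_right) simp
  also have "(\<lambda>x. sqrt (pi / s) * normal_density 0 \<sigma> x) = (\<lambda>x. exp (- s * x\<^sup>2))"
    unfolding nd using assms by (auto simp: fun_eq_iff real_sqrt_mult[symmetric] mult.assoc[symmetric])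
  finally have int: "integrable lborel (\<lambda>x. exp (- s * x\<^sup>2))" .
  then show "integrable lborel (\<lambda>x. complex_of_real (exp (- s * x\<^sup>2)) * cis (x * u))"
    by (intro integrable_mult_cis) simp_all
  have "(\<integral>x. complex_of_real (exp (- s * x\<^sup>2)) * cis (x * u) \<partial>lborel)
      = \<bar>\<sigma>\<bar> *\<^sub>R (\<integral>y. complex_of_real (exp (- s * (0 + \<sigma> * y)\<^sup>2)) * cis ((0 + \<sigma> * y) * u) \<partial>lborel)"
    using \<sigma> by (intro lborel_integral_real_affine) auto
  also have "(\<integral>y. complex_of_real (exp (- s * (0 + \<sigma> * y)\<^sup>2)) * cis ((0 + \<sigma> * y) * u) \<partial>lborel)
     = (\<integral>y. sqrt (2 * pi) *\<^sub>R (std_normal_density y *\<^sub>R iexp ((\<sigma> * u) * y)) \<partial>lborel)"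
  proof (rule Bochner_Integration.integral_cong)
    fix y :: real
    have "s * (\<sigma> * y)\<^sup>2 = y\<^sup>2 / 2" using \<sigma>(2) by (simp add: power_mult_distrib mult.assoc[symmetric])
    then show "complex_of_real (exp (- s * (0 + \<sigma> * y)\<^sup>2)) * cis ((0 + \<sigma> * y) * u)
      = sqrt (2 * pi) *\<^sub>R (std_normal_density y *\<^sub>R iexp ((\<sigma> * u) * y))"
      by (simp add: std_normal_density_def scaleR_conv_of_real cis_conv_exp mult_ac)
  qed simp
  also have "\<dots> = sqrt (2 * pi) *\<^sub>R (\<integral>y. std_normal_density y *\<^sub>R iexp ((\<sigma> * u) * y) \<partial>lborel)"
    by (rule integral_scaleR_right)
  also have "(\<integral>y. std_normal_density y *\<^sub>R iexp ((\<sigma> * u) * y) \<partial>lborel) = char std_normal_distribution (\<sigma> * u)"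
    unfolding char_def by (subst integral_density) auto
  also have "\<dots> = complex_of_real (exp (- u\<^sup>2 / (4 * s)))"
    using assms by (simp add: char_std_normal_distribution \<sigma>_def power_mult_distrib power_divide)
  also have "\<bar>\<sigma>\<bar> *\<^sub>R (sqrt (2 * pi) *\<^sub>R complex_of_real (exp (- u\<^sup>2 / (4 * s))))
      = complex_of_real (sqrt (pi / s) * exp (- u\<^sup>2 / (4 * s)))"
    using assms by (simp add: scaleR_conv_of_real \<sigma>_def real_sqrt_divide real_sqrt_mult)
  finally show "(\<integral>x. complex_of_real (exp (- s * x\<^sup>2)) * cis (x * u) \<partial>lborel)
          = complex_of_real (sqrt (pi / s) * exp (- u\<^sup>2 / (4 * s)))" .
qed

lemma cis_sum: "finite A \<Longrightarrow> cis (\<Sum>i\<in>A. f i) = (\<Prod>i\<in>A. cis (f i))"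
  by (induction rule: finite_induct) (auto simp flip: cis_mult)

text \<open>The Gaussian and the phase both factor over the coordinates, so the one-dimensional
  formula is multiplied up.\<close>

lemma
  fixes \<omega> :: "'a::euclidean_space" and s :: real
  assumes "s > 0"
  shows integrable_gaussian_cis:
      "integrable lborel (\<lambda>x::'a. complex_of_real (exp (- s * (norm x)\<^sup>2)) * cis (x \<bullet> \<omega>))" (is ?A)
    and integral_gaussian_cis:
      "(\<integral>x. complex_of_real (exp (- s * (norm x)\<^sup>2)) * cis (x \<bullet> \<omega>) \<partial>(lborel :: 'a measure))
          = complex_of_real ((pi / s) powr (real DIM('a) / 2) * exp (- (norm \<omega>)\<^sup>2 / (4 * s)))" (is ?B)
proof -
  let ?f = "\<lambda>b t. complex_of_real (exp (- s * t\<^sup>2)) * cis (t * (\<omega> \<bullet> b))"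
  have nrm: "(norm y)\<^sup>2 = (\<Sum>b\<in>Basis. (y \<bullet> b)\<^sup>2)" for y :: 'a
    unfolding power2_norm_eq_inner by (subst euclidean_inner) (simp add: power2_eq_square)
  have eq: "complex_of_real (exp (- s * (norm x)\<^sup>2)) * cis (x \<bullet> \<omega>) = (\<Prod>b\<in>Basis. ?f b (x \<bullet> b))" for x :: 'a
    unfolding nrm by (subst euclidean_inner)
      (simp add: prod.distrib cis_sum exp_sum sum_distrib_left sum_negf[symmetric])
  show ?A unfolding eq by (intro integrable_lborel_prod gaussian_real_fourier(1) assms)
  have "(\<integral>x. complex_of_real (exp (- s * (norm x)\<^sup>2)) * cis (x \<bullet> \<omega>) \<partial>(lborel :: 'a measure))
     = (\<Prod>b\<in>Basis. complex_of_real (sqrt (pi / s) * exp (- (\<omega> \<bullet> b)\<^sup>2 / (4 * s))))"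
    unfolding eq using assms
    by (subst integral_lborel_prod) (auto simp only: gaussian_real_fourier intro!: prod.cong)
  also have "\<dots> = complex_of_real (sqrt (pi / s) ^ DIM('a) * (\<Prod>b\<in>Basis. exp (- (\<omega> \<bullet> b)\<^sup>2 / (4 * s))))"
    by (simp add: prod.distrib)
  also have "(\<Prod>b\<in>Basis. exp (- (\<omega> \<bullet> b)\<^sup>2 / (4 * s))) = exp (- (norm \<omega>)\<^sup>2 / (4 * s))"
    unfolding nrm by (simp add: exp_sum[symmetric] sum_negf sum_divide_distrib)
  also have "sqrt (pi / s) ^ DIM('a) = (pi / s) powr (real DIM('a) / 2)"
    using assms by (simp add: powr_half_sqrt[symmetric] powr_realpow[symmetric] powr_powr)
  finally show ?B .
qed

lemma
  fixes s :: real
  assumes "s > 0"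
  shows integrable_gaussian: "integrable lborel (\<lambda>x::'a::euclidean_space. exp (- s * (norm x)\<^sup>2))" (is ?A)
    and integral_gaussian: "(\<integral>x. exp (- s * (norm x)\<^sup>2) \<partial>(lborel :: 'a measure)) = (pi / s) powr (real DIM('a) / 2)" (is ?B)
proof -
  have "integrable lborel (\<lambda>x::'a. complex_of_real (exp (- s * (norm x)\<^sup>2)))"
    using integrable_gaussian_cis[OF assms, of "0::'a"] by simp
  then show ?A using integrable_Re by fastforce
  have "(\<integral>x. complex_of_real (exp (- s * (norm x)\<^sup>2)) \<partial>(lborel :: 'a measure)) = complex_of_real ((pi / s) powr (real DIM('a) / 2))"
    using integral_gaussian_cis[OF assms, of "0::'a"] by simp
  then show ?B by (simp del: of_real_exp)
qed

lemma integrable_mult_kernel: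
  fixes u :: "'a::euclidean_space \<Rightarrow> complex" and v :: "'b::euclidean_space \<Rightarrow> complex"
  assumes u: "integrable lborel u" and v: "integrable lborel v"
    and [measurable]: "k \<in> borel_measurable borel" and k: "\<And>z. cmod (k z) \<le> 1"
  shows "integrable (lborel \<Otimes>\<^sub>M lborel) (\<lambda>(x, y). u x * v y * k (x, y))"
proof -
  have [measurable]: "u \<in> borel_measurable borel" "v \<in> borel_measurable borel"
    using u v by simp_all
  have meas[measurable]: "(\<lambda>(x, y). u x * v y) \<in> borel_measurable (lborel \<Otimes>\<^sub>M lborel)" by measurable
  have prd: "integrable (lborel \<Otimes>\<^sub>M lborel) (\<lambda>(x, y). u x * v y)"
    using u v by (intro lborel_pair.Fubini_integrable) (auto simp: norm_mult)
  have kb[measurable]: "k \<in> borel_measurable (lborel \<Otimes>\<^sub>M lborel)"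
    by (simp add: lborel_prod)
  show ?thesis
  proof (rule Bochner_Integration.integrable_bound[OF prd])
    show "(\<lambda>(x, y). u x * v y * k (x, y)) \<in> borel_measurable (lborel \<Otimes>\<^sub>M lborel)" by measurable
    show "AE z in lborel \<Otimes>\<^sub>M lborel. norm (case z of (x, y) \<Rightarrow> u x * v y * k (x, y)) \<le> norm (case z of (x, y) \<Rightarrow> u x * v y)"
      using k by (intro always_eventually) (auto simp: norm_mult intro!: mult_left_le)
  qed
qed

text \<open>With a phase as \<open>k\<close>, this moves a Fourier transform from one factor of an
  integrated product to the other.\<close>

lemma integral_bounded_kernel_swap:
  fixes u :: "'a::euclidean_space \<Rightarrow> complex" and v :: "'b::euclidean_space \<Rightarrow> complex"
  assumes u: "integrable lborel u" and v: "integrable lborel v"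
    and k: "continuous_on UNIV (\<lambda>(x, y). k x y)" "\<And>x y. cmod (k x y) \<le> 1"
  shows "(\<integral>y. (\<integral>x. u x * k x y \<partial>lborel) * v y \<partial>lborel)
       = (\<integral>x. u x * (\<integral>y. v y * k x y \<partial>lborel) \<partial>lborel)"
proof -
  have "integrable (lborel \<Otimes>\<^sub>M lborel) (\<lambda>(x, y). u x * v y * (\<lambda>(x, y). k x y) (x, y))"
    using k by (intro integrable_mult_kernel u v borel_measurable_continuous_onI) auto
  then have "(\<integral>y. (\<integral>x. u x * v y * k x y \<partial>lborel) \<partial>lborel)
     = (\<integral>x. (\<integral>y. u x * v y * k x y \<partial>lborel) \<partial>lborel)"
    by (intro lborel_pair.Fubini_integral) simp
  also have "(\<lambda>y. (\<integral>x. u x * v y * k x y \<partial>lborel)) = (\<lambda>y. (\<integral>x. u x * k x y \<partial>lborel) * v y)"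
  proof
    fix y
    have "(\<integral>x. u x * v y * k x y \<partial>lborel) = (\<integral>x. u x * k x y * v y \<partial>lborel)"
      by (simp only: mult_ac)
    then show "(\<integral>x. u x * v y * k x y \<partial>lborel) = (\<integral>x. u x * k x y \<partial>lborel) * v y" by simp
  qed
  finally show ?thesis by (simp add: mult.assoc)
qed

section \<open>Square-integrable Fourier transforms\<close>

lemma borel_measurable_cis [measurable]: "cis \<in> borel_measurable borel"
  by (intro borel_measurable_continuous_onI continuous_intros)

section \<open>Integral inequalities and translation invariance\<close>

lemma integrable_mult_of_square_integrable:
  fixes f g :: "'a \<Rightarrow> complex"
  assumes [measurable]: "f \<in> borel_measurable M" "g \<in> borel_measurable M"
    and "integrable M (\<lambda>x. (cmod (f x))\<^sup>2)" "integrable M (\<lambda>x. (cmod (g x))\<^sup>2)"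
  shows "integrable M (\<lambda>x. f x * g x)"
proof (rule Bochner_Integration.integrable_bound[OF Bochner_Integration.integrable_add[OF assms(3,4)]])
  have "cmod (f x) * cmod (g x) \<le> (cmod (f x))\<^sup>2 + (cmod (g x))\<^sup>2" for x
    using sum_squares_bound[of "cmod (f x)" "cmod (g x)"]
      mult_nonneg_nonneg[OF norm_ge_zero[of "f x"] norm_ge_zero[of "g x"]] by linarith
  then show "AE x in M. norm (f x * g x) \<le> norm ((cmod (f x))\<^sup>2 + (cmod (g x))\<^sup>2)"
    by (simp add: norm_mult)
qed simp

text \<open>The integral of \<open>(t * cmod (f x) - cmod (g x))\<^sup>2\<close> is a nonnegative
  quadratic in \<open>t\<close>; its value at the minimum \<open>t = I / A\<close> is the
  claim.\<close>

lemma Cauchy_Schwarz_integral: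
  fixes f g :: "'a \<Rightarrow> complex"
  assumes [measurable]: "f \<in> borel_measurable M" "g \<in> borel_measurable M"
    and f: "integrable M (\<lambda>x. (cmod (f x))\<^sup>2)" and g: "integrable M (\<lambda>x. (cmod (g x))\<^sup>2)"
  shows "(cmod (\<integral>x. f x * g x \<partial>M))\<^sup>2 \<le> (\<integral>x. (cmod (f x))\<^sup>2 \<partial>M) * (\<integral>x. (cmod (g x))\<^sup>2 \<partial>M)"
proof -
  define A B I where "A = (\<integral>x. (cmod (f x))\<^sup>2 \<partial>M)" and "B = (\<integral>x. (cmod (g x))\<^sup>2 \<partial>M)"
    and "I = (\<integral>x. cmod (f x) * cmod (g x) \<partial>M)"
  have fg: "integrable M (\<lambda>x. cmod (f x) * cmod (g x))"
    using integrable_norm[OF integrable_mult_of_square_integrable[OF assms]] by (simp add: norm_mult)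
  have quad: "0 \<le> t\<^sup>2 * A - 2 * t * I + B" for t
  proof -
    have "0 \<le> (\<integral>x. (t * cmod (f x) - cmod (g x))\<^sup>2 \<partial>M)" by simp
    also have "\<dots> = (\<integral>x. t\<^sup>2 * (cmod (f x))\<^sup>2 - 2 * t * (cmod (f x) * cmod (g x)) + (cmod (g x))\<^sup>2 \<partial>M)"
      by (simp add: power2_diff power_mult_distrib algebra_simps)
    also have "\<dots> = t\<^sup>2 * A - 2 * t * I + B"
      unfolding A_def B_def I_def using f g fg by simp
    finally show ?thesis .
  qed
  have AB: "0 \<le> A" "0 \<le> B" "0 \<le> I" by (simp_all add: A_def B_def I_def)
  have "I\<^sup>2 \<le> A * B"
  proof (cases "A = 0")
    case True
    have "I = 0"
    proof (rule ccontr)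
      assume "I \<noteq> 0"
      \<comment> \<open>For \<open>A = 0\<close> the quadratic degenerates to
        \<open>B - 2 * t * I\<close>, and this \<open>t\<close> makes it -1.\<close>
      then show False using quad[of "(B + 1) / (2 * I)"] True by simp
    qed
    then show ?thesis using True by simp
  next
    case False
    have "0 \<le> A * ((I / A)\<^sup>2 * A - 2 * (I / A) * I + B)"
      using AB(1) quad[of "I / A"] by (rule mult_nonneg_nonneg)
    also have "\<dots> = A * B - I\<^sup>2"
      using False by (simp add: power2_eq_square field_simps)
    finally show ?thesis by simp
  qed
  moreover have "cmod (\<integral>x. f x * g x \<partial>M) \<le> I"
    unfolding I_def using integral_norm_bound[of M "\<lambda>x. f x * g x"] by (simp add: norm_mult)
  ultimately show ?thesis unfolding A_def B_def
    by (meson norm_ge_zero order_trans power_mono)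
qed

text \<open>A non-integrable function has Bochner integral 0 by default, so the bound holds for
  every \<open>f\<close>.\<close>

lemma ennreal_norm_integral_le: "ennreal (norm (integral\<^sup>L M f)) \<le> (\<integral>\<^sup>+x. norm (f x) \<partial>M)"
  by (cases "integrable M f") (auto simp: not_integrable_integral_eq intro: integral_norm_bound_ennreal)

lemma nn_integral_lborel_translate:
  fixes f :: "'a::euclidean_space \<Rightarrow> ennreal"
  assumes [measurable]: "f \<in> borel_measurable borel"
  shows "(\<integral>\<^sup>+x. f (x - a) \<partial>lborel) = (\<integral>\<^sup>+x. f x \<partial>lborel)"
proof -
  have "(\<integral>\<^sup>+x. f x \<partial>lborel) = (\<integral>\<^sup>+x. f x \<partial>distr lborel borel ((+) (- a)))"
    by (simp add: lborel_distr_plus)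
  also have "\<dots> = (\<integral>\<^sup>+x. f (x - a) \<partial>lborel)"
    by (subst nn_integral_distr) auto
  finally show ?thesis by simp
qed

lemma
  fixes f :: "'a::euclidean_space \<Rightarrow> 'b::{banach, second_countable_topology}"
  assumes f: "integrable lborel f"
  shows integrable_lborel_translate: "integrable lborel (\<lambda>x. f (x - a))"
    and integral_lborel_translate: "(\<integral>x. f (x - a) \<partial>lborel) = (\<integral>x. f x \<partial>lborel)"
proof -
  have [measurable]: "f \<in> borel_measurable borel" using f by simp
  have D: "lborel = distr lborel borel ((+) (- a))" by (simp add: lborel_distr_plus)
  have "integrable (distr lborel borel ((+) (- a))) f" using f D by simp
  then show "integrable lborel (\<lambda>x. f (x - a))"
    by (subst (asm) integrable_distr_eq) auto
  have "(\<integral>x. f x \<partial>lborel) = (\<integral>x. f x \<partial>distr lborel borel ((+) (- a)))" using D by simp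
  also have "\<dots> = (\<integral>x. f (x - a) \<partial>lborel)" by (subst integral_distr) auto
  finally show "(\<integral>x. f (x - a) \<partial>lborel) = (\<integral>x. f x \<partial>lborel)" by simp
qed

lemma nn_integral_gaussian_translate:
  fixes a :: "'a::euclidean_space"
  assumes "s > 0"
  shows "(\<integral>\<^sup>+x. ennreal (exp (- s * (norm (x - a))\<^sup>2)) \<partial>lborel) = ennreal ((pi / s) powr (real DIM('a) / 2))"
proof -
  have "(\<integral>\<^sup>+x. ennreal (exp (- s * (norm (x - a))\<^sup>2)) \<partial>lborel)
      = (\<integral>\<^sup>+x. ennreal (exp (- s * (norm x)\<^sup>2)) \<partial>(lborel :: 'a measure))"
    by (rule nn_integral_lborel_translate[where f = "\<lambda>x. ennreal (exp (- s * (norm x)\<^sup>2))"]) simp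
  also have "\<dots> = ennreal ((pi / s) powr (real DIM('a) / 2))"
    using integrable_gaussian[OF assms, where 'a = 'a] integral_gaussian[OF assms, where 'a = 'a]
    by (subst nn_integral_eq_integral) simp_all
  finally show ?thesis .
qed

section \<open>Bessel inequality for the Fourier integral\<close>

lemma borel_measurable_fourier_integral [measurable]:
  fixes f :: "'a::euclidean_space \<Rightarrow> complex"
  assumes [measurable]: "f \<in> borel_measurable borel"
  shows "(\<lambda>\<omega>. \<integral>x. f x * cis (- (x \<bullet> \<omega>)) \<partial>lborel) \<in> borel_measurable borel"
  by measurable

lemma borel_measurable_fourier [measurable]:
  fixes f :: "'a::euclidean_space \<Rightarrow> complex"
  assumes [measurable]: "f \<in> borel_measurable borel"
  shows "fourier f \<in> borel_measurable borel"
  unfolding fourier_cis[abs_def] by measurable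

text \<open>Writing the square as \<open>F \<omega> * cnj (F \<omega>)\<close> and integrating over
  \<open>\<omega>\<close> before \<open>x\<close> and \<open>y\<close> turns the Gaussian weight
  into the kernel \<open>c * E x y\<close>; without the weight that inner integral would diverge. A
  Schur test finishes: \<open>cmod (f x) * cmod (f y)\<close> is at most half the sum of the
  squares, and the kernel has the same integral in either variable.\<close>

lemma bessel_gaussian_weight:
  fixes f :: "'a::euclidean_space \<Rightarrow> complex"
  assumes f: "integrable lborel f" and f2: "integrable lborel (\<lambda>x. (cmod (f x))\<^sup>2)" and s: "s > 0"
  shows "(\<integral>\<^sup>+\<omega>. ennreal ((cmod (\<integral>x. f x * cis (- (x \<bullet> \<omega>)) \<partial>lborel))\<^sup>2 * exp (- s * (norm \<omega>)\<^sup>2)) \<partial>lborel)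
     \<le> ennreal ((2 * pi) powr real DIM('a) * (\<integral>x. (cmod (f x))\<^sup>2 \<partial>lborel))"
proof -
  have [measurable]: "f \<in> borel_measurable borel" using f by simp
  define F where "F \<omega> = (\<integral>x. f x * cis (- (x \<bullet> \<omega>)) \<partial>lborel)" for \<omega>
  define G :: "'a \<Rightarrow> complex" where "G \<omega> = complex_of_real (exp (- s * (norm \<omega>)\<^sup>2))" for \<omega>
  define c where "c = (pi / s) powr (real DIM('a) / 2)"
  define E where "E x y = exp (- (norm (y - x))\<^sup>2 / (4 * s))" for x y :: 'a
  have [measurable]: "(\<lambda>(x, y). E x y) \<in> borel_measurable (borel \<Otimes>\<^sub>M borel)"
    unfolding E_def by measurable
  have c0: "c \<ge> 0" by (simp add: c_def)
  have [measurable]: "F \<in> borel_measurable borel" unfolding F_def by measurable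
  have [measurable]: "G \<in> borel_measurable borel" unfolding G_def by measurable
  have G: "integrable lborel G"
    unfolding G_def using integrable_gaussian_cis[OF s, of "0::'a"] by simp
  have Fb: "cmod (F \<omega>) \<le> (\<integral>x. cmod (f x) \<partial>lborel)" for \<omega>
    unfolding F_def using integral_norm_bound[of lborel "\<lambda>x. f x * cis (- (x \<bullet> \<omega>))"]
    by (simp add: norm_mult)
  have [measurable]: "(\<lambda>\<omega>. cnj (F \<omega>)) \<in> borel_measurable borel"
    by (rule borel_measurable_continuous_on[OF _ \<open>F \<in> borel_measurable borel\<close>]) (intro continuous_intros)
  \<comment> \<open>\<open>F\<close> is bounded by the L1 norm of \<open>f\<close>, so the Gaussian
    factor alone gives integrability; square integrability of \<open>F\<close> is what remains to be
    shown.\<close>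
  have v: "integrable lborel (\<lambda>\<omega>. cnj (F \<omega>) * G \<omega>)"
    using G Fb by (intro Bochner_Integration.integrable_bound[OF integrable_mult_right[OF G, of "complex_of_real (\<integral>x. cmod (f x) \<partial>lborel)"]])
      (auto simp: norm_mult intro!: always_eventually mult_right_mono)
  have FG: "F \<omega> * (cnj (F \<omega>) * G \<omega>) = complex_of_real ((cmod (F \<omega>))\<^sup>2 * exp (- s * (norm \<omega>)\<^sup>2))" for \<omega>
    by (simp only: of_real_mult complex_norm_square G_def mult_ac)
  have cnjF: "cnj (F \<omega>) = (\<integral>y. cnj (f y) * cis (y \<bullet> \<omega>) \<partial>lborel)" for \<omega>
    using Bochner_Integration.integral_cnj[of lborel "\<lambda>x. f x * cis (- (x \<bullet> \<omega>))"] by (simp add: F_def cis_cnj)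
  have inner: "(\<integral>\<omega>. cnj (F \<omega>) * G \<omega> * cis (- (x \<bullet> \<omega>)) \<partial>lborel)
      = (\<integral>y. cnj (f y) * complex_of_real (c * E x y) \<partial>lborel)" for x
  proof -
    have Gy: "(\<integral>\<omega>. G \<omega> * cis (- (x \<bullet> \<omega>)) * cis (y \<bullet> \<omega>) \<partial>lborel) = complex_of_real (c * E x y)" for y
    proof -
      have "(\<lambda>\<omega>. G \<omega> * cis (- (x \<bullet> \<omega>)) * cis (y \<bullet> \<omega>)) = (\<lambda>\<omega>. G \<omega> * cis (\<omega> \<bullet> (y - x)))"
        by (auto simp: mult.assoc cis_mult inner_diff_right inner_commute)
      then show ?thesis unfolding G_def using integral_gaussian_cis[OF s, of "y - x"]
        by (simp add: c_def E_def del: of_real_exp)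
    qed
    have "(\<integral>\<omega>. cnj (F \<omega>) * G \<omega> * cis (- (x \<bullet> \<omega>)) \<partial>lborel)
       = (\<integral>\<omega>. (\<integral>y. cnj (f y) * cis (y \<bullet> \<omega>) \<partial>lborel) * (G \<omega> * cis (- (x \<bullet> \<omega>))) \<partial>lborel)"
      by (simp add: cnjF mult.assoc)
    also have "\<dots> = (\<integral>y. cnj (f y) * (\<integral>\<omega>. G \<omega> * cis (- (x \<bullet> \<omega>)) * cis (y \<bullet> \<omega>) \<partial>lborel) \<partial>lborel)"
      using f by (intro integral_bounded_kernel_swap integrable_mult_cis G)
        (auto simp: split_beta intro!: continuous_intros)
    also have "\<dots> = (\<integral>y. cnj (f y) * complex_of_real (c * E x y) \<partial>lborel)"
      unfolding Gy ..
    finally show ?thesis .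
  qed
  have "complex_of_real (\<integral>\<omega>. (cmod (F \<omega>))\<^sup>2 * exp (- s * (norm \<omega>)\<^sup>2) \<partial>lborel)
      = (\<integral>\<omega>. F \<omega> * (cnj (F \<omega>) * G \<omega>) \<partial>lborel)"
    unfolding FG by (rule integral_complex_of_real[symmetric])
  also have "\<dots> = (\<integral>\<omega>. (\<integral>x. f x * cis (- (x \<bullet> \<omega>)) \<partial>lborel) * (cnj (F \<omega>) * G \<omega>) \<partial>lborel)"
    by (simp only: F_def)
  also have "\<dots> = (\<integral>x. f x * (\<integral>\<omega>. (cnj (F \<omega>) * G \<omega>) * cis (- (x \<bullet> \<omega>)) \<partial>lborel) \<partial>lborel)"
    by (rule integral_bounded_kernel_swap[OF f v]) (auto simp: split_beta intro!: continuous_intros)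
  also have "\<dots> = (\<integral>x. f x * (\<integral>y. cnj (f y) * complex_of_real (c * E x y) \<partial>lborel) \<partial>lborel)"
    unfolding inner ..
  finally have I: "complex_of_real (\<integral>\<omega>. (cmod (F \<omega>))\<^sup>2 * exp (- s * (norm \<omega>)\<^sup>2) \<partial>lborel)
     = (\<integral>x. f x * (\<integral>y. cnj (f y) * complex_of_real (c * E x y) \<partial>lborel) \<partial>lborel)" .
  have "ennreal (\<bar>\<integral>\<omega>. (cmod (F \<omega>))\<^sup>2 * exp (- s * (norm \<omega>)\<^sup>2) \<partial>lborel\<bar>)
     = ennreal (cmod (\<integral>x. f x * (\<integral>y. cnj (f y) * complex_of_real (c * E x y) \<partial>lborel) \<partial>lborel))"
    unfolding I[symmetric] norm_of_real ..
  also have "\<dots> \<le> (\<integral>\<^sup>+x. ennreal (cmod (f x * (\<integral>y. cnj (f y) * complex_of_real (c * E x y) \<partial>lborel))) \<partial>lborel)"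
    by (rule ennreal_norm_integral_le)
  also have "\<dots> \<le> (\<integral>\<^sup>+x. \<integral>\<^sup>+y. ennreal (c / 2 * (cmod (f x))\<^sup>2) * ennreal (E x y)
        + ennreal (c / 2 * (cmod (f y))\<^sup>2) * ennreal (E x y) \<partial>lborel \<partial>lborel)"
  proof (rule nn_integral_mono)
    fix x
    have "ennreal (cmod (f x * (\<integral>y. cnj (f y) * complex_of_real (c * E x y) \<partial>lborel)))
      = ennreal (cmod (\<integral>y. f x * (cnj (f y) * complex_of_real (c * E x y)) \<partial>lborel))" by simp
    also have "\<dots> \<le> (\<integral>\<^sup>+y. ennreal (cmod (f x * (cnj (f y) * complex_of_real (c * E x y)))) \<partial>lborel)"
      by (rule ennreal_norm_integral_le)
    also have "\<dots> \<le> (\<integral>\<^sup>+y. ennreal (c / 2 * (cmod (f x))\<^sup>2) * ennreal (E x y)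
        + ennreal (c / 2 * (cmod (f y))\<^sup>2) * ennreal (E x y) \<partial>lborel)"
    proof (rule nn_integral_mono)
      fix y
      have "2 * (cmod (f x) * cmod (f y)) * (c * E x y) \<le> ((cmod (f x))\<^sup>2 + (cmod (f y))\<^sup>2) * (c * E x y)"
        using sum_squares_bound[of "cmod (f x)" "cmod (f y)"] c0
        by (intro mult_right_mono) (auto simp: E_def)
      then have "cmod (f x * (cnj (f y) * complex_of_real (c * E x y)))
          \<le> c / 2 * (cmod (f x))\<^sup>2 * E x y + c / 2 * (cmod (f y))\<^sup>2 * E x y"
        using c0 by (simp add: norm_mult E_def algebra_simps)
      then show "ennreal (cmod (f x * (cnj (f y) * complex_of_real (c * E x y))))
        \<le> ennreal (c / 2 * (cmod (f x))\<^sup>2) * ennreal (E x y) + ennreal (c / 2 * (cmod (f y))\<^sup>2) * ennreal (E x y)"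
        using c0 by (simp add: E_def ennreal_mult[symmetric] ennreal_plus[symmetric] ennreal_leI del: ennreal_plus)
    qed
    finally show "ennreal (cmod (f x * (\<integral>y. cnj (f y) * complex_of_real (c * E x y) \<partial>lborel)))
       \<le> (\<integral>\<^sup>+y. ennreal (c / 2 * (cmod (f x))\<^sup>2) * ennreal (E x y)
        + ennreal (c / 2 * (cmod (f y))\<^sup>2) * ennreal (E x y) \<partial>lborel)" .
  qed
  also have "\<dots> = (\<integral>\<^sup>+x. \<integral>\<^sup>+y. ennreal (c / 2 * (cmod (f x))\<^sup>2) * ennreal (E x y) \<partial>lborel \<partial>lborel)
        + (\<integral>\<^sup>+x. \<integral>\<^sup>+y. ennreal (c / 2 * (cmod (f y))\<^sup>2) * ennreal (E x y) \<partial>lborel \<partial>lborel)"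
    by (subst nn_integral_add, simp, simp, rule nn_integral_add) measurable
  \<comment> \<open>By Tonelli and the symmetry of \<open>E\<close>, the second half of the
    symmetrised bound equals the first.\<close>
  also have "(\<integral>\<^sup>+x. \<integral>\<^sup>+y. ennreal (c / 2 * (cmod (f y))\<^sup>2) * ennreal (E x y) \<partial>lborel \<partial>lborel)
     = (\<integral>\<^sup>+y. \<integral>\<^sup>+x. ennreal (c / 2 * (cmod (f y))\<^sup>2) * ennreal (E x y) \<partial>lborel \<partial>lborel)"
    by (rule lborel_pair.Fubini'[symmetric]) measurable
  also have "\<dots> = (\<integral>\<^sup>+x. \<integral>\<^sup>+y. ennreal (c / 2 * (cmod (f x))\<^sup>2) * ennreal (E x y) \<partial>lborel \<partial>lborel)"
    by (simp add: E_def norm_minus_commute)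
  also have "\<dots> = (\<integral>\<^sup>+x. ennreal (c / 2 * (cmod (f x))\<^sup>2) * ennreal ((4 * pi * s) powr (real DIM('a) / 2)) \<partial>lborel)"
  proof -
    have "(\<integral>\<^sup>+y. ennreal (E x y) \<partial>lborel) = ennreal ((4 * pi * s) powr (real DIM('a) / 2))" for x
      using nn_integral_gaussian_translate[of "1 / (4 * s)" x] s by (simp add: E_def mult_ac)
    then show ?thesis
      by (subst nn_integral_cmult) (auto simp: E_def)
  qed
  also have "\<dots> = ennreal (c / 2 * (4 * pi * s) powr (real DIM('a) / 2) * (\<integral>x. (cmod (f x))\<^sup>2 \<partial>lborel))"
    using c0 f2 by (subst nn_integral_multc)
      (auto simp: nn_integral_eq_integral ennreal_mult[symmetric] mult_ac)
  also have "\<dots> + \<dots> = ennreal ((c * (4 * pi * s) powr (real DIM('a) / 2)) * (\<integral>x. (cmod (f x))\<^sup>2 \<partial>lborel))"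
    using c0 by (simp add: ennreal_plus[symmetric] field_simps del: ennreal_plus)
  \<comment> \<open>The powers of \<open>s\<close> cancel, so the bound is uniform in
    \<open>s\<close>; this permits the limit in \<open>bessel_fourier\<close>.\<close>
  also have "c * (4 * pi * s) powr (real DIM('a) / 2) = ((2 * pi)\<^sup>2) powr (real DIM('a) / 2)"
    unfolding c_def using s by (simp add: powr_mult[symmetric] power2_eq_square mult.left_commute)
  also have "\<dots> = (2 * pi) powr real DIM('a)"
    using powr_powr[of "2 * pi" 2 "real DIM('a) / 2"] by simp
  finally have "ennreal (\<bar>\<integral>\<omega>. (cmod (F \<omega>))\<^sup>2 * exp (- s * (norm \<omega>)\<^sup>2) \<partial>lborel\<bar>)
    \<le> ennreal ((2 * pi) powr real DIM('a) * (\<integral>x. (cmod (f x))\<^sup>2 \<partial>lborel))" .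
  \<comment> \<open>A bound on a Bochner integral carries no information for a non-integrable
    function; integrability transfers it to the nonnegative integral.\<close>
  moreover have "integrable lborel (\<lambda>\<omega>. (cmod (F \<omega>))\<^sup>2 * exp (- s * (norm \<omega>)\<^sup>2))"
  proof (rule Bochner_Integration.integrable_bound[OF integrable_mult_right[OF integrable_gaussian[OF s], of "(\<integral>x. cmod (f x) \<partial>lborel)\<^sup>2"]])
    show "AE \<omega> in lborel. norm ((cmod (F \<omega>))\<^sup>2 * exp (- s * (norm \<omega>)\<^sup>2))
       \<le> norm ((\<integral>x. cmod (f x) \<partial>lborel)\<^sup>2 * exp (- s * (norm \<omega>)\<^sup>2))"
      using Fb by (auto intro!: power_mono)
  qed simp
  ultimately show ?thesis
    unfolding F_def[symmetric] by (subst nn_integral_eq_integral) auto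
qed

text \<open>This is Bessel's inequality and has nothing to do with \<open>besselK\<close>. Fatou's
  lemma along the weights \<open>s = 1 / (n + 1)\<close> removes the Gaussian from
  \<open>bessel_gaussian_weight\<close>; the factor \<open>(2 * pi) powr real DIM('a)\<close> there
  is absorbed by the unitary normalisation of \<open>fourier\<close>.\<close>

lemma bessel_fourier:
  fixes f :: "'a::euclidean_space \<Rightarrow> complex"
  assumes f: "integrable lborel f" and f2: "integrable lborel (\<lambda>x. (cmod (f x))\<^sup>2)"
  shows "integrable lborel (\<lambda>\<omega>. (cmod (fourier f \<omega>))\<^sup>2)"
    and "(\<integral>\<omega>. (cmod (fourier f \<omega>))\<^sup>2 \<partial>lborel) \<le> (\<integral>x. (cmod (f x))\<^sup>2 \<partial>lborel)"
proof -
  have [measurable]: "f \<in> borel_measurable borel" using f by simp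
  define C where "C = (2 * pi) powr real DIM('a)"
  define I where "I = (\<integral>x. (cmod (f x))\<^sup>2 \<partial>lborel)"
  have I0: "I \<ge> 0" by (simp add: I_def)
  define F where "F \<omega> = (\<integral>x. f x * cis (- (x \<bullet> \<omega>)) \<partial>lborel)" for \<omega>
  have [measurable]: "F \<in> borel_measurable borel" unfolding F_def by measurable
  let ?u = "\<lambda>n \<omega>. ennreal ((cmod (F \<omega>))\<^sup>2 * exp (- inverse (real (Suc n)) * (norm \<omega>)\<^sup>2))"
  have lim: "(\<lambda>n. ?u n \<omega>) \<longlonglongrightarrow> ennreal ((cmod (F \<omega>))\<^sup>2)" for \<omega>
  proof -
    have "(\<lambda>n. (cmod (F \<omega>))\<^sup>2 * exp (- inverse (real (Suc n)) * (norm \<omega>)\<^sup>2)) \<longlonglongrightarrow> (cmod (F \<omega>))\<^sup>2 * exp (- 0 * (norm \<omega>)\<^sup>2)"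
      by (intro tendsto_intros LIMSEQ_inverse_real_of_nat)
    then show ?thesis by (intro tendsto_ennrealI) simp
  qed
  have "(\<integral>\<^sup>+\<omega>. ennreal ((cmod (F \<omega>))\<^sup>2) \<partial>lborel) = (\<integral>\<^sup>+\<omega>. liminf (\<lambda>n. ?u n \<omega>) \<partial>lborel)"
    by (intro nn_integral_cong lim_imp_Liminf[symmetric] lim) simp
  also have "\<dots> \<le> liminf (\<lambda>n. \<integral>\<^sup>+\<omega>. ?u n \<omega> \<partial>lborel)"
    by (rule nn_integral_liminf) simp
  also have "\<dots> \<le> liminf (\<lambda>n. ennreal (C * I))"
    unfolding C_def I_def F_def
    by (intro Liminf_mono always_eventually allI bessel_gaussian_weight[OF f f2]) simp
  finally have le: "(\<integral>\<^sup>+\<omega>. ennreal ((cmod (F \<omega>))\<^sup>2) \<partial>lborel) \<le> ennreal (C * I)"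
    by (simp add: Liminf_const)
  have C: "C > 0" by (simp add: C_def)
  have int: "integrable lborel (\<lambda>\<omega>. (cmod (F \<omega>))\<^sup>2)"
    using le_less_trans[OF le ennreal_less_top] by (intro integrableI_bounded) simp_all
  have fF: "(cmod (fourier f \<omega>))\<^sup>2 = (1 / C) * (cmod (F \<omega>))\<^sup>2" for \<omega>
  proof -
    have "((2 * pi) powr (- real DIM('a) / 2))\<^sup>2 = 1 / C"
      unfolding C_def power2_eq_square powr_add[symmetric] by (simp add: powr_minus_divide)
    then show ?thesis unfolding fourier_cis F_def[symmetric] by (simp add: norm_mult power_mult_distrib)
  qed
  show "integrable lborel (\<lambda>\<omega>. (cmod (fourier f \<omega>))\<^sup>2)"
    unfolding fF using int by simp
  have "(\<integral>\<omega>. (cmod (F \<omega>))\<^sup>2 \<partial>lborel) \<le> C * I"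
    using le int C I0 by (subst (asm) nn_integral_eq_integral) (auto simp: ennreal_le_iff)
  then show "(\<integral>\<omega>. (cmod (fourier f \<omega>))\<^sup>2 \<partial>lborel) \<le> I"
    unfolding fF using C by (simp add: field_simps)
qed

section \<open>The L2 Fourier transform: uniqueness and agreement with the Fourier integral\<close>

lemma cmod_diff_square_le: "(cmod (a - b))\<^sup>2 \<le> 2 * (cmod a)\<^sup>2 + 2 * (cmod b)\<^sup>2"
proof -
  have "(cmod (a - b))\<^sup>2 \<le> (cmod a + cmod b)\<^sup>2"
    by (intro power_mono norm_triangle_ineq4) simp
  also have "\<dots> \<le> 2 * (cmod a)\<^sup>2 + 2 * (cmod b)\<^sup>2"
    using sum_squares_bound[of "cmod a" "cmod b"] by (simp add: power2_sum)
  finally show ?thesis .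
qed

lemma square_integrable_diff:
  fixes f g :: "'a \<Rightarrow> complex"
  assumes [measurable]: "f \<in> borel_measurable M" "g \<in> borel_measurable M"
    and "integrable M (\<lambda>x. (cmod (f x))\<^sup>2)" "integrable M (\<lambda>x. (cmod (g x))\<^sup>2)"
  shows "integrable M (\<lambda>x. (cmod (f x - g x))\<^sup>2)"
proof (rule Bochner_Integration.integrable_bound)
  show "integrable M (\<lambda>x. 2 * (cmod (f x))\<^sup>2 + 2 * (cmod (g x))\<^sup>2)"
    using assms by simp
qed (use cmod_diff_square_le in \<open>auto\<close>)

lemma fourier_diff:
  fixes f g :: "'a::euclidean_space \<Rightarrow> complex"
  assumes "integrable lborel f" "integrable lborel g"
  shows "fourier (\<lambda>x. f x - g x) \<omega> = fourier f \<omega> - fourier g \<omega>"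
  unfolding fourier_cis left_diff_distrib using assms
  by (subst Bochner_Integration.integral_diff) (auto intro!: integrable_mult_cis simp: algebra_simps)

text \<open>Supplies the hypotheses of \<open>bessel_fourier\<close> for the truncations in
  \<open>L2_fourier\<close>: a continuous function is bounded on a closed ball.\<close>

lemma truncation_integrable:
  fixes F :: "'a::euclidean_space \<Rightarrow> real"
  assumes F: "continuous_on UNIV F"
  shows "integrable lborel (\<lambda>x. complex_of_real (indicator (ball 0 R) x * F x))"
    and "integrable lborel (\<lambda>x. (cmod (complex_of_real (indicator (ball 0 R) x * F x)))\<^sup>2)"
proof -
  have [measurable]: "F \<in> borel_measurable borel" by (intro borel_measurable_continuous_onI F)
  have [measurable]: "ball 0 R \<in> sets (borel :: 'a measure)" for R by simp
  have "bounded (F ` cball 0 R)"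
    using F by (intro compact_imp_bounded compact_continuous_image) (auto intro: continuous_on_subset)
  then obtain B where "\<forall>v\<in>F ` cball 0 R. norm v \<le> B" unfolding bounded_iff by blast
  then have B: "\<bar>F x\<bar> \<le> B" if "x \<in> cball 0 R" for x using that by auto
  have fin: "emeasure lborel (ball (0::'a) R) < \<infinity>"
    by (intro emeasure_bounded_finite) simp
  show "integrable lborel (\<lambda>x. complex_of_real (indicator (ball 0 R) x * F x))"
    using B fin by (intro integrableI_bounded_set[where A = "ball 0 R" and B = B]) auto
  have "(F x)\<^sup>2 \<le> B\<^sup>2" if "x \<in> ball 0 R" for x
    using B[of x] that by (simp add: abs_le_square_iff[symmetric])
  then show "integrable lborel (\<lambda>x. (cmod (complex_of_real (indicator (ball 0 R) x * F x)))\<^sup>2)"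
    using fin by (intro integrableI_bounded_set[where A = "ball 0 R" and B = "B\<^sup>2"]) auto
qed

text \<open>Both \<open>g\<close> and \<open>h\<close> are L2 limits of the same family, hence at
  distance 0. Bessel's inequality makes the transforms of the truncations square integrable;
  otherwise the integrals in \<open>L2_fourier\<close> could be 0 by default and say
  nothing.\<close>

lemma L2_fourier_unique:
  fixes F :: "'a::euclidean_space \<Rightarrow> real"
  assumes F: "continuous_on UNIV F" and g: "L2_fourier F g" and h: "L2_fourier F h"
  shows "AE \<omega> in lborel. g \<omega> = h \<omega>"
proof -
  let ?t = "\<lambda>R x. complex_of_real (indicator (ball 0 R) x * F x)"
  have [measurable]: "F \<in> borel_measurable borel" by (intro borel_measurable_continuous_onI F)
  have [measurable]: "ball 0 R \<in> sets (borel :: 'a measure)" for R by simp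
  have [measurable]: "g \<in> borel_measurable borel" "h \<in> borel_measurable borel"
    using g h by (auto simp: L2_fourier_def)
  have t2: "integrable lborel (\<lambda>\<omega>. (cmod (fourier (?t R) \<omega>))\<^sup>2)" for R
    by (intro bessel_fourier(1) truncation_integrable F)
  have g2: "integrable lborel (\<lambda>\<omega>. (cmod (g \<omega>))\<^sup>2)" and h2: "integrable lborel (\<lambda>\<omega>. (cmod (h \<omega>))\<^sup>2)"
    using g h by (auto simp: L2_fourier_def)
  define d where "d f R = (\<integral>\<omega>. (cmod (fourier (?t R) \<omega> - f \<omega>))\<^sup>2 \<partial>lborel)" for f R
  have gh: "integrable lborel (\<lambda>\<omega>. (cmod (g \<omega> - h \<omega>))\<^sup>2)"
    by (intro square_integrable_diff g2 h2) auto
  have le: "(\<integral>\<omega>. (cmod (g \<omega> - h \<omega>))\<^sup>2 \<partial>lborel) \<le> 2 * d h R + 2 * d g R" for R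
  proof -
    have [measurable]: "fourier (?t R) \<in> borel_measurable borel"
      by (intro borel_measurable_fourier) measurable
    have i: "integrable lborel (\<lambda>\<omega>. (cmod (fourier (?t R) \<omega> - h \<omega>))\<^sup>2)"
      "integrable lborel (\<lambda>\<omega>. (cmod (fourier (?t R) \<omega> - g \<omega>))\<^sup>2)"
      by (rule square_integrable_diff[OF _ _ t2 h2]; measurable)
         (rule square_integrable_diff[OF _ _ t2 g2]; measurable)
    have "(\<integral>\<omega>. (cmod (g \<omega> - h \<omega>))\<^sup>2 \<partial>lborel)
       \<le> (\<integral>\<omega>. 2 * (cmod (fourier (?t R) \<omega> - h \<omega>))\<^sup>2 + 2 * (cmod (fourier (?t R) \<omega> - g \<omega>))\<^sup>2 \<partial>lborel)"
    proof (rule integral_mono[OF gh])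
      show "integrable lborel (\<lambda>\<omega>. 2 * (cmod (fourier (?t R) \<omega> - h \<omega>))\<^sup>2 + 2 * (cmod (fourier (?t R) \<omega> - g \<omega>))\<^sup>2)"
        using i by simp
      show "(cmod (g \<omega> - h \<omega>))\<^sup>2 \<le> 2 * (cmod (fourier (?t R) \<omega> - h \<omega>))\<^sup>2 + 2 * (cmod (fourier (?t R) \<omega> - g \<omega>))\<^sup>2" for \<omega>
        using cmod_diff_square_le[of "fourier (?t R) \<omega> - h \<omega>" "fourier (?t R) \<omega> - g \<omega>"] by simp
    qed
    also have "\<dots> = 2 * d h R + 2 * d g R"
      unfolding d_def using i by simp
    finally show ?thesis .
  qed
  have "((\<lambda>R. 2 * d h R + 2 * d g R) \<longlongrightarrow> 2 * 0 + 2 * 0) at_top"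
    using g h unfolding L2_fourier_def d_def by (intro tendsto_intros) auto
  then have "(\<integral>\<omega>. (cmod (g \<omega> - h \<omega>))\<^sup>2 \<partial>lborel) \<le> 2 * 0 + 2 * 0"
    by (rule tendsto_lowerbound) (auto intro!: always_eventually le)
  then have "(\<integral>\<omega>. (cmod (g \<omega> - h \<omega>))\<^sup>2 \<partial>lborel) = 0"
    by (intro antisym) auto
  then show ?thesis
    using integral_nonneg_eq_0_iff_AE[OF gh] by auto
qed

text \<open>Bessel's inequality for the truncation minus \<open>f\<close> bounds the L2 distance of
  the transforms by that of the functions, which tends to 0 by dominated convergence.\<close>

lemma L2_fourier_fourier:
  fixes f :: "'a::euclidean_space \<Rightarrow> real"
  assumes f: "integrable lborel f" and f2: "integrable lborel (\<lambda>x. (f x)\<^sup>2)"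
  shows "L2_fourier f (fourier (\<lambda>x. complex_of_real (f x)))"
proof -
  let ?f = "\<lambda>x. complex_of_real (f x)"
  let ?t = "\<lambda>R x. complex_of_real (indicator (ball 0 R) x * f x)"
  have [measurable]: "f \<in> borel_measurable borel" using f by simp
  have fc: "integrable lborel ?f" "integrable lborel (\<lambda>x. (cmod (?f x))\<^sup>2)" using f f2 by auto
  have t: "integrable lborel (?t R)" for R
    by (rule Bochner_Integration.integrable_bound[OF f]) (auto simp: indicator_def)
  have d: "integrable lborel (\<lambda>x. ?t R x - ?f x)" for R using t fc by simp
  have d2: "integrable lborel (\<lambda>x. (cmod (?t R x - ?f x))\<^sup>2)" for R
    by (rule Bochner_Integration.integrable_bound[OF f2]) (auto simp: indicator_def)
  have le: "(\<integral>\<omega>. (cmod (fourier (?t R) \<omega> - fourier ?f \<omega>))\<^sup>2 \<partial>lborel) \<le> (\<integral>x. (cmod (?t R x - ?f x))\<^sup>2 \<partial>lborel)" for R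
    using bessel_fourier(2)[OF d d2, of R] fourier_diff[OF t fc(1), of R] by simp
  have lim0: "((\<lambda>R. \<integral>x. (cmod (?t R x - ?f x))\<^sup>2 \<partial>lborel) \<longlongrightarrow> (\<integral>x. 0 \<partial>(lborel :: 'a measure))) at_top"
  proof (rule integral_dominated_convergence_at_top[where w = "\<lambda>x. (f x)\<^sup>2"])
    show "AE x in lborel. ((\<lambda>R. (cmod (?t R x - ?f x))\<^sup>2) \<longlongrightarrow> 0) at_top"
    proof (rule AE_I2)
      fix x :: 'a
      have "eventually (\<lambda>R. (cmod (?t R x - ?f x))\<^sup>2 = 0) at_top"
        using eventually_gt_at_top[of "norm x"] by eventually_elim (simp add: indicator_def)
      then show "((\<lambda>R. (cmod (?t R x - ?f x))\<^sup>2) \<longlongrightarrow> 0) at_top" by (rule tendsto_eventually)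
    qed
  qed (use f2 in \<open>auto simp: indicator_def\<close>)
  have "((\<lambda>R. \<integral>\<omega>. (cmod (fourier (?t R) \<omega> - fourier ?f \<omega>))\<^sup>2 \<partial>lborel) \<longlongrightarrow> 0) at_top"
    by (rule real_tendsto_sandwich[OF _ _ tendsto_const])
       (use le lim0 in \<open>auto intro!: always_eventually\<close>)
  then show ?thesis
    unfolding L2_fourier_def using bessel_fourier(1)[OF fc] by simp
qed

section \<open>Fourier inversion at every point\<close>

text \<open>The Gaussians \<open>c \<tau> * E \<tau> y\<close> have total mass 1 and concentrate at
  \<open>x\<close>, near which continuity is used. As \<open>F\<close> may be unbounded, the far
  part is compared with the fixed integrable function \<open>\<bar>F y - F x\<bar> * E 1 y\<close>,
  and the decay in \<open>\<tau>\<close> comes from \<open>\<eta> \<tau>\<close>.\<close>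

lemma gaussian_approximate_identity:
  fixes F :: "'a::euclidean_space \<Rightarrow> real"
  assumes F: "continuous_on UNIV F" and F2: "integrable lborel (\<lambda>y. (F y)\<^sup>2)"
  shows "((\<lambda>\<tau>. (\<tau> / pi) powr (real DIM('a) / 2) * (\<integral>y. F y * exp (- \<tau> * (norm (y - x))\<^sup>2) \<partial>lborel)) \<longlongrightarrow> F x) at_top"
    and "\<tau> > 0 \<Longrightarrow> integrable lborel (\<lambda>y. F y * exp (- \<tau> * (norm (y - x))\<^sup>2))"
proof -
  have [measurable]: "F \<in> borel_measurable borel" by (intro borel_measurable_continuous_onI F)
  define E where "E \<tau> y = exp (- \<tau> * (norm (y - x))\<^sup>2)" for \<tau> and y
  have [measurable]: "E \<tau> \<in> borel_measurable borel" for \<tau> unfolding E_def by measurable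
  have Epos: "E \<tau> y > 0" for \<tau> y by (simp add: E_def)
  have E: "integrable lborel (E \<tau>)" and IE: "(\<integral>y. E \<tau> y \<partial>lborel) = (pi / \<tau>) powr (real DIM('a) / 2)" if "\<tau> > 0" for \<tau>
    using integrable_lborel_translate[OF integrable_gaussian[OF that], of x]
      integral_lborel_translate[OF integrable_gaussian[OF that], of x] integral_gaussian[OF that, where 'a='a]
    by (simp_all add: E_def[abs_def])
  have FE: "integrable lborel (\<lambda>y. F y * E \<tau> y)" if "\<tau> > 0" for \<tau>
  proof (rule Bochner_Integration.integrable_bound)
    show "integrable lborel (\<lambda>y. (F y)\<^sup>2 + E \<tau> y)" using F2 E[OF that] by simp
    show "AE y in lborel. norm (F y * E \<tau> y) \<le> norm ((F y)\<^sup>2 + E \<tau> y)"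
    proof (rule AE_I2)
      fix y
      have "E \<tau> y \<le> 1" using that by (simp add: E_def)
      have "\<bar>F y\<bar> * E \<tau> y \<le> (1 + (F y)\<^sup>2) * E \<tau> y"
        using sum_squares_bound[of 1 "\<bar>F y\<bar>"] Epos[of \<tau> y] by (intro mult_right_mono) auto
      also have "\<dots> \<le> E \<tau> y + (F y)\<^sup>2"
        using \<open>E \<tau> y \<le> 1\<close> mult_left_mono[of "E \<tau> y" 1 "(F y)\<^sup>2"] by (simp add: algebra_simps)
      finally show "norm (F y * E \<tau> y) \<le> norm ((F y)\<^sup>2 + E \<tau> y)"
        using Epos[of \<tau> y] by (simp add: abs_mult)
    qed
  qed simp
  then show "\<tau> > 0 \<Longrightarrow> integrable lborel (\<lambda>y. F y * exp (- \<tau> * (norm (y - x))\<^sup>2))"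
    by (simp add: E_def)
  have dE: "integrable lborel (\<lambda>y. (F y - F x) * E \<tau> y)" if "\<tau> > 0" for \<tau>
    using FE[OF that] E[OF that] by (simp add: left_diff_distrib)
  define c where "c \<tau> = (\<tau> / pi) powr (real DIM('a) / 2)" for \<tau>
  have c: "c \<tau> > 0" "c \<tau> * (\<integral>y. E \<tau> y \<partial>lborel) = 1" if "\<tau> > 0" for \<tau>
    using that by (auto simp: c_def IE powr_mult[symmetric])
  have main: "\<forall>\<^sub>F \<tau> in at_top. dist (c \<tau> * (\<integral>y. F y * E \<tau> y \<partial>lborel)) (F x) < \<epsilon>" if \<epsilon>: "\<epsilon> > 0" for \<epsilon>
  proof -
    have "isCont F x" using F by (simp add: continuous_on_eq_continuous_at)
    then obtain \<delta> where \<delta>: "\<delta> > 0" "\<And>y. norm (y - x) < \<delta> \<Longrightarrow> \<bar>F y - F x\<bar> < \<epsilon> / 2"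
      using \<epsilon> unfolding continuous_at_eps_delta dist_norm real_norm_def by (metis half_gt_zero)
    define M where "M = (\<integral>y. \<bar>F y - F x\<bar> * E 1 y \<partial>lborel)"
    have M: "integrable lborel (\<lambda>y. \<bar>F y - F x\<bar> * E 1 y)"
      using integrable_norm[OF dE[of 1]] Epos by (simp add: abs_mult less_imp_le)
    define \<eta> where "\<eta> \<tau> = c \<tau> * exp (- \<tau> * (\<delta>\<^sup>2 / 2))" for \<tau>
    have "(\<eta> \<longlongrightarrow> 0) at_top"
    proof -
      define k a where "k = \<delta>\<^sup>2 / 2" and "a = real DIM('a) / 2"
      have "k > 0" "a > 0" using \<delta> by (auto simp: k_def a_def)
      then have "((\<lambda>\<tau>. (\<tau> / pi) powr a * exp (- \<tau> * k)) \<longlongrightarrow> 0) at_top"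
        by real_asymp
      then show ?thesis unfolding \<eta>_def[abs_def] c_def k_def a_def .
    qed
    then have "((\<lambda>\<tau>. \<eta> \<tau> * M) \<longlongrightarrow> 0 * M) at_top" by (intro tendsto_intros)
    then have "\<forall>\<^sub>F \<tau> in at_top. \<eta> \<tau> * M < \<epsilon> / 2"
      using \<epsilon> by (intro order_tendstoD(2)[where y = "0 * M"]) auto
    \<comment> \<open>For \<open>\<tau>\<close> at least 2 the exponent splits in halves: one half
      dominates the exponent of \<open>E 1 y\<close>, the other is at least
      \<open>\<tau> * (\<delta>\<^sup>2 / 2)\<close> outside the ball of radius
      \<open>\<delta>\<close>.\<close>
    then show ?thesis using eventually_ge_at_top[of 2]
    proof eventually_elim
      case (elim \<tau>)
      then have \<tau>: "\<tau> > 0" by simp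
      have "c \<tau> * (\<integral>y. F y * E \<tau> y \<partial>lborel) - F x
          = c \<tau> * (\<integral>y. F y * E \<tau> y \<partial>lborel) - F x * (c \<tau> * (\<integral>y. E \<tau> y \<partial>lborel))"
        using c[OF \<tau>] by simp
      also have "\<dots> = c \<tau> * (\<integral>y. (F y - F x) * E \<tau> y \<partial>lborel)"
        using FE[OF \<tau>] E[OF \<tau>] by (simp add: left_diff_distrib right_diff_distrib)
      finally have "\<bar>c \<tau> * (\<integral>y. F y * E \<tau> y \<partial>lborel) - F x\<bar> = c \<tau> * \<bar>\<integral>y. (F y - F x) * E \<tau> y \<partial>lborel\<bar>"
        using c[OF \<tau>] by (simp add: abs_mult)
      also have "\<dots> \<le> c \<tau> * (\<integral>y. \<bar>F y - F x\<bar> * E \<tau> y \<partial>lborel)"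
        using integral_norm_bound[of lborel "\<lambda>y. (F y - F x) * E \<tau> y"] c[OF \<tau>] Epos
        by (intro mult_left_mono) (auto simp: abs_mult less_imp_le)
      also have "(\<integral>y. \<bar>F y - F x\<bar> * E \<tau> y \<partial>lborel)
          \<le> (\<integral>y. \<epsilon> / 2 * E \<tau> y + exp (- \<tau> * (\<delta>\<^sup>2 / 2)) * (\<bar>F y - F x\<bar> * E 1 y) \<partial>lborel)"
      proof (rule integral_mono)
        show "integrable lborel (\<lambda>y. \<bar>F y - F x\<bar> * E \<tau> y)"
          using integrable_norm[OF dE[OF \<tau>]] Epos by (simp add: abs_mult less_imp_le)
        show "integrable lborel (\<lambda>y. \<epsilon> / 2 * E \<tau> y + exp (- \<tau> * (\<delta>\<^sup>2 / 2)) * (\<bar>F y - F x\<bar> * E 1 y))"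
          using E[OF \<tau>] M by simp
        fix y
        show "\<bar>F y - F x\<bar> * E \<tau> y \<le> \<epsilon> / 2 * E \<tau> y + exp (- \<tau> * (\<delta>\<^sup>2 / 2)) * (\<bar>F y - F x\<bar> * E 1 y)"
        proof (cases "norm (y - x) < \<delta>")
          case True
          then have "\<bar>F y - F x\<bar> * E \<tau> y \<le> \<epsilon> / 2 * E \<tau> y"
            using \<delta>(2)[OF True] Epos[of \<tau> y] by (intro mult_right_mono) auto
          moreover have "0 \<le> exp (- \<tau> * (\<delta>\<^sup>2 / 2)) * (\<bar>F y - F x\<bar> * E 1 y)"
            using Epos[of 1 y] by simp
          ultimately show ?thesis by linarith
        next
          case False
          then have "\<delta>\<^sup>2 \<le> (norm (y - x))\<^sup>2" using \<delta> by (intro power_mono) auto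
          then have "\<tau> / 2 * \<delta>\<^sup>2 \<le> \<tau> / 2 * (norm (y - x))\<^sup>2" using \<tau> by (intro mult_left_mono) auto
          moreover have "1 * (norm (y - x))\<^sup>2 \<le> \<tau> / 2 * (norm (y - x))\<^sup>2"
            using elim by (intro mult_right_mono) auto
          ultimately have "E \<tau> y \<le> exp (- \<tau> * (\<delta>\<^sup>2 / 2)) * E 1 y"
            unfolding E_def exp_add[symmetric] by (simp add: algebra_simps)
          then have "\<bar>F y - F x\<bar> * E \<tau> y \<le> \<bar>F y - F x\<bar> * (exp (- \<tau> * (\<delta>\<^sup>2 / 2)) * E 1 y)"
            by (intro mult_left_mono) auto
          moreover have "0 \<le> \<epsilon> / 2 * E \<tau> y" using \<epsilon> Epos[of \<tau> y] by simp
          ultimately show ?thesis by (simp add: mult_ac)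
        qed
      qed
      also have "\<dots> = \<epsilon> / 2 * (\<integral>y. E \<tau> y \<partial>lborel) + exp (- \<tau> * (\<delta>\<^sup>2 / 2)) * M"
        unfolding M_def using E[OF \<tau>] M by simp
      also have "c \<tau> * \<dots> = \<epsilon> / 2 * (c \<tau> * (\<integral>y. E \<tau> y \<partial>lborel)) + \<eta> \<tau> * M"
        by (simp add: \<eta>_def algebra_simps)
      also have "\<dots> < \<epsilon>" using c[OF \<tau>] elim by simp
      finally show ?case using c[OF \<tau>] by (simp add: dist_real_def)
    qed
  qed
  then show "((\<lambda>\<tau>. (\<tau> / pi) powr (real DIM('a) / 2) * (\<integral>y. F y * exp (- \<tau> * (norm (y - x))\<^sup>2) \<partial>lborel)) \<longlongrightarrow> F x) at_top"
    unfolding E_def c_def by (rule tendstoI)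
qed

text \<open>Damping \<open>g\<close> by a Gaussian reduces inversion to Fubini on truncations and
  yields a Gaussian average of \<open>F\<close> around \<open>x\<close>. As \<open>\<tau>\<close>
  grows, that average tends to \<open>F x\<close> by continuity, while the frequency side converges
  by domination since \<open>g\<close> is integrable. The formula therefore holds at every point and
  not only almost everywhere.\<close>

lemma fourier_inversion_continuous:
  fixes F :: "'a::euclidean_space \<Rightarrow> real"
  assumes F: "continuous_on UNIV F" and F2: "integrable lborel (\<lambda>y. (F y)\<^sup>2)"
    and g: "L2_fourier F g" and g1: "integrable lborel g"
  shows "complex_of_real (F x) = complex_of_real ((2 * pi) powr (- real DIM('a) / 2)) * (\<integral>\<omega>. g \<omega> * cis (x \<bullet> \<omega>) \<partial>lborel)"
proof -
  let ?t = "\<lambda>R y. complex_of_real (indicator (ball 0 R) y * F y)"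
  let ?c = "complex_of_real ((2 * pi) powr (- real DIM('a) / 2))"
  have [measurable]: "F \<in> borel_measurable borel" by (intro borel_measurable_continuous_onI F)
  have [measurable]: "ball 0 R \<in> sets (borel :: 'a measure)" for R by simp
  have [measurable]: "g \<in> borel_measurable borel" using g by (auto simp: L2_fourier_def)
  have g2: "integrable lborel (\<lambda>\<omega>. (cmod (g \<omega>))\<^sup>2)" using g by (auto simp: L2_fourier_def)
  have [measurable]: "fourier (?t R) \<in> borel_measurable borel" for R
    by (intro borel_measurable_fourier) measurable
  have t1: "integrable lborel (?t R)" for R by (rule truncation_integrable[OF F])
  have t2: "integrable lborel (\<lambda>\<omega>. (cmod (fourier (?t R) \<omega>))\<^sup>2)" for R
    by (intro bessel_fourier(1) truncation_integrable F)
  define E where "E \<tau> y = exp (- \<tau> * (norm (y - x))\<^sup>2)" for \<tau> y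
  have [measurable]: "E \<tau> \<in> borel_measurable borel" for \<tau> unfolding E_def by measurable
  \<comment> \<open>The rate \<open>1 / (4 * \<tau>)\<close> and the phase are chosen so that the
    transform of \<open>v \<tau>\<close> is a multiple of \<open>E \<tau>\<close>, the Gaussian of
    rate \<open>\<tau>\<close> centred at \<open>x\<close>.\<close>
  define v where "v \<tau> \<omega> = complex_of_real (exp (- (1 / (4 * \<tau>)) * (norm \<omega>)\<^sup>2)) * cis (x \<bullet> \<omega>)" for \<tau> and \<omega> :: 'a
  have v_meas[measurable]: "v \<tau> \<in> borel_measurable borel" for \<tau> unfolding v_def by measurable
  have vnorm: "cmod (v \<tau> \<omega>) = exp (- (1 / (4 * \<tau>)) * (norm \<omega>)\<^sup>2)" for \<tau> \<omega>
    by (simp add: v_def norm_mult del: of_real_exp)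
  have key: "?c * (\<integral>\<omega>. g \<omega> * v \<tau> \<omega> \<partial>lborel)
      = complex_of_real ((\<tau> / pi) powr (real DIM('a) / 2) * (\<integral>y. F y * E \<tau> y \<partial>lborel))" if \<tau>: "\<tau> > 0" for \<tau>
  proof -
    define m where "m = (4 * pi * \<tau>) powr (real DIM('a) / 2)"
    have s: "1 / (4 * \<tau>) > 0" using \<tau> by simp
    have v1: "integrable lborel (v \<tau>)"
      using integrable_gaussian_cis[OF s, of x] by (simp add: v_def[abs_def] inner_commute)
    have v2: "integrable lborel (\<lambda>\<omega>. (cmod (v \<tau> \<omega>))\<^sup>2)"
    proof -
      have "(cmod (v \<tau> \<omega>))\<^sup>2 = exp (- (1 / (2 * \<tau>)) * (norm \<omega>)\<^sup>2)" for \<omega>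
        unfolding vnorm by (simp add: power2_eq_square[of "exp _"] exp_add[symmetric])
      then show ?thesis using \<tau> integrable_gaussian[of "1 / (2 * \<tau>)", where 'a = 'a] by simp
    qed
    have vE: "(\<integral>\<omega>. v \<tau> \<omega> * cis (- (y \<bullet> \<omega>)) \<partial>lborel) = complex_of_real (m * E \<tau> y)" for y
    proof -
      have "(\<lambda>\<omega>. v \<tau> \<omega> * cis (- (y \<bullet> \<omega>))) = (\<lambda>\<omega>. complex_of_real (exp (- (1 / (4 * \<tau>)) * (norm \<omega>)\<^sup>2)) * cis (\<omega> \<bullet> (x - y)))"
        by (auto simp: v_def mult.assoc cis_mult inner_diff_right inner_commute)
      then show ?thesis using integral_gaussian_cis[OF s, of "x - y"] \<tau>
        by (simp add: m_def E_def norm_minus_commute mult_ac del: of_real_exp)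
    qed
    have tR: "(\<integral>\<omega>. fourier (?t R) \<omega> * v \<tau> \<omega> \<partial>lborel) = ?c * complex_of_real m * (\<integral>y. ?t R y * complex_of_real (E \<tau> y) \<partial>lborel)" for R
    proof -
      have "(\<integral>\<omega>. fourier (?t R) \<omega> * v \<tau> \<omega> \<partial>lborel)
          = ?c * (\<integral>\<omega>. (\<integral>y. ?t R y * cis (- (y \<bullet> \<omega>)) \<partial>lborel) * v \<tau> \<omega> \<partial>lborel)"
        unfolding fourier_cis mult.assoc by (rule integral_mult_right_zero)
      also have "(\<integral>\<omega>. (\<integral>y. ?t R y * cis (- (y \<bullet> \<omega>)) \<partial>lborel) * v \<tau> \<omega> \<partial>lborel)
         = (\<integral>y. ?t R y * (\<integral>\<omega>. v \<tau> \<omega> * cis (- (y \<bullet> \<omega>)) \<partial>lborel) \<partial>lborel)"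
        by (rule integral_bounded_kernel_swap[OF t1 v1]) (auto simp: split_beta intro!: continuous_intros)
      also have "\<dots> = (\<integral>y. complex_of_real m * (?t R y * complex_of_real (E \<tau> y)) \<partial>lborel)"
        unfolding vE by (simp add: mult_ac)
      also have "\<dots> = complex_of_real m * (\<integral>y. ?t R y * complex_of_real (E \<tau> y) \<partial>lborel)"
        by (rule integral_mult_right_zero)
      finally show ?thesis by (simp only: mult.assoc)
    qed
    \<comment> \<open>The transforms of the truncations converge only in L2; pairing with the
      square-integrable \<open>v \<tau>\<close> gives convergence of numbers by
      Cauchy-Schwarz.\<close>
    have lim1: "((\<lambda>R. \<integral>\<omega>. fourier (?t R) \<omega> * v \<tau> \<omega> \<partial>lborel) \<longlongrightarrow> (\<integral>\<omega>. g \<omega> * v \<tau> \<omega> \<partial>lborel)) at_top"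
    proof -
      define d where "d R = (\<integral>\<omega>. (cmod (fourier (?t R) \<omega> - g \<omega>))\<^sup>2 \<partial>lborel)" for R
      define V where "V = (\<integral>\<omega>. (cmod (v \<tau> \<omega>))\<^sup>2 \<partial>lborel)"
      have "(d \<longlongrightarrow> 0) at_top" using g unfolding L2_fourier_def d_def[abs_def] by simp
      then have "((\<lambda>R. sqrt (d R * V)) \<longlongrightarrow> sqrt (0 * V)) at_top" by (intro tendsto_intros)
      then have 0: "((\<lambda>R. sqrt (d R * V)) \<longlongrightarrow> 0) at_top" by simp
      have "cmod ((\<integral>\<omega>. fourier (?t R) \<omega> * v \<tau> \<omega> \<partial>lborel) - (\<integral>\<omega>. g \<omega> * v \<tau> \<omega> \<partial>lborel)) \<le> sqrt (d R * V)" for R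
      proof (rule real_le_rsqrt)
        have i: "integrable lborel (\<lambda>\<omega>. fourier (?t R) \<omega> * v \<tau> \<omega>)" "integrable lborel (\<lambda>\<omega>. g \<omega> * v \<tau> \<omega>)"
          by (rule integrable_mult_of_square_integrable[OF _ _ t2 v2]; measurable)
             (rule integrable_mult_of_square_integrable[OF _ _ g2 v2]; measurable)
        have "integrable lborel (\<lambda>\<omega>. (cmod (fourier (?t R) \<omega> - g \<omega>))\<^sup>2)"
          by (rule square_integrable_diff[OF _ _ t2 g2]; measurable)
        then have "(cmod (\<integral>\<omega>. (fourier (?t R) \<omega> - g \<omega>) * v \<tau> \<omega> \<partial>lborel))\<^sup>2 \<le> d R * V"
          unfolding d_def V_def by (intro Cauchy_Schwarz_integral v2; measurable)
        then show "(cmod ((\<integral>\<omega>. fourier (?t R) \<omega> * v \<tau> \<omega> \<partial>lborel) - (\<integral>\<omega>. g \<omega> * v \<tau> \<omega> \<partial>lborel)))\<^sup>2 \<le> d R * V"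
          unfolding left_diff_distrib using i by (subst (asm) Bochner_Integration.integral_diff)
      qed
      then have "((\<lambda>R. (\<integral>\<omega>. fourier (?t R) \<omega> * v \<tau> \<omega> \<partial>lborel) - (\<integral>\<omega>. g \<omega> * v \<tau> \<omega> \<partial>lborel)) \<longlongrightarrow> 0) at_top"
        by (intro Lim_null_comparison[OF _ 0] always_eventually) auto
      then show ?thesis by (simp add: LIM_zero_iff)
    qed
    have FE: "integrable lborel (\<lambda>y. F y * E \<tau> y)"
      unfolding E_def by (rule gaussian_approximate_identity(2)[OF F F2 \<tau>])
    have lim2: "((\<lambda>R. \<integral>y. ?t R y * complex_of_real (E \<tau> y) \<partial>lborel) \<longlongrightarrow> (\<integral>y. complex_of_real (F y * E \<tau> y) \<partial>lborel)) at_top"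
    proof (rule integral_dominated_convergence_at_top[where w = "\<lambda>y. norm (F y * E \<tau> y)"])
      show "AE y in lborel. ((\<lambda>R. ?t R y * complex_of_real (E \<tau> y)) \<longlongrightarrow> complex_of_real (F y * E \<tau> y)) at_top"
      proof (rule AE_I2)
        fix y :: 'a
        have "eventually (\<lambda>R. ?t R y * complex_of_real (E \<tau> y) = complex_of_real (F y * E \<tau> y)) at_top"
          using eventually_gt_at_top[of "norm y"] by eventually_elim (simp add: indicator_def)
        then show "((\<lambda>R. ?t R y * complex_of_real (E \<tau> y)) \<longlongrightarrow> complex_of_real (F y * E \<tau> y)) at_top"
          by (rule tendsto_eventually)
      qed
      show "integrable lborel (\<lambda>y. norm (F y * E \<tau> y))" using FE by (rule integrable_norm)
      show "\<forall>\<^sub>F R in at_top. AE y in lborel. norm (?t R y * complex_of_real (E \<tau> y)) \<le> norm (F y * E \<tau> y)"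
        by (intro always_eventually allI AE_I2) (auto simp: indicator_def norm_mult)
    qed measurable
    have "((\<lambda>R. \<integral>\<omega>. fourier (?t R) \<omega> * v \<tau> \<omega> \<partial>lborel) \<longlongrightarrow> ?c * complex_of_real m * (\<integral>y. complex_of_real (F y * E \<tau> y) \<partial>lborel)) at_top"
      unfolding tR by (intro tendsto_mult_left lim2)
    with lim1 have "(\<integral>\<omega>. g \<omega> * v \<tau> \<omega> \<partial>lborel) = ?c * complex_of_real m * (\<integral>y. complex_of_real (F y * E \<tau> y) \<partial>lborel)"
      by (rule tendsto_unique[rotated]) simp
    also have "(\<integral>y. complex_of_real (F y * E \<tau> y) \<partial>lborel) = complex_of_real (\<integral>y. F y * E \<tau> y \<partial>lborel)"
      by (rule integral_complex_of_real)
    finally have eq: "(\<integral>\<omega>. g \<omega> * v \<tau> \<omega> \<partial>lborel) = ?c * complex_of_real m * complex_of_real (\<integral>y. F y * E \<tau> y \<partial>lborel)" .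
    \<comment> \<open>One factor \<open>?c\<close> stems from \<open>fourier\<close>, the other from
      the inversion formula; together with \<open>m\<close> they are exactly the normalisation of
      the approximate identity.\<close>
    have "?c * ?c * complex_of_real m = complex_of_real ((2 * pi) powr (- real DIM('a) / 2) * (2 * pi) powr (- real DIM('a) / 2) * m)"
      by simp
    also have "(2 * pi) powr (- real DIM('a) / 2) * (2 * pi) powr (- real DIM('a) / 2) * m = (\<tau> / pi) powr (real DIM('a) / 2)"
    proof -
      have "(2 * pi) powr (- real DIM('a) / 2) = (1 / (2 * pi)) powr (real DIM('a) / 2)"
        by (simp add: powr_minus_divide powr_divide)
      then show ?thesis using \<tau> by (simp add: m_def powr_mult[symmetric])
    qed
    finally show ?thesis unfolding eq by (simp add: mult.assoc[symmetric])
  qed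
  have L: "((\<lambda>\<tau>. ?c * (\<integral>\<omega>. g \<omega> * v \<tau> \<omega> \<partial>lborel)) \<longlongrightarrow> ?c * (\<integral>\<omega>. g \<omega> * cis (x \<bullet> \<omega>) \<partial>lborel)) at_top"
  proof (rule tendsto_mult_left, rule integral_dominated_convergence_at_top[where w = "\<lambda>\<omega>. cmod (g \<omega>)"])
    show "integrable lborel (\<lambda>\<omega>. cmod (g \<omega>))" using g1 by (rule integrable_norm)
    show "AE \<omega> in lborel. ((\<lambda>\<tau>. g \<omega> * v \<tau> \<omega>) \<longlongrightarrow> g \<omega> * cis (x \<bullet> \<omega>)) at_top"
    proof (rule AE_I2, rule tendsto_mult_left)
      fix \<omega> :: 'a
      have "((\<lambda>\<tau>. exp (- (1 / (4 * \<tau>)) * (norm \<omega>)\<^sup>2)) \<longlongrightarrow> 1) at_top" by real_asymp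
      then have "((\<lambda>\<tau>. complex_of_real (exp (- (1 / (4 * \<tau>)) * (norm \<omega>)\<^sup>2)) * cis (x \<bullet> \<omega>)) \<longlongrightarrow> complex_of_real 1 * cis (x \<bullet> \<omega>)) at_top"
        by (intro tendsto_mult_right tendsto_of_real)
      then show "((\<lambda>\<tau>. v \<tau> \<omega>) \<longlongrightarrow> cis (x \<bullet> \<omega>)) at_top" by (simp add: v_def del: of_real_exp)
    qed
    show "\<forall>\<^sub>F \<tau> in at_top. AE \<omega> in lborel. norm (g \<omega> * v \<tau> \<omega>) \<le> cmod (g \<omega>)"
      using eventually_gt_at_top[of 0]
      by eventually_elim (auto simp: norm_mult vnorm intro!: mult_left_le)
  qed measurable
  have "((\<lambda>\<tau>. ?c * (\<integral>\<omega>. g \<omega> * v \<tau> \<omega> \<partial>lborel)) \<longlongrightarrow> complex_of_real (F x)) at_top"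
  proof (rule Lim_transform_eventually)
    show "((\<lambda>\<tau>. complex_of_real ((\<tau> / pi) powr (real DIM('a) / 2) * (\<integral>y. F y * E \<tau> y \<partial>lborel))) \<longlongrightarrow> complex_of_real (F x)) at_top"
      unfolding E_def by (intro tendsto_of_real gaussian_approximate_identity(1)[OF F F2])
    show "\<forall>\<^sub>F \<tau> in at_top. complex_of_real ((\<tau> / pi) powr (real DIM('a) / 2) * (\<integral>y. F y * E \<tau> y \<partial>lborel)) = ?c * (\<integral>\<omega>. g \<omega> * v \<tau> \<omega> \<partial>lborel)"
      using eventually_gt_at_top[of 0] by eventually_elim (rule key[symmetric])
  qed
  then show ?thesis by (rule tendsto_unique[rotated, OF _ L]) simp
qed

section \<open>Spectral density of the Matern kernel\<close>

text \<open>Fubini carries the Gaussian transform through a mixture: the L1 norm in \<open>x\<close>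
  of the component at \<open>s\<close> is the integrand in \<open>int\<close>, so that assumption is
  integrability on the product space. Positivity of the rate is tied to a nonzero weight, so that
  weights living on a half-line can be integrated over all of \<open>real\<close>.\<close>

lemma
  fixes w \<tau> :: "real \<Rightarrow> real" and \<omega> :: "'a::euclidean_space"
  assumes [measurable]: "w \<in> borel_measurable borel" "\<tau> \<in> borel_measurable borel"
    and w: "\<And>s. 0 \<le> w s" and \<tau>: "\<And>s. w s \<noteq> 0 \<Longrightarrow> 0 < \<tau> s"
    and int: "integrable lborel (\<lambda>s. w s * (pi / \<tau> s) powr (real DIM('a) / 2))"
  shows integrable_gaussian_mixture:
      "integrable lborel (\<lambda>x::'a. \<integral>s. w s * exp (- \<tau> s * (norm x)\<^sup>2) \<partial>lborel)"
    and fourier_gaussian_mixture: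
      "(\<integral>x. complex_of_real (\<integral>s. w s * exp (- \<tau> s * (norm x)\<^sup>2) \<partial>lborel) * cis (x \<bullet> \<omega>) \<partial>lborel)
        = complex_of_real (\<integral>s. w s * (pi / \<tau> s) powr (real DIM('a) / 2) * exp (- (norm \<omega>)\<^sup>2 / (4 * \<tau> s)) \<partial>lborel)"
proof -
  define h where "h \<omega> s x = complex_of_real (w s * exp (- \<tau> s * (norm x)\<^sup>2)) * cis (x \<bullet> \<omega>)" for \<omega> s and x :: 'a
  have hx: "integrable lborel (h \<omega> s)" for \<omega> s
  proof (cases "w s = 0")
    case False
    then show ?thesis using integrable_mult_right[OF integrable_gaussian_cis[OF \<tau>[OF False], of \<omega>], of "complex_of_real (w s)"]
      by (simp add: h_def[abs_def] mult.assoc)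
  qed (simp add: h_def[abs_def])
  have hn: "(\<integral>x. norm (h \<omega> s x) \<partial>lborel) = w s * (pi / \<tau> s) powr (real DIM('a) / 2)" for \<omega> s
  proof -
    have "norm (h \<omega> s x) = w s * exp (- \<tau> s * (norm x)\<^sup>2)" for x
      using w[of s] by (simp add: h_def norm_mult del: of_real_mult of_real_exp)
    then show ?thesis using \<tau>[of s] integral_gaussian[of "\<tau> s", where 'a='a] by (cases "w s = 0") auto
  qed
  have h: "integrable (lborel \<Otimes>\<^sub>M lborel) (\<lambda>(s, x). h \<omega> s x)" for \<omega>
  proof (rule lborel_pair.Fubini_integrable)
    show "(\<lambda>(s, x). h \<omega> s x) \<in> borel_measurable (lborel \<Otimes>\<^sub>M lborel)" unfolding h_def by measurable
    show "integrable lborel (\<lambda>s. \<integral>x. norm (case (s, x) of (s, x) \<Rightarrow> h \<omega> s x) \<partial>lborel)"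
      using int by (simp add: hn)
  qed (simp add: hx)
  have hs: "(\<integral>s. h \<omega> s x \<partial>lborel) = complex_of_real (\<integral>s. w s * exp (- \<tau> s * (norm x)\<^sup>2) \<partial>lborel) * cis (x \<bullet> \<omega>)" for \<omega> x
    unfolding h_def integral_mult_left_zero integral_complex_of_real ..
  have "integrable lborel (\<lambda>x::'a. complex_of_real (\<integral>s. w s * exp (- \<tau> s * (norm x)\<^sup>2) \<partial>lborel))"
    using lborel_pair.integrable_snd[OF h[of 0]] by (simp add: hs)
  then show "integrable lborel (\<lambda>x::'a. \<integral>s. w s * exp (- \<tau> s * (norm x)\<^sup>2) \<partial>lborel)"
    using integrable_Re by fastforce
  have "(\<integral>x. complex_of_real (\<integral>s. w s * exp (- \<tau> s * (norm x)\<^sup>2) \<partial>lborel) * cis (x \<bullet> \<omega>) \<partial>lborel)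
     = (\<integral>s. (\<integral>x. h \<omega> s x \<partial>lborel) \<partial>lborel)"
    unfolding hs[symmetric] by (rule lborel_pair.Fubini_integral[OF h])
  also have "\<dots> = (\<integral>s. complex_of_real (w s * (pi / \<tau> s) powr (real DIM('a) / 2) * exp (- (norm \<omega>)\<^sup>2 / (4 * \<tau> s))) \<partial>lborel)"
  proof (rule Bochner_Integration.integral_cong[OF refl])
    fix s
    show "(\<integral>x. h \<omega> s x \<partial>lborel) = complex_of_real (w s * (pi / \<tau> s) powr (real DIM('a) / 2) * exp (- (norm \<omega>)\<^sup>2 / (4 * \<tau> s)))"
    proof (cases "w s = 0")
      case False
      have "(\<integral>x. h \<omega> s x \<partial>lborel) = (\<integral>x. complex_of_real (w s) * (complex_of_real (exp (- \<tau> s * (norm x)\<^sup>2)) * cis (x \<bullet> \<omega>)) \<partial>lborel)"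
        by (simp only: h_def of_real_mult mult.assoc)
      also have "\<dots> = complex_of_real (w s) * complex_of_real ((pi / \<tau> s) powr (real DIM('a) / 2) * exp (- (norm \<omega>)\<^sup>2 / (4 * \<tau> s)))"
        unfolding integral_mult_right_zero integral_gaussian_cis[OF \<tau>[OF False]] ..
      finally show ?thesis by (simp only: of_real_mult mult.assoc)
    qed (simp add: h_def)
  qed
  finally show "(\<integral>x. complex_of_real (\<integral>s. w s * exp (- \<tau> s * (norm x)\<^sup>2) \<partial>lborel) * cis (x \<bullet> \<omega>) \<partial>lborel)
        = complex_of_real (\<integral>s. w s * (pi / \<tau> s) powr (real DIM('a) / 2) * exp (- (norm \<omega>)\<^sup>2 / (4 * \<tau> s)) \<partial>lborel)"
    unfolding integral_complex_of_real .
qed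

section \<open>Gamma mixtures and the Bessel integral\<close>

definition gamma_weight :: "real \<Rightarrow> real \<Rightarrow> real" where
  "gamma_weight a s = indicator {0<..} s * (s powr (a - 1) * exp (- s))"

lemma borel_measurable_gamma_weight [measurable]: "gamma_weight a \<in> borel_measurable borel"
  unfolding gamma_weight_def[abs_def] by measurable

lemma gamma_weight_nonneg: "0 \<le> gamma_weight a s"
  by (simp add: gamma_weight_def)

lemma has_bochner_integral_gamma_weight:
  assumes "a > 0"
  shows "has_bochner_integral lborel (gamma_weight a) (Gamma a)"
proof (rule has_bochner_integral_nn_integral)
  have "indicator {0..} t * t powr (a - 1) / exp t = gamma_weight a t" for t
    by (auto simp: gamma_weight_def indicator_def exp_minus field_simps)
  then show "(\<integral>\<^sup>+t. ennreal (gamma_weight a t) \<partial>lborel) = ennreal (Gamma a)"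
    using Gamma_conv_nn_integral_real[OF assms] by simp
qed (use assms in \<open>auto simp: gamma_weight_nonneg Gamma_real_nonneg\<close>)

lemma gamma_weight_shift: "s powr b * gamma_weight a s = gamma_weight (a + b) s"
  by (auto simp: gamma_weight_def indicator_def powr_add[symmetric] algebra_simps)

text \<open>Under \<open>s = r / 2 * exp t\<close> the exponent
  \<open>- s - r\<^sup>2 / (4 * s)\<close> becomes \<open>- r * cosh t\<close>, and the power of
  \<open>s\<close> times the Jacobian becomes \<open>(r / 2) powr a * exp (a * t)\<close>. Over the
  whole line only the even part \<open>cosh (a * t)\<close> of the last factor counts; folding the
  line produces the factor 2.\<close>

lemma besselK_gamma_weight:
  assumes a: "a > 0" and r: "r > 0"
  shows "(\<integral>s. gamma_weight a s * exp (- (1 / (4 * s)) * r\<^sup>2) \<partial>lborel) = 2 * (r / 2) powr a * besselK a r"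
proof -
  define f where "f s = s powr (a - 1) * exp (- s) * exp (- (1 / (4 * s)) * r\<^sup>2)" for s
  define q where "q t = exp (a * t) * exp (- r * cosh t)" for t
  define e where "e t = exp (- r * cosh t) * cosh (a * t)" for t
  have fm[measurable]: "f \<in> borel_measurable borel" unfolding f_def by measurable
  have qm[measurable]: "q \<in> borel_measurable borel"
    unfolding q_def[abs_def] by (intro borel_measurable_continuous_onI continuous_intros)
  have f_eq: "indicator {0<..} s *\<^sub>R f s = gamma_weight a s * exp (- (1 / (4 * s)) * r\<^sup>2)" for s
    by (simp add: f_def gamma_weight_def)
  have fint: "set_integrable lborel {0<..} f"
    unfolding set_integrable_def f_eq
    using has_bochner_integral_gamma_weight[OF a, THEN integrable.intros]
    by (rule Bochner_Integration.integrable_bound)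
       (auto simp: gamma_weight_def indicator_def abs_mult mult_left_le)
  let ?g = "\<lambda>t. r / 2 * exp t"
  have range: "range ?g = {0<..}"
  proof
    show "{0<..} \<subseteq> range ?g"
    proof
      fix s :: real assume "s \<in> {0<..}"
      then have "s = ?g (ln (2 * s / r))" using r by simp
      then show "s \<in> range ?g" by blast
    qed
  qed (use r in auto)
  have inj: "inj_on ?g UNIV" using r by (auto simp: inj_on_def)
  have gq: "\<bar>?g t\<bar> * f (?g t) = (r / 2) powr a * q t" for t
  proof -
    have "(r / 2 * exp t) * (r / 2 * exp t) powr (a - 1) = (r / 2 * exp t) powr a"
      using powr_add[of "r / 2 * exp t" 1 "a - 1"] r by simp
    also have "\<dots> = (r / 2) powr a * exp (a * t)"
      using r powr_mult[of "r / 2" "exp t" a] by (simp add: exp_powr_real mult_ac)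
    finally have A: "(r / 2 * exp t) * (r / 2 * exp t) powr (a - 1) = (r / 2) powr a * exp (a * t)" .
    have B: "exp (- ?g t) * exp (- (1 / (4 * ?g t)) * r\<^sup>2) = exp (- r * cosh t)"
      using r by (simp add: exp_add[symmetric] cosh_def exp_minus field_simps power2_eq_square)
    have "\<bar>?g t\<bar> * f (?g t) = (?g t * ?g t powr (a - 1)) * (exp (- ?g t) * exp (- (1 / (4 * ?g t)) * r\<^sup>2))"
      using r by (simp add: f_def mult.assoc)
    then show ?thesis unfolding A B by (simp add: q_def mult.assoc)
  qed
  \<comment> \<open>The change of variables is an equivalence, so it also yields the integrability
    of \<open>q\<close> from that of \<open>f\<close>.\<close>
  have "(\<lambda>t. \<bar>?g t\<bar> * f (?g t)) absolutely_integrable_on UNIV \<and>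
      integral UNIV (\<lambda>t. \<bar>?g t\<bar> * f (?g t)) = integral {0<..} f
      \<longleftrightarrow> f absolutely_integrable_on (?g ` UNIV) \<and> integral (?g ` UNIV) f = integral {0<..} f"
    by (rule has_absolute_integral_change_of_variables_1'[OF _ _ inj])
       (auto intro!: derivative_eq_intros)
  moreover have "f absolutely_integrable_on {0<..}"
    using fint unfolding set_integrable_def by (subst integrable_completion) auto
  ultimately have abs: "(\<lambda>t. (r / 2) powr a * q t) absolutely_integrable_on UNIV"
    and I: "integral UNIV (\<lambda>t. (r / 2) powr a * q t) = integral {0<..} f"
    unfolding range gq by simp_all
  from abs have "integrable lborel (\<lambda>t. (r / 2) powr a * q t)"
    unfolding set_integrable_def by (subst (asm) integrable_completion) auto
  then have qint: "integrable lborel q" using r by simp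
  have "(\<integral>s. gamma_weight a s * exp (- (1 / (4 * s)) * r\<^sup>2) \<partial>lborel) = (LINT s:{0<..}|lborel. f s)"
    unfolding set_lebesgue_integral_def f_eq ..
  also have "\<dots> = integral UNIV (\<lambda>t. (r / 2) powr a * q t)"
    using set_borel_integral_eq_integral(2)[OF fint] I by simp
  also have "\<dots> = (\<integral>t. (r / 2) powr a * q t \<partial>lborel)"
    using qint by (intro integral_lborel) simp
  also have "\<dots> = (r / 2) powr a * (\<integral>t. q t \<partial>lborel)" by simp
  also have "(\<integral>t. q t \<partial>lborel) = 2 * besselK a r"
  proof -
    have q': "has_bochner_integral lborel q (\<integral>t. q t \<partial>lborel)"
      using qint by (rule has_bochner_integral_integrable)
    have q'': "has_bochner_integral lborel (\<lambda>t. q (- t)) (\<integral>t. q t \<partial>lborel)"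
      using lborel_has_bochner_integral_real_affine_iff[of "-1" q "\<integral>t. q t \<partial>lborel" 0] q' by simp
    have e_eq: "e t = (q t + q (- t)) / 2" for t
      by (simp add: e_def q_def cosh_def[of "a * t"] field_simps)
    have "has_bochner_integral lborel e (((\<integral>t. q t \<partial>lborel) + (\<integral>t. q t \<partial>lborel)) / 2)"
      unfolding e_eq[abs_def] using q' q'' by (intro has_bochner_integral_divide_zero has_bochner_integral_add)
    then have e1: "has_bochner_integral lborel e (\<integral>t. q t \<partial>lborel)" by simp
    then have eint: "integrable lborel e" by (rule integrable.intros)
    have "integrable lborel (\<lambda>t. indicator {0..} t *\<^sub>R e t)"
      using integrable_mult_indicator[OF _ eint, of "{0..}"] by simp
    then have "has_bochner_integral lborel (\<lambda>t. indicator {0..} t *\<^sub>R e t) (\<integral>t. indicator {0..} t *\<^sub>R e t \<partial>lborel)"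
      by (rule has_bochner_integral_integrable)
    then have e2: "has_bochner_integral lborel e (2 *\<^sub>R (\<integral>t. indicator {0..} t *\<^sub>R e t \<partial>lborel))"
      by (rule has_bochner_integral_even_function) (simp add: e_def)
    \<comment> \<open>The folding lemma uses the closed half-line and \<open>besselK\<close> the
      open one; the point 0 is a null set.\<close>
    have "(\<integral>t. indicator {0..} t *\<^sub>R e t \<partial>lborel) = besselK a r"
      unfolding besselK_def set_lebesgue_integral_def e_def[symmetric]
    proof (rule integral_cong_AE)
      have em: "e \<in> borel_measurable borel" using eint by simp
      show "(\<lambda>t. indicator {0..} t *\<^sub>R e t) \<in> borel_measurable lborel"
        "(\<lambda>t. indicator {0<..} t *\<^sub>R e t) \<in> borel_measurable lborel"
        using em by simp_all
      show "AE t in lborel. indicator {0..} t *\<^sub>R e t = indicator {0<..} t *\<^sub>R e t"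
        using AE_lborel_singleton[of "0::real"] by eventually_elim (auto simp: indicator_def)
    qed
    then show ?thesis
      using has_bochner_integral_eq[OF e1 e2] by simp
  qed
  finally show ?thesis by simp
qed

text \<open>At \<open>h = 0\<close> the mixture is the total mass of the Gamma distribution, which
  matches the value 1 that \<open>matern\<close> prescribes there.\<close>

lemma matern_gaussian_mixture:
  fixes h :: "'a::euclidean_space" and \<nu> :: real
  defines "\<alpha> \<equiv> \<nu> - real DIM('a) / 2"
  assumes "\<nu> > real DIM('a) / 2"
  shows "matern \<nu> h = (\<integral>s. gamma_weight \<alpha> s / Gamma \<alpha> * exp (- (1 / (4 * s)) * (norm h)\<^sup>2) \<partial>lborel)"
proof -
  have a: "\<alpha> > 0" using assms by simp
  have G: "Gamma \<alpha> > 0" using a by (rule Gamma_real_pos)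
  have "(\<integral>s. gamma_weight \<alpha> s / Gamma \<alpha> * exp (- (1 / (4 * s)) * (norm h)\<^sup>2) \<partial>lborel)
     = (\<integral>s. gamma_weight \<alpha> s * exp (- (1 / (4 * s)) * (norm h)\<^sup>2) \<partial>lborel) / Gamma \<alpha>"
    by simp
  also have "\<dots> = matern \<nu> h"
  proof (cases "h = 0")
    case True
    then show ?thesis
      using has_bochner_integral_integral_eq[OF has_bochner_integral_gamma_weight[OF a]] G
      by (simp add: matern_def)
  next
    case False
    then have r: "norm h > 0" by simp
    have "2 * (norm h / 2) powr \<alpha> = norm h powr \<alpha> / 2 powr (\<alpha> - 1)"
      using r by (simp add: powr_divide powr_diff)
    then show ?thesis unfolding besselK_gamma_weight[OF a r]
      using False by (simp add: matern_def Let_def \<alpha>_def)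
  qed
  finally show ?thesis ..
qed

section \<open>Kernels with a positive spectral density\<close>

text \<open>Interface between the Matern computation and the error analysis: once it is interpreted,
  Bessel functions no longer occur. Both directions of the transform are recorded because the native
  norm is defined through \<open>fourier_kernel\<close> while quadratic forms are evaluated through
  \<open>kernel_inversion\<close>; \<open>kernel_zero\<close> matches the constant 1 in
  \<open>post_var\<close>.\<close>

locale spectral_kernel =
  fixes \<Psi> p :: "'a::euclidean_space \<Rightarrow> real"
  assumes kernel_integrable: "integrable lborel \<Psi>"
    and density_integrable: "integrable lborel p"
    and density_pos: "\<And>\<omega>. 0 < p \<omega>"
    and fourier_kernel: "\<And>\<omega>. fourier (\<lambda>x. complex_of_real (\<Psi> x)) \<omega> = complex_of_real (p \<omega>)"
    and kernel_inversion: "\<And>x. complex_of_real (\<Psi> x) =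
       complex_of_real ((2 * pi) powr (- real DIM('a) / 2)) * (\<integral>\<omega>. complex_of_real (p \<omega>) * cis (x \<bullet> \<omega>) \<partial>lborel)"
    and kernel_zero: "\<Psi> 0 = 1"

text \<open>For \<open>\<nu> > real DIM('a) / 2\<close> this is a constant times
  \<open>(1 + (norm \<omega>)\<^sup>2) powr (- \<nu>)\<close>. The factor after the Gamma density is
  the unitary transform of \<open>exp (- (norm h)\<^sup>2 / (4 * s))\<close>. The mixture form is
  kept because positivity and the inverse transform can be read off from it.\<close>

definition matern_density :: "real \<Rightarrow> 'a::euclidean_space \<Rightarrow> real" where
  "matern_density \<nu> \<omega> = (let \<alpha> = \<nu> - real DIM('a) / 2 in
     \<integral>s. gamma_weight \<alpha> s / Gamma \<alpha> * (2 * s) powr (real DIM('a) / 2) * exp (- s * (norm \<omega>)\<^sup>2) \<partial>lborel)"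

text \<open>The mixture lemma is used with rate \<open>1 / (4 * s)\<close> to obtain the density and
  with rate \<open>s\<close> to transform the density back, so inversion is a direct computation.
  The first use needs the moment of order \<open>d2\<close>, a Gamma weight with shifted parameter;
  in the second the powers of \<open>s\<close> cancel and only the mass of \<open>m\<close>
  remains.\<close>

lemma spectral_kernel_matern:
  assumes "\<nu> > real DIM('a) / 2"
  shows "spectral_kernel (matern \<nu> :: 'a::euclidean_space \<Rightarrow> real) (matern_density \<nu>)"
proof -
  define \<alpha> where "\<alpha> = \<nu> - real DIM('a) / 2"
  define d2 where "d2 = real DIM('a) / 2"
  define m where "m s = gamma_weight \<alpha> s / Gamma \<alpha>" for s
  have a: "\<alpha> > 0" using assms by (simp add: \<alpha>_def)
  have d2: "d2 > 0" by (simp add: d2_def)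
  have G: "Gamma \<alpha> > 0" using a by (rule Gamma_real_pos)
  have [measurable]: "m \<in> borel_measurable borel" unfolding m_def by measurable
  have m0: "0 \<le> m s" for s unfolding m_def using G gamma_weight_nonneg[of \<alpha> s] by simp
  have mpos: "s > 0" if "m s \<noteq> 0" for s
    using that by (auto simp: m_def gamma_weight_def indicator_def split: if_splits)
  have m_int: "integrable lborel m"
    using has_bochner_integral_gamma_weight[OF a, THEN integrable.intros] unfolding m_def by simp
  have ms_int: "integrable lborel (\<lambda>s. m s * (c * s) powr d2)" if "c > 0" for c
  proof -
    have "m s * (c * s) powr d2 = c powr d2 / Gamma \<alpha> * gamma_weight (\<alpha> + d2) s" for s
      using that mpos[of s]
      by (cases "m s = 0") (auto simp: m_def powr_mult gamma_weight_shift[symmetric])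
    moreover have "integrable lborel (gamma_weight (\<alpha> + d2))"
      using a d2 has_bochner_integral_gamma_weight[of "\<alpha> + d2"] by (auto simp: integrable.simps)
    ultimately show ?thesis by simp
  qed
  have mat: "matern \<nu> h = (\<integral>s. m s * exp (- (1 / (4 * s)) * (norm h)\<^sup>2) \<partial>lborel)" for h :: 'a
    unfolding m_def \<alpha>_def by (rule matern_gaussian_mixture[OF assms])
  have den: "matern_density \<nu> \<omega> = (\<integral>s. m s * (2 * s) powr d2 * exp (- s * (norm \<omega>)\<^sup>2) \<partial>lborel)" for \<omega> :: 'a
    unfolding matern_density_def Let_def m_def \<alpha>_def d2_def ..
  have pi2: "(2 * pi) powr (- real DIM('a) / 2) * (2 * pi) powr d2 = 1"
    by (simp add: d2_def powr_add[symmetric])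
  note mix1 = integrable_gaussian_mixture[where w = m and \<tau> = "\<lambda>s. 1 / (4 * s)" and 'a = 'a]
    fourier_gaussian_mixture[where w = m and \<tau> = "\<lambda>s. 1 / (4 * s)" and 'a = 'a]
  note mix2 = integrable_gaussian_mixture[where w = "\<lambda>s. m s * (2 * s) powr d2" and \<tau> = "\<lambda>s. s" and 'a = 'a]
    fourier_gaussian_mixture[where w = "\<lambda>s. m s * (2 * s) powr d2" and \<tau> = "\<lambda>s. s" and 'a = 'a]
  have i1: "integrable lborel (\<lambda>s. m s * (pi / (1 / (4 * s))) powr (real DIM('a) / 2))"
    using ms_int[of "4 * pi"] by (simp add: d2_def mult_ac)
  have i2: "integrable lborel (\<lambda>s. m s * (2 * s) powr d2 * (pi / s) powr (real DIM('a) / 2))"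
  proof -
    have eq: "m s * (2 * s) powr d2 * (pi / s) powr (real DIM('a) / 2) = (2 * pi) powr d2 * m s" for s
      using mpos[of s] by (cases "m s = 0") (auto simp: d2_def powr_mult[symmetric])
    show ?thesis unfolding eq using m_int by simp
  qed
  show ?thesis
  proof
    show "integrable lborel (matern \<nu> :: 'a \<Rightarrow> real)"
      unfolding mat[abs_def] using mpos by (intro mix1(1) m0 i1) auto
    show "integrable lborel (matern_density \<nu> :: 'a \<Rightarrow> real)"
      unfolding den[abs_def] using mpos m0 by (intro mix2(1) i2) auto
    show "matern \<nu> (0::'a) = 1" by (simp add: matern_def)
    fix \<omega> :: 'a
    have i3: "integrable lborel (\<lambda>s. m s * (2 * s) powr d2 * exp (- s * (norm \<omega>)\<^sup>2))"
    proof (rule Bochner_Integration.integrable_bound[OF ms_int[of 2]])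
      show "AE s in lborel. norm (m s * (2 * s) powr d2 * exp (- s * (norm \<omega>)\<^sup>2)) \<le> norm (m s * (2 * s) powr d2)"
      proof (rule AE_I2)
        fix s
        show "norm (m s * (2 * s) powr d2 * exp (- s * (norm \<omega>)\<^sup>2)) \<le> norm (m s * (2 * s) powr d2)"
          using mpos[of s] m0[of s] by (cases "m s = 0") (auto simp: abs_mult intro!: mult_left_le)
      qed
    qed auto
    \<comment> \<open>If the integral vanished, the nonnegative integrand would vanish almost
      everywhere, but all its factors are positive on \<open>{0<..<1}\<close>.\<close>
    have "matern_density \<nu> \<omega> \<noteq> 0"
    proof
      assume "matern_density \<nu> \<omega> = 0"
      then have "AE s in lborel. m s * (2 * s) powr d2 * exp (- s * (norm \<omega>)\<^sup>2) = 0"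
        unfolding den using integral_nonneg_eq_0_iff_AE[OF i3] m0 by auto
      then have "AE s in lborel. \<not> s \<in> {0<..<1::real}"
        by eventually_elim (use G in \<open>auto simp: m_def gamma_weight_def\<close>)
      then have "emeasure lborel {0<..<1::real} = 0"
        by (subst (asm) AE_iff_measurable[where N = "{0<..<1::real}"]) auto
      then show False by simp
    qed
    moreover have "0 \<le> matern_density \<nu> \<omega>"
      unfolding den using m0 by (intro integral_nonneg_AE) auto
    ultimately show "0 < matern_density \<nu> \<omega>" by simp
    \<comment> \<open>\<open>fourier\<close> has a minus sign in the phase and the mixture lemma has
      none, so the lemma is applied at \<open>- \<omega>\<close>.\<close>
    have "fourier (\<lambda>x. complex_of_real (matern \<nu> x)) \<omega>
      = complex_of_real ((2 * pi) powr (- real DIM('a) / 2)) *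
          complex_of_real (\<integral>s. m s * (pi / (1 / (4 * s))) powr (real DIM('a) / 2) * exp (- (norm (- \<omega>))\<^sup>2 / (4 * (1 / (4 * s)))) \<partial>lborel)"
      unfolding fourier_cis mat inner_minus_right[symmetric]
      by (subst mix1(2)) (use m0 mpos i1 in auto)
    also have "(\<integral>s. m s * (pi / (1 / (4 * s))) powr (real DIM('a) / 2) * exp (- (norm (- \<omega>))\<^sup>2 / (4 * (1 / (4 * s)))) \<partial>lborel)
       = (\<integral>s. (2 * pi) powr d2 * (m s * (2 * s) powr d2 * exp (- s * (norm \<omega>)\<^sup>2)) \<partial>lborel)"
    proof (rule Bochner_Integration.integral_cong[OF refl])
      fix s
      show "m s * (pi / (1 / (4 * s))) powr (real DIM('a) / 2) * exp (- (norm (- \<omega>))\<^sup>2 / (4 * (1 / (4 * s))))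
        = (2 * pi) powr d2 * (m s * (2 * s) powr d2 * exp (- s * (norm \<omega>)\<^sup>2))"
      proof (cases "m s = 0")
        case False
        have "(pi / (1 / (4 * s))) powr (real DIM('a) / 2) = (2 * pi) powr d2 * (2 * s) powr d2"
          using mpos[OF False] by (simp add: d2_def powr_mult[symmetric] mult_ac)
        then show ?thesis by (simp add: mult_ac)
      qed simp
    qed
    also have "\<dots> = (2 * pi) powr d2 * matern_density \<nu> \<omega>" unfolding den by simp
    finally show "fourier (\<lambda>x. complex_of_real (matern \<nu> x)) \<omega> = complex_of_real (matern_density \<nu> \<omega>)"
      unfolding of_real_mult[symmetric] mult.assoc[symmetric] pi2 by simp
    have "complex_of_real ((2 * pi) powr (- real DIM('a) / 2)) * (\<integral>x. complex_of_real (matern_density \<nu> x) * cis (x \<bullet> \<omega>) \<partial>lborel)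
      = complex_of_real ((2 * pi) powr (- real DIM('a) / 2)) *
          complex_of_real (\<integral>s. m s * (2 * s) powr d2 * (pi / s) powr (real DIM('a) / 2) * exp (- (norm \<omega>)\<^sup>2 / (4 * s)) \<partial>lborel)"
      unfolding den by (subst mix2(2)) (use m0 mpos i2 in auto)
    also have "(\<integral>s. m s * (2 * s) powr d2 * (pi / s) powr (real DIM('a) / 2) * exp (- (norm \<omega>)\<^sup>2 / (4 * s)) \<partial>lborel)
       = (\<integral>s. (2 * pi) powr d2 * (m s * exp (- (1 / (4 * s)) * (norm \<omega>)\<^sup>2)) \<partial>lborel)"
    proof (rule Bochner_Integration.integral_cong[OF refl])
      fix s
      show "m s * (2 * s) powr d2 * (pi / s) powr (real DIM('a) / 2) * exp (- (norm \<omega>)\<^sup>2 / (4 * s))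
        = (2 * pi) powr d2 * (m s * exp (- (1 / (4 * s)) * (norm \<omega>)\<^sup>2))"
      proof (cases "m s = 0")
        case False
        have "(2 * s) powr d2 * (pi / s) powr (real DIM('a) / 2) = (2 * pi) powr d2"
          using mpos[OF False] by (simp add: d2_def powr_mult[symmetric])
        then show ?thesis by (simp add: mult_ac)
      qed simp
    qed
    also have "\<dots> = (2 * pi) powr d2 * matern \<nu> \<omega>" unfolding mat by simp
    finally show "complex_of_real (matern \<nu> \<omega>) = complex_of_real ((2 * pi) powr (- real DIM('a) / 2)) *
        (\<integral>x. complex_of_real (matern_density \<nu> x) * cis (\<omega> \<bullet> x) \<partial>lborel)"
      unfolding of_real_mult[symmetric] mult.assoc[symmetric] pi2 by (simp add: inner_commute)
  qed
qed

section \<open>Reproducing property\<close>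

lemma continuous_inverse_fourier_integral:
  fixes g :: "'a::euclidean_space \<Rightarrow> complex"
  assumes g: "integrable lborel g"
  shows "continuous_on UNIV (\<lambda>x. \<integral>\<omega>. g \<omega> * cis (x \<bullet> \<omega>) \<partial>lborel)"
proof -
  have [measurable]: "g \<in> borel_measurable borel" using g by simp
  have "continuous_on UNIV cis" by (intro continuous_intros)
  then have cont: "isCont cis t" for t by (simp add: continuous_on_eq_continuous_at)
  have "isCont (\<lambda>x. \<integral>\<omega>. g \<omega> * cis (x \<bullet> \<omega>) \<partial>lborel) x" for x
    unfolding continuous_at_sequentially comp_def
  proof safe
    fix X assume X: "X \<longlonglongrightarrow> x"
    show "(\<lambda>n. \<integral>\<omega>. g \<omega> * cis (X n \<bullet> \<omega>) \<partial>lborel) \<longlonglongrightarrow> (\<integral>\<omega>. g \<omega> * cis (x \<bullet> \<omega>) \<partial>lborel)"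
    proof (rule integral_dominated_convergence[where w = "\<lambda>\<omega>. cmod (g \<omega>)"])
      show "AE \<omega> in lborel. (\<lambda>n. g \<omega> * cis (X n \<bullet> \<omega>)) \<longlonglongrightarrow> g \<omega> * cis (x \<bullet> \<omega>)"
      proof (rule AE_I2)
        fix \<omega>
        have "(\<lambda>n. X n \<bullet> \<omega>) \<longlonglongrightarrow> x \<bullet> \<omega>" by (rule tendsto_inner[OF X tendsto_const])
        then have "(\<lambda>n. cis (X n \<bullet> \<omega>)) \<longlonglongrightarrow> cis (x \<bullet> \<omega>)" by (rule isCont_tendsto_compose[OF cont])
        then show "(\<lambda>n. g \<omega> * cis (X n \<bullet> \<omega>)) \<longlonglongrightarrow> g \<omega> * cis (x \<bullet> \<omega>)" by (rule tendsto_mult_left)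
      qed
      show "integrable lborel (\<lambda>\<omega>. cmod (g \<omega>))" using g by (rule integrable_norm)
      show "AE \<omega> in lborel. norm (g \<omega> * cis (X n \<bullet> \<omega>)) \<le> cmod (g \<omega>)" for n by (simp add: norm_mult)
    qed measurable
  qed
  then show ?thesis by (simp add: continuous_on_eq_continuous_at)
qed

lemma fourier_translate:
  fixes f :: "'a::euclidean_space \<Rightarrow> complex"
  assumes "integrable lborel f"
  shows "fourier (\<lambda>x. f (x - y)) \<omega> = cis (- (y \<bullet> \<omega>)) * fourier f \<omega>"
proof -
  have "(\<integral>x. f (x - y) * cis (- (x \<bullet> \<omega>)) \<partial>lborel)
      = (\<integral>x. cis (- (y \<bullet> \<omega>)) * (f (x - y) * cis (- ((x - y) \<bullet> \<omega>))) \<partial>lborel)"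
    by (intro Bochner_Integration.integral_cong) (auto simp: mult.left_commute cis_mult inner_diff_left)
  also have "\<dots> = cis (- (y \<bullet> \<omega>)) * (\<integral>x. f (x - y) * cis (- ((x - y) \<bullet> \<omega>)) \<partial>lborel)"
    by (rule integral_mult_right_zero)
  also have "(\<integral>x. f (x - y) * cis (- ((x - y) \<bullet> \<omega>)) \<partial>lborel) = (\<integral>x. f x * cis (- (x \<bullet> \<omega>)) \<partial>lborel)"
    using assms by (intro integral_lborel_translate[where f = "\<lambda>x. f x * cis (- (x \<bullet> \<omega>))"] integrable_mult_cis) auto
  finally show ?thesis unfolding fourier_cis by simp
qed

lemma fourier_sum:
  fixes f :: "'i \<Rightarrow> 'a::euclidean_space \<Rightarrow> complex"
  assumes "\<And>i. i \<in> I \<Longrightarrow> integrable lborel (f i)"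
  shows "fourier (\<lambda>x. \<Sum>i\<in>I. c i * f i x) \<omega> = (\<Sum>i\<in>I. c i * fourier (f i) \<omega>)"
proof -
  have "(\<integral>x. (\<Sum>i\<in>I. c i * f i x) * cis (- (x \<bullet> \<omega>)) \<partial>lborel)
      = (\<integral>x. (\<Sum>i\<in>I. c i * (f i x * cis (- (x \<bullet> \<omega>)))) \<partial>lborel)"
    by (simp add: sum_distrib_right mult.assoc)
  also have "\<dots> = (\<Sum>i\<in>I. \<integral>x. c i * (f i x * cis (- (x \<bullet> \<omega>))) \<partial>lborel)"
    using assms by (intro Bochner_Integration.integral_sum integrable_mult_right integrable_mult_cis) auto
  finally show ?thesis
    unfolding fourier_cis by (simp add: sum_distrib_left mult.left_commute)
qed

text \<open>The Fourier symbol of the functional that sends \<open>F\<close> to the sum of the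
  \<open>c i * F (y i)\<close>.\<close>

definition exp_sum_at :: "'i set \<Rightarrow> ('i \<Rightarrow> real) \<Rightarrow> ('i \<Rightarrow> 'a::euclidean_space) \<Rightarrow> 'a \<Rightarrow> complex" where
  "exp_sum_at I c y \<omega> = (\<Sum>i\<in>I. complex_of_real (c i) * cis (y i \<bullet> \<omega>))"

lemma borel_measurable_exp_sum_at [measurable]: "exp_sum_at I c y \<in> borel_measurable borel"
  unfolding exp_sum_at_def[abs_def] by measurable

lemma cnj_exp_sum_at: "cnj (exp_sum_at I c y \<omega>) = (\<Sum>i\<in>I. complex_of_real (c i) * cis (- (y i \<bullet> \<omega>)))"
  by (simp add: exp_sum_at_def cis_cnj)

context spectral_kernel
begin

text \<open>Nodes form a family and not a set, because the error functional repeats a node when its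
  evaluation point is itself a sample point.\<close>

definition kernel_form :: "'i set \<Rightarrow> ('i \<Rightarrow> real) \<Rightarrow> ('i \<Rightarrow> 'a) \<Rightarrow> real" where
  "kernel_form I c y = (\<Sum>i\<in>I. \<Sum>j\<in>I. c i * c j * \<Psi> (y i - y j))"

lemma density_measurable [measurable]: "p \<in> borel_measurable borel"
  using density_integrable by simp

lemma kernel_measurable [measurable]: "\<Psi> \<in> borel_measurable borel"
  using kernel_integrable by simp

lemma density_cis_integrable: "integrable lborel (\<lambda>\<omega>. complex_of_real (p \<omega>) * cis (x \<bullet> \<omega>))"
  using density_integrable by (intro integrable_mult_cis) auto

lemma continuous_kernel: "continuous_on UNIV \<Psi>"
proof -
  have c: "continuous_on UNIV (\<lambda>x. complex_of_real ((2 * pi) powr (- real DIM('a) / 2)) * (\<integral>\<omega>. complex_of_real (p \<omega>) * cis (x \<bullet> \<omega>) \<partial>lborel))"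
    using density_integrable by (intro continuous_intros continuous_inverse_fourier_integral) auto
  show ?thesis
    using continuous_on_Re[OF c] unfolding kernel_inversion[symmetric] by simp
qed

text \<open>The density is real, so conjugating the inversion integral reverses the phase.\<close>

lemma kernel_minus: "\<Psi> (- x) = \<Psi> x"
proof -
  have "complex_of_real (\<Psi> (- x)) = complex_of_real ((2 * pi) powr (- real DIM('a) / 2)) * (\<integral>\<omega>. cnj (complex_of_real (p \<omega>) * cis (x \<bullet> \<omega>)) \<partial>lborel)"
    unfolding kernel_inversion[of "- x"] by (simp add: cis_cnj)
  also have "\<dots> = cnj (complex_of_real ((2 * pi) powr (- real DIM('a) / 2)) * (\<integral>\<omega>. complex_of_real (p \<omega>) * cis (x \<bullet> \<omega>) \<partial>lborel))"
    unfolding Bochner_Integration.integral_cnj by simp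
  also have "\<dots> = complex_of_real (\<Psi> x)" unfolding kernel_inversion[symmetric] by simp
  finally show ?thesis by simp
qed

lemma kernel_commute: "\<Psi> (x - y) = \<Psi> (y - x)"
  using kernel_minus[of "x - y"] by simp

lemma density_integral: "((2 * pi) powr (- real DIM('a) / 2)) * (\<integral>\<omega>. p \<omega> \<partial>lborel) = 1"
proof -
  have "complex_of_real (((2 * pi) powr (- real DIM('a) / 2)) * (\<integral>\<omega>. p \<omega> \<partial>lborel)) = complex_of_real (\<Psi> 0)"
    unfolding kernel_inversion[of 0] by simp
  then show ?thesis using kernel_zero by (simp only: of_real_eq_iff)
qed

lemma abs_kernel_le: "\<bar>\<Psi> x\<bar> \<le> 1"
proof -
  have "\<bar>\<Psi> x\<bar> = cmod (complex_of_real (\<Psi> x))" by simp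
  also have "\<dots> = ((2 * pi) powr (- real DIM('a) / 2)) * cmod (\<integral>\<omega>. complex_of_real (p \<omega>) * cis (x \<bullet> \<omega>) \<partial>lborel)"
    unfolding kernel_inversion[of x] norm_mult by simp
  also have "\<dots> \<le> ((2 * pi) powr (- real DIM('a) / 2)) * (\<integral>\<omega>. p \<omega> \<partial>lborel)"
    using integral_norm_bound[of lborel "\<lambda>\<omega>. complex_of_real (p \<omega>) * cis (x \<bullet> \<omega>)"] density_pos
    by (intro mult_left_mono) (auto simp: norm_mult less_imp_le)
  finally show ?thesis unfolding density_integral .
qed

lemma
  assumes "finite I"
  shows exp_sum_square_integrable: "integrable lborel (\<lambda>\<omega>. (cmod (exp_sum_at I c y \<omega>))\<^sup>2 * p \<omega>)" (is ?A)
    and exp_sum_square_integral: "((2 * pi) powr (- real DIM('a) / 2)) * (\<integral>\<omega>. (cmod (exp_sum_at I c y \<omega>))\<^sup>2 * p \<omega> \<partial>lborel) = kernel_form I c y" (is ?B)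
proof -
  have eq: "complex_of_real ((cmod (exp_sum_at I c y \<omega>))\<^sup>2 * p \<omega>)
     = (\<Sum>i\<in>I. \<Sum>j\<in>I. complex_of_real (c i * c j) * (complex_of_real (p \<omega>) * cis ((y i - y j) \<bullet> \<omega>)))" for \<omega>
  proof -
    have "complex_of_real ((cmod (exp_sum_at I c y \<omega>))\<^sup>2 * p \<omega>) = exp_sum_at I c y \<omega> * cnj (exp_sum_at I c y \<omega>) * complex_of_real (p \<omega>)"
      by (simp only: of_real_mult complex_norm_square)
    also have "\<dots> = (\<Sum>i\<in>I. \<Sum>j\<in>I. complex_of_real (c i) * cis (y i \<bullet> \<omega>) * (complex_of_real (c j) * cis (- (y j \<bullet> \<omega>))) * complex_of_real (p \<omega>))"
      unfolding cnj_exp_sum_at unfolding exp_sum_at_def sum_product by (simp add: sum_distrib_right)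
    also have "\<dots> = (\<Sum>i\<in>I. \<Sum>j\<in>I. complex_of_real (c i * c j) * (complex_of_real (p \<omega>) * cis ((y i - y j) \<bullet> \<omega>)))"
    proof (intro sum.cong refl)
      fix i j
      have "cis ((y i - y j) \<bullet> \<omega>) = cis (y i \<bullet> \<omega>) * cis (- (y j \<bullet> \<omega>))"
        by (simp add: cis_mult inner_diff_left)
      then show "complex_of_real (c i) * cis (y i \<bullet> \<omega>) * (complex_of_real (c j) * cis (- (y j \<bullet> \<omega>))) * complex_of_real (p \<omega>)
        = complex_of_real (c i * c j) * (complex_of_real (p \<omega>) * cis ((y i - y j) \<bullet> \<omega>))" by (simp add: mult_ac)
    qed
    finally show ?thesis .
  qed
  have int: "integrable lborel (\<lambda>\<omega>. complex_of_real ((cmod (exp_sum_at I c y \<omega>))\<^sup>2 * p \<omega>))"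
    unfolding eq by (intro Bochner_Integration.integrable_sum integrable_mult_right density_cis_integrable)
  then show ?A using integrable_Re[OF int] by (simp only: Re_complex_of_real)
  have "complex_of_real (((2 * pi) powr (- real DIM('a) / 2)) * (\<integral>\<omega>. (cmod (exp_sum_at I c y \<omega>))\<^sup>2 * p \<omega> \<partial>lborel))
     = complex_of_real ((2 * pi) powr (- real DIM('a) / 2)) * (\<integral>\<omega>. complex_of_real ((cmod (exp_sum_at I c y \<omega>))\<^sup>2 * p \<omega>) \<partial>lborel)"
    unfolding integral_complex_of_real by simp
  also have "\<dots> = complex_of_real ((2 * pi) powr (- real DIM('a) / 2)) * (\<Sum>i\<in>I. \<Sum>j\<in>I. complex_of_real (c i * c j) * (\<integral>\<omega>. complex_of_real (p \<omega>) * cis ((y i - y j) \<bullet> \<omega>) \<partial>lborel))"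
    unfolding eq
    by (simp add: Bochner_Integration.integral_sum Bochner_Integration.integrable_sum density_cis_integrable del: of_real_mult)
  also have "\<dots> = (\<Sum>i\<in>I. \<Sum>j\<in>I. complex_of_real (c i * c j) * complex_of_real (\<Psi> (y i - y j)))"
    unfolding kernel_inversion by (simp add: sum_distrib_left mult_ac)
  also have "\<dots> = complex_of_real (kernel_form I c y)"
    by (simp add: kernel_form_def)
  finally show ?B by (simp only: of_real_eq_iff)
qed

lemma kernel_form_nonneg: "finite I \<Longrightarrow> 0 \<le> kernel_form I c y"
  unfolding exp_sum_square_integral[symmetric]
  by (intro mult_nonneg_nonneg integral_nonneg_AE AE_I2) (auto simp: less_imp_le[OF density_pos])

text \<open>Since \<open>p\<close> is positive, a vanishing form forces the exponential sum to
  vanish almost everywhere. Integrating that sum against a Gaussian with phase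
  \<open>- (y k \<bullet> \<omega>)\<close> gives \<open>sum0\<close> for every positive
  \<open>\<tau>\<close>; as \<open>\<tau>\<close> grows only the term \<open>i = k\<close> survives,
  because the nodes are distinct.\<close>

lemma kernel_form_eq_0_imp:
  assumes I: "finite I" and inj: "inj_on y I" and zero: "kernel_form I c y = 0" and k: "k \<in> I"
  shows "c k = 0"
proof -
  have "(\<integral>\<omega>. (cmod (exp_sum_at I c y \<omega>))\<^sup>2 * p \<omega> \<partial>lborel) = 0"
    using exp_sum_square_integral[OF I, of c y] zero by simp
  then have "AE \<omega> in lborel. (cmod (exp_sum_at I c y \<omega>))\<^sup>2 * p \<omega> = 0"
    using integral_nonneg_eq_0_iff_AE[OF exp_sum_square_integrable[OF I], of c y]
    by (simp add: less_imp_le[OF density_pos])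
  then have ae: "AE \<omega> in lborel. exp_sum_at I c y \<omega> = 0"
    by eventually_elim (simp add: less_imp_neq[OF density_pos, symmetric])
  have sum0: "(\<Sum>i\<in>I. c i * exp (- \<tau> * (norm (y i - y k))\<^sup>2)) = 0" if \<tau>: "\<tau> > 0" for \<tau>
  proof -
    define G where "G \<omega> = complex_of_real (exp (- (1 / (4 * \<tau>)) * (norm \<omega>)\<^sup>2))" for \<omega> :: 'a
    have [measurable]: "G \<in> borel_measurable borel" unfolding G_def by measurable
    have s: "1 / (4 * \<tau>) > 0" using \<tau> by simp
    have eqc: "(pi / (1 / (4 * \<tau>))) powr (real DIM('a) / 2) * exp (- (norm z)\<^sup>2 / (4 * (1 / (4 * \<tau>))))
        = (4 * pi * \<tau>) powr (real DIM('a) / 2) * exp (- \<tau> * (norm z)\<^sup>2)" for z :: 'a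
      using \<tau> by (simp add: mult_ac)
    have Gint: "integrable lborel (\<lambda>\<omega>. G \<omega> * cis (\<omega> \<bullet> z))" for z
      unfolding G_def by (rule integrable_gaussian_cis[OF s])
    have "AE \<omega> in lborel. exp_sum_at I c y \<omega> * (G \<omega> * cis (- (y k \<bullet> \<omega>))) = 0"
      using ae by eventually_elim simp
    then have "0 = (\<integral>\<omega>. exp_sum_at I c y \<omega> * (G \<omega> * cis (- (y k \<bullet> \<omega>))) \<partial>lborel)"
      by (intro integral_eq_zero_AE[symmetric])
    also have "\<dots> = (\<integral>\<omega>. (\<Sum>i\<in>I. complex_of_real (c i) * (G \<omega> * cis (\<omega> \<bullet> (y i - y k)))) \<partial>lborel)"
    proof (rule Bochner_Integration.integral_cong[OF refl])
      fix \<omega>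
      have "cis (\<omega> \<bullet> (y i - y k)) = cis (y i \<bullet> \<omega>) * cis (- (y k \<bullet> \<omega>))" for i
        by (simp add: cis_mult inner_diff_right inner_commute)
      then show "exp_sum_at I c y \<omega> * (G \<omega> * cis (- (y k \<bullet> \<omega>))) = (\<Sum>i\<in>I. complex_of_real (c i) * (G \<omega> * cis (\<omega> \<bullet> (y i - y k))))"
        unfolding exp_sum_at_def sum_distrib_right by (simp add: mult_ac)
    qed
    also have "\<dots> = (\<Sum>i\<in>I. complex_of_real (c i) * (\<integral>\<omega>. G \<omega> * cis (\<omega> \<bullet> (y i - y k)) \<partial>lborel))"
      by (simp add: Bochner_Integration.integral_sum Gint)
    also have "\<dots> = (\<Sum>i\<in>I. complex_of_real (c i) * complex_of_real ((4 * pi * \<tau>) powr (real DIM('a) / 2) * exp (- \<tau> * (norm (y i - y k))\<^sup>2)))"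
      unfolding G_def integral_gaussian_cis[OF s] eqc ..
    also have "\<dots> = complex_of_real ((4 * pi * \<tau>) powr (real DIM('a) / 2) * (\<Sum>i\<in>I. c i * exp (- \<tau> * (norm (y i - y k))\<^sup>2)))"
      unfolding of_real_mult[symmetric] of_real_sum[symmetric] sum_distrib_left by (simp only: mult.left_commute)
    finally have "complex_of_real ((4 * pi * \<tau>) powr (real DIM('a) / 2) * (\<Sum>i\<in>I. c i * exp (- \<tau> * (norm (y i - y k))\<^sup>2))) = 0" by (rule sym)
    then have "(4 * pi * \<tau>) powr (real DIM('a) / 2) * (\<Sum>i\<in>I. c i * exp (- \<tau> * (norm (y i - y k))\<^sup>2)) = 0" by (simp only: of_real_eq_0_iff)
    then show ?thesis using \<tau> by simp
  qed
  have L1: "((\<lambda>\<tau>. \<Sum>i\<in>I. c i * exp (- \<tau> * (norm (y i - y k))\<^sup>2)) \<longlongrightarrow> (\<Sum>i\<in>I. c i * (if i = k then 1 else 0))) at_top"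
  proof (intro tendsto_sum tendsto_mult_left)
    fix i assume i: "i \<in> I"
    show "((\<lambda>\<tau>. exp (- \<tau> * (norm (y i - y k))\<^sup>2)) \<longlongrightarrow> (if i = k then 1 else 0)) at_top"
    proof (cases "i = k")
      case False
      then have "(norm (y i - y k))\<^sup>2 > 0" using inj i k by (auto simp: inj_on_def)
      then have "((\<lambda>\<tau>. exp (- \<tau> * (norm (y i - y k))\<^sup>2)) \<longlongrightarrow> 0) at_top" by real_asymp
      then show ?thesis using False by simp
    qed simp
  qed
  have "\<forall>\<^sub>F \<tau> in at_top. (\<Sum>i\<in>I. c i * exp (- \<tau> * (norm (y i - y k))\<^sup>2)) = 0"
    using eventually_gt_at_top[of 0] by eventually_elim (rule sum0)
  then have L2: "((\<lambda>\<tau>. \<Sum>i\<in>I. c i * exp (- \<tau> * (norm (y i - y k))\<^sup>2)) \<longlongrightarrow> 0) at_top"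
    by (rule tendsto_eventually)
  have "(\<Sum>i\<in>I. c i * (if i = k then 1 else 0)) = 0"
    by (rule tendsto_unique[OF trivial_limit_at_top_linorder L1 L2])
  then show ?thesis using I k by (simp add: if_distrib[of "(*) _"] cong: if_cong)
qed

lemma kernel_form_pos:
  assumes "finite I" "inj_on y I" "k \<in> I" "c k \<noteq> 0"
  shows "0 < kernel_form I c y"
  using kernel_form_nonneg[OF assms(1), of c y] kernel_form_eq_0_imp[OF assms(1,2) _ assms(3), of c] assms(4)
  by (auto simp: less_le)

section \<open>Native norm and point evaluations\<close>

lemma cmod_div_csqrt_fourier_kernel:
  "(cmod (z / csqrt (fourier (\<lambda>x. complex_of_real (\<Psi> x)) \<omega>)))\<^sup>2 = (cmod z)\<^sup>2 / p \<omega>"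
  using density_pos[of \<omega>] unfolding fourier_kernel
  by (subst of_real_sqrt[symmetric]) (auto simp: norm_divide power_divide)

text \<open>The transform that \<open>SOME\<close> selects in \<open>native_norm\<close> agrees
  almost everywhere with any other one, so every \<open>g\<close> computes the norm.\<close>

lemma native_norm_eq:
  assumes F: "continuous_on UNIV F" and g: "L2_fourier F g"
  shows "native_norm \<Psi> F = sqrt (((2 * pi) powr (- real DIM('a) / 2)) * (\<integral>\<omega>. (cmod (g \<omega>))\<^sup>2 / p \<omega> \<partial>lborel))"
proof -
  define h where "h = (SOME h. L2_fourier F h)"
  have h: "L2_fourier F h" unfolding h_def using g by (rule someI[of "L2_fourier F"])
  have [measurable]: "g \<in> borel_measurable borel" "h \<in> borel_measurable borel"
    using g h by (auto simp: L2_fourier_def)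
  have "(\<integral>\<omega>. (cmod (h \<omega>))\<^sup>2 / p \<omega> \<partial>lborel) = (\<integral>\<omega>. (cmod (g \<omega>))\<^sup>2 / p \<omega> \<partial>lborel)"
    using L2_fourier_unique[OF F h g] by (intro integral_cong_AE) auto
  then show ?thesis
    unfolding native_norm_def h_def[symmetric] Let_def cmod_div_csqrt_fourier_kernel by simp
qed

text \<open>The factorisation of \<open>g\<close> as \<open>u \<omega> * r \<omega>\<close> serves
  twice. It makes \<open>g\<close> integrable, so that inversion expresses the point values of
  \<open>F\<close>; and it splits the resulting integral so that Cauchy-Schwarz yields the native
  norm from \<open>u\<close> and the kernel form from \<open>r\<close> times the exponential
  sum.\<close>

lemma native_functional_bound:
  assumes F: "F \<in> native_space \<Psi>" and I: "finite I"
  shows "\<bar>\<Sum>i\<in>I. c i * F (y i)\<bar> \<le> native_norm \<Psi> F * sqrt (kernel_form I c y)"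
proof -
  from F obtain g where cont: "continuous_on UNIV F" and F2: "integrable lborel (\<lambda>x. (F x)\<^sup>2)"
    and g: "L2_fourier F g" and gp: "integrable lborel (\<lambda>\<omega>. (cmod (g \<omega>))\<^sup>2 / p \<omega>)"
    unfolding native_space_def cmod_div_csqrt_fourier_kernel by auto
  have [measurable]: "g \<in> borel_measurable borel" using g by (auto simp: L2_fourier_def)
  define u where "u \<omega> = g \<omega> / complex_of_real (sqrt (p \<omega>))" for \<omega>
  define r where "r \<omega> = complex_of_real (sqrt (p \<omega>))" for \<omega>
  have [measurable]: "u \<in> borel_measurable borel" "r \<in> borel_measurable borel"
    unfolding u_def r_def by measurable
  have p0: "p \<omega> \<ge> 0" "p \<omega> \<noteq> 0" for \<omega> using density_pos[of \<omega>] by auto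
  have u2: "(cmod (u \<omega>))\<^sup>2 = (cmod (g \<omega>))\<^sup>2 / p \<omega>" for \<omega>
    using p0[of \<omega>] by (simp add: u_def norm_divide power_divide)
  have r2: "(cmod (r \<omega>))\<^sup>2 = p \<omega>" for \<omega>
    using p0[of \<omega>] by (simp add: r_def)
  have ur: "u \<omega> * r \<omega> = g \<omega>" for \<omega>
    using p0[of \<omega>] by (simp add: u_def r_def)
  have g1: "integrable lborel g"
    using integrable_mult_of_square_integrable[of u lborel r] gp density_integrable by (simp add: u2 r2 ur)
  let ?S = "exp_sum_at I c y"
  have S2: "(cmod (r \<omega> * ?S \<omega>))\<^sup>2 = (cmod (?S \<omega>))\<^sup>2 * p \<omega>" for \<omega>
    by (simp add: norm_mult power_mult_distrib r2 mult.commute)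
  have "complex_of_real (\<Sum>i\<in>I. c i * F (y i)) = (\<Sum>i\<in>I. complex_of_real (c i) * complex_of_real (F (y i)))"
    by simp
  also have "\<dots> = (\<Sum>i\<in>I. complex_of_real (c i) * (complex_of_real ((2 * pi) powr (- real DIM('a) / 2)) * (\<integral>\<omega>. g \<omega> * cis (y i \<bullet> \<omega>) \<partial>lborel)))"
    unfolding fourier_inversion_continuous[OF cont F2 g g1] ..
  also have "\<dots> = complex_of_real ((2 * pi) powr (- real DIM('a) / 2)) * (\<Sum>i\<in>I. \<integral>\<omega>. complex_of_real (c i) * (g \<omega> * cis (y i \<bullet> \<omega>)) \<partial>lborel)"
    unfolding integral_mult_right_zero sum_distrib_left by (simp only: mult.left_commute)
  also have "(\<Sum>i\<in>I. \<integral>\<omega>. complex_of_real (c i) * (g \<omega> * cis (y i \<bullet> \<omega>)) \<partial>lborel)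
     = (\<integral>\<omega>. (\<Sum>i\<in>I. complex_of_real (c i) * (g \<omega> * cis (y i \<bullet> \<omega>))) \<partial>lborel)"
    by (intro Bochner_Integration.integral_sum[symmetric] integrable_mult_right integrable_mult_cis g1) auto
  also have "\<dots> = (\<integral>\<omega>. u \<omega> * (r \<omega> * ?S \<omega>) \<partial>lborel)"
    unfolding mult.assoc[symmetric] ur by (simp add: exp_sum_at_def sum_distrib_left mult_ac)
  finally have "cmod (complex_of_real (\<Sum>i\<in>I. c i * F (y i)))
      = cmod (complex_of_real ((2 * pi) powr (- real DIM('a) / 2)) * (\<integral>\<omega>. u \<omega> * (r \<omega> * ?S \<omega>) \<partial>lborel))"
    by (rule arg_cong)
  then have abs: "\<bar>\<Sum>i\<in>I. c i * F (y i)\<bar> = ((2 * pi) powr (- real DIM('a) / 2)) * cmod (\<integral>\<omega>. u \<omega> * (r \<omega> * ?S \<omega>) \<partial>lborel)"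
    by (simp only: norm_mult norm_of_real abs_of_nonneg powr_ge_zero)
  have "(cmod (\<integral>\<omega>. u \<omega> * (r \<omega> * ?S \<omega>) \<partial>lborel))\<^sup>2
      \<le> (\<integral>\<omega>. (cmod (g \<omega>))\<^sup>2 / p \<omega> \<partial>lborel) * (\<integral>\<omega>. (cmod (?S \<omega>))\<^sup>2 * p \<omega> \<partial>lborel)"
    using Cauchy_Schwarz_integral[of u lborel "\<lambda>\<omega>. r \<omega> * ?S \<omega>"] gp exp_sum_square_integrable[OF I]
    by (simp add: S2 u2)
  then have "\<bar>\<Sum>i\<in>I. c i * F (y i)\<bar>\<^sup>2
     \<le> ((2 * pi) powr (- real DIM('a) / 2))\<^sup>2 * ((\<integral>\<omega>. (cmod (g \<omega>))\<^sup>2 / p \<omega> \<partial>lborel) * (\<integral>\<omega>. (cmod (?S \<omega>))\<^sup>2 * p \<omega> \<partial>lborel))"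
    unfolding abs power_mult_distrib by (rule mult_left_mono) simp
  also have "\<dots> = (((2 * pi) powr (- real DIM('a) / 2)) * (\<integral>\<omega>. (cmod (g \<omega>))\<^sup>2 / p \<omega> \<partial>lborel)) * kernel_form I c y"
    unfolding exp_sum_square_integral[OF I, symmetric] by (simp add: power2_eq_square mult_ac)
  finally show ?thesis
    unfolding native_norm_eq[OF cont g] real_sqrt_mult[symmetric] by (intro real_le_rsqrt)
qed

text \<open>The transform is the conjugate exponential sum times \<open>p\<close>, and dividing its
  squared modulus by \<open>p\<close> leaves the integrand of
  \<open>exp_sum_square_integral\<close>. These functions supply the extremal example for the error
  bound.\<close>

lemma
  fixes c :: "'i \<Rightarrow> real" and y :: "'i \<Rightarrow> 'a"
  assumes I: "finite I"
  defines "f \<equiv> \<lambda>x. \<Sum>i\<in>I. c i * \<Psi> (x - y i)"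
  shows kernel_combination_native: "f \<in> native_space \<Psi>"
    and native_norm_kernel_combination: "native_norm \<Psi> f = sqrt (kernel_form I c y)"
proof -
  have cont: "continuous_on UNIV f"
    unfolding f_def by (intro continuous_intros continuous_on_compose2[OF continuous_kernel]) auto
  have [measurable]: "f \<in> borel_measurable borel" by (intro borel_measurable_continuous_onI cont)
  have f1: "integrable lborel f"
    unfolding f_def by (intro Bochner_Integration.integrable_sum integrable_mult_right integrable_lborel_translate kernel_integrable)
  \<comment> \<open>Boundedness upgrades integrability of \<open>f\<close> to square
    integrability.\<close>
  have "\<bar>f x\<bar> \<le> (\<Sum>i\<in>I. \<bar>c i\<bar>)" for x
    unfolding f_def by (rule order_trans[OF sum_abs])
      (auto simp: abs_mult intro!: sum_mono mult_left_le abs_kernel_le)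
  then have "(f x)\<^sup>2 \<le> (\<Sum>i\<in>I. \<bar>c i\<bar>) * \<bar>f x\<bar>" for x
    using mult_right_mono[of "\<bar>f x\<bar>" "\<Sum>i\<in>I. \<bar>c i\<bar>" "\<bar>f x\<bar>"] by (simp add: power2_eq_square)
  then have f2: "integrable lborel (\<lambda>x. (f x)\<^sup>2)"
    using f1 by (intro Bochner_Integration.integrable_bound[OF integrable_mult_right[OF integrable_norm[OF f1], of "\<Sum>i\<in>I. \<bar>c i\<bar>"]])
      (auto simp: abs_mult sum_nonneg)
  have L: "L2_fourier f (fourier (\<lambda>x. complex_of_real (f x)))"
    by (rule L2_fourier_fourier[OF f1 f2])
  have ff: "fourier (\<lambda>x. complex_of_real (f x)) \<omega> = cnj (exp_sum_at I c y \<omega>) * complex_of_real (p \<omega>)" for \<omega>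
  proof -
    have "fourier (\<lambda>x. complex_of_real (f x)) \<omega> = fourier (\<lambda>x. \<Sum>i\<in>I. complex_of_real (c i) * complex_of_real (\<Psi> (x - y i))) \<omega>"
      by (simp add: f_def)
    also have "\<dots> = (\<Sum>i\<in>I. complex_of_real (c i) * fourier (\<lambda>x. complex_of_real (\<Psi> (x - y i))) \<omega>)"
      by (intro fourier_sum integrable_of_real integrable_lborel_translate kernel_integrable)
    also have "\<dots> = (\<Sum>i\<in>I. complex_of_real (c i) * (cis (- (y i \<bullet> \<omega>)) * complex_of_real (p \<omega>)))"
      using fourier_translate[of "\<lambda>x. complex_of_real (\<Psi> x)"] kernel_integrable
      by (simp add: fourier_kernel)
    finally show ?thesis unfolding cnj_exp_sum_at by (simp add: sum_distrib_right mult.assoc)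
  qed
  have n: "(cmod (fourier (\<lambda>x. complex_of_real (f x)) \<omega>))\<^sup>2 / p \<omega> = (cmod (exp_sum_at I c y \<omega>))\<^sup>2 * p \<omega>" for \<omega>
    using density_pos[of \<omega>] by (simp add: ff norm_mult power_mult_distrib power2_eq_square)
  show "f \<in> native_space \<Psi>"
    unfolding native_space_def cmod_div_csqrt_fourier_kernel
    using cont f2 L exp_sum_square_integrable[OF I, of c y] by (auto simp: n[symmetric])
  show "native_norm \<Psi> f = sqrt (kernel_form I c y)"
    unfolding native_norm_eq[OF cont L] n exp_sum_square_integral[OF I] ..
qed

end

section \<open>Positive definite linear systems\<close>

text \<open>Elimination of the last unknown: the Schur complement \<open>M'\<close> inherits
  positive definiteness, so the induction hypothesis solves the reduced system and the last row
  gives the remaining entry.\<close>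

lemma pos_def_solvable:
  fixes M :: "nat \<Rightarrow> nat \<Rightarrow> real"
  assumes "\<And>c. \<exists>k<n. c k \<noteq> 0 \<Longrightarrow> 0 < (\<Sum>j<n. \<Sum>k<n. c j * c k * M j k)"
  shows "\<exists>c. \<forall>j<n. (\<Sum>k<n. M j k * c k) = y j"
  using assms
proof (induction n arbitrary: M y)
  case (Suc n)
  define d where "d = M n n"
  \<comment> \<open>The last unit vector shows that the pivot is positive.\<close>
  have "0 < (\<Sum>j<Suc n. \<Sum>k<Suc n. (if j = n then 1 else 0) * (if k = n then 1 else 0) * M j k)"
    by (rule Suc.prems) auto
  then have d: "d > 0" by (simp add: d_def)
  define M' where "M' j k = M j k - M j n * M n k / d" for j k
  have "0 < (\<Sum>j<n. \<Sum>k<n. c j * c k * M' j k)" if c: "\<exists>k<n. c k \<noteq> 0" for c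
  proof -
    define s where "s = (\<Sum>k<n. M n k * c k)"
    define A where "A = (\<Sum>j<n. \<Sum>k<n. c j * c k * M j k)"
    define B where "B = (\<Sum>j<n. c j * M j n)"
    \<comment> \<open>This \<open>t\<close> solves \<open>s + d * t = 0\<close>, so the last row
      annihilates the extended vector \<open>c'\<close> and the form of \<open>M\<close> at
      \<open>c'\<close> equals that of \<open>M'\<close> at \<open>c\<close>.\<close>
    define t where "t = - s / d"
    define c' where "c' = c(n := t)"
    have "0 < (\<Sum>j<Suc n. \<Sum>k<Suc n. c' j * c' k * M j k)"
      using c by (intro Suc.prems) (auto simp: c'_def intro: less_SucI)
    also have "\<dots> = A + t * B + (t * s + t * t * d)"
      by (simp add: c'_def A_def B_def s_def d_def sum.distrib sum_distrib_left mult_ac)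
    also have "t * s + t * t * d = 0" using d by (simp add: t_def field_simps)
    also have "A + t * B + 0 = A - (\<Sum>j<n. c j * M j n) * (\<Sum>k<n. M n k * c k) / d"
      by (simp add: t_def B_def s_def)
    also have "\<dots> = (\<Sum>j<n. \<Sum>k<n. c j * c k * M' j k)"
      unfolding A_def M'_def sum_product sum_divide_distrib sum_subtractf[symmetric]
      by (intro sum.cong refl) (simp add: algebra_simps)
    finally show ?thesis .
  qed
  from Suc.IH[OF this, of "\<lambda>j. y j - M j n * y n / d"]
  obtain c where c: "\<And>j. j < n \<Longrightarrow> (\<Sum>k<n. M' j k * c k) = y j - M j n * y n / d" by blast
  define s where "s = (\<Sum>k<n. M n k * c k)"
  have "(\<Sum>k<Suc n. M j k * (c(n := (y n - s) / d)) k) = y j" if j: "j < Suc n" for j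
  proof (cases "j = n")
    case True
    then show ?thesis using d by (simp add: s_def d_def)
  next
    case False
    with j have "j < n" by simp
    have "(\<Sum>k<n. M j k * c k) = (\<Sum>k<n. M' j k * c k) + M j n / d * s"
      unfolding s_def sum_distrib_left sum.distrib[symmetric]
      by (intro sum.cong refl) (simp add: M'_def algebra_simps)
    then show ?thesis using d c[OF \<open>j < n\<close>] by (simp add: field_simps)
  qed
  then show ?case by blast
qed simp

text \<open>Makes the definite description usable: existence is \<open>pos_def_solvable\<close>, and
  two solutions differ by a vector on which the form is 0. Padding with zeros from index
  \<open>n\<close> on makes the solution unique as a function on \<open>nat\<close>.\<close>

lemma
  fixes M :: "nat \<Rightarrow> nat \<Rightarrow> real"
  assumes pd: "\<And>c. \<exists>k<n. c k \<noteq> 0 \<Longrightarrow> 0 < (\<Sum>j<n. \<Sum>k<n. c j * c k * M j k)"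
  shows mat_inv_mult_solves: "j < n \<Longrightarrow> (\<Sum>k<n. M j k * mat_inv_mult n M y k) = y j"
    and mat_inv_mult_eqI: "(\<And>j. j < n \<Longrightarrow> (\<Sum>k<n. M j k * c k) = y j) \<Longrightarrow> (\<And>k. k \<ge> n \<Longrightarrow> c k = 0)
          \<Longrightarrow> mat_inv_mult n M y = c"
    and mat_inv_mult_outside: "k \<ge> n \<Longrightarrow> mat_inv_mult n M y k = 0"
proof -
  let ?P = "\<lambda>c. (\<forall>j<n. (\<Sum>k<n. M j k * c k) = y j) \<and> (\<forall>k\<ge>n. c k = 0)"
  have unique: "c = c'" if "?P c" "?P c'" for c c'
  proof -
    define e where "e k = c k - c' k" for k
    have "(\<Sum>j<n. \<Sum>k<n. e j * e k * M j k) = (\<Sum>j<n. e j * (\<Sum>k<n. M j k * e k))"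
      by (simp add: sum_distrib_left mult_ac)
    also have "\<dots> = (\<Sum>j<n. e j * 0)"
      using that by (intro sum.cong refl) (simp add: e_def right_diff_distrib sum_subtractf)
    finally have e0: "\<not> (\<exists>k<n. e k \<noteq> 0)" using pd[of e] by auto
    have "c k = c' k" for k
    proof (cases "k < n")
      case True
      then have "e k = 0" using e0 by blast
      then show ?thesis by (simp add: e_def)
    next
      case False
      then show ?thesis using conjunct2[OF that(1)] conjunct2[OF that(2)] by (simp only: not_less)
    qed
    then show ?thesis by blast
  qed
  obtain c0 where c0: "\<forall>j<n. (\<Sum>k<n. M j k * c0 k) = y j"
    using pos_def_solvable[OF pd] by blast
  have P0: "?P (\<lambda>k. if k < n then c0 k else 0)" using c0 by simp
  have ex1: "\<exists>!c. ?P c" by (rule ex1I[where P = ?P, OF P0]) (rule unique[OF _ P0])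
  have P: "?P (mat_inv_mult n M y)"
    unfolding mat_inv_mult_def by (rule theI'[OF ex1])
  then show "j < n \<Longrightarrow> (\<Sum>k<n. M j k * mat_inv_mult n M y k) = y j"
    and "k \<ge> n \<Longrightarrow> mat_inv_mult n M y k = 0" by auto
  show "mat_inv_mult n M y = c" if "\<And>j. j < n \<Longrightarrow> (\<Sum>k<n. M j k * c k) = y j" "\<And>k. k \<ge> n \<Longrightarrow> c k = 0"
    by (rule unique[OF P]) (simp add: that)
qed

text \<open>Serves continuity in the evaluation point: when \<open>y\<close> is
  \<open>kvec \<Psi> xs x\<close>, the point \<open>x\<close> enters only through the coefficients
  of fixed unit solutions.\<close>

lemma mat_inv_mult_linear:
  fixes M :: "nat \<Rightarrow> nat \<Rightarrow> real"
  assumes pd: "\<And>c. \<exists>k<n. c k \<noteq> 0 \<Longrightarrow> 0 < (\<Sum>j<n. \<Sum>k<n. c j * c k * M j k)"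
  shows "mat_inv_mult n M y j = (\<Sum>i<n. y i * mat_inv_mult n M (\<lambda>k. if k = i then 1 else 0) j)"
proof -
  let ?u = "\<lambda>i. mat_inv_mult n M (\<lambda>k. if k = i then 1 else 0)"
  have "mat_inv_mult n M y = (\<lambda>j. \<Sum>i<n. y i * ?u i j)"
  proof (rule mat_inv_mult_eqI[OF pd])
    fix j assume j: "j < n"
    have "(\<Sum>k<n. M j k * (\<Sum>i<n. y i * ?u i k)) = (\<Sum>k<n. \<Sum>i<n. y i * (M j k * ?u i k))"
      by (simp add: sum_distrib_left mult_ac)
    also have "\<dots> = (\<Sum>i<n. y i * (\<Sum>k<n. M j k * ?u i k))"
      by (subst sum.swap) (simp add: sum_distrib_left)
    also have "\<dots> = (\<Sum>i<n. y i * (if j = i then 1 else 0))"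
      using mat_inv_mult_solves[OF pd j] by simp
    also have "\<dots> = y j" using j by (simp add: if_distrib[of "(*) _"] cong: if_cong)
    finally show "(\<Sum>k<n. M j k * (\<Sum>i<n. y i * ?u i k)) = y j" .
  qed (simp_all add: mat_inv_mult_outside[OF pd])
  then show ?thesis by simp
qed

section \<open>Normal quantiles and essential suprema\<close>

text \<open>The quantile is a definite description: the intermediate value theorem gives existence,
  strict monotonicity gives uniqueness, and the value 1/2 of the distribution function at 0 gives
  the sign.\<close>

lemma normal_quantile_pos:
  assumes "1 / 2 < p" "p < 1"
  shows "normal_quantile p > 0"
proof -
  let ?f = "std_normal_density"
  have fint: "integrable lborel ?f" by simp
  have si: "set_integrable lborel A ?f" if "A \<in> sets borel" for A
    using integrable_mult_indicator[OF _ fint, of A] that by (simp add: set_integrable_def)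
  have split: "std_normal_cdf b = std_normal_cdf a + (LINT x:{a<..b}|lborel. ?f x)" if "a \<le> b" for a b
  proof -
    have U: "{..b} = {..a} \<union> {a<..b}" and D: "{..a} \<inter> {a<..b} = {}" using that by auto
    show ?thesis unfolding std_normal_cdf_def U by (rule set_integral_Un[OF D si si]) auto
  qed
  have strict: "std_normal_cdf a < std_normal_cdf b" if "a < b" for a b
  proof -
    have nn: "AE x in lborel. 0 \<le> indicator {a<..b} x *\<^sub>R ?f x" by simp
    have "(LINT x:{a<..b}|lborel. ?f x) \<noteq> 0"
    proof
      assume "(LINT x:{a<..b}|lborel. ?f x) = 0"
      then have "AE x in lborel. indicator {a<..b} x *\<^sub>R ?f x = 0"
        using integral_nonneg_eq_0_iff_AE[OF si[unfolded set_integrable_def] nn]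
        by (simp add: set_lebesgue_integral_def)
      then have "AE x in lborel. \<not> x \<in> {a<..b}"
        by eventually_elim (auto simp: normal_density_def)
      then have "emeasure lborel {a<..b} = 0"
        by (subst (asm) AE_iff_measurable[where N = "{a<..b}"]) auto
      then show False using that by simp
    qed
    moreover have "(LINT x:{a<..b}|lborel. ?f x) \<ge> 0"
      unfolding set_lebesgue_integral_def by (rule integral_nonneg_AE[OF nn])
    ultimately show ?thesis using split[of a b] that by simp
  qed
  \<comment> \<open>The density is at most 1, so the distribution function is 1-Lipschitz and in
    particular continuous.\<close>
  have lip: "dist (std_normal_cdf a) (std_normal_cdf b) \<le> 1 * dist a b" for a b
  proof (induction a b rule: linorder_wlog)
    case (le a b)
    have "(LINT x:{a<..b}|lborel. ?f x) \<le> (LINT x:{a<..b}|lborel. 1)"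
    proof (rule set_integral_mono[OF si])
      show "set_integrable lborel {a<..b} (\<lambda>x. 1::real)" using le by (simp add: set_integrable_def)
      show "?f x \<le> 1" for x
      proof -
        have "sqrt (2 * pi) \<ge> 1" using pi_ge_two by simp
        then have "?f x \<le> 1 * 1" unfolding std_normal_density_def
          by (intro mult_mono) auto
        then show ?thesis by simp
      qed
    qed simp
    also have "\<dots> = b - a" using le by (simp add: set_lebesgue_integral_def)
    finally have "(LINT x:{a<..b}|lborel. ?f x) \<le> b - a" .
    moreover have "(LINT x:{a<..b}|lborel. ?f x) \<ge> 0"
      unfolding set_lebesgue_integral_def by (rule integral_nonneg_AE) simp
    ultimately show ?case using split[OF le] le by (simp add: dist_real_def)
  qed (simp add: dist_commute)
  have cont: "isCont std_normal_cdf x" for x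
    using lipschitz_on_continuous_on[of 1 UNIV std_normal_cdf] lip
    by (auto simp: lipschitz_on_def continuous_on_eq_continuous_at)
  have half: "std_normal_cdf 0 = 1 / 2"
  proof -
    have "has_bochner_integral lborel (\<lambda>x. indicator {0..} x *\<^sub>R ?f x) (\<integral>x. indicator {0..} x *\<^sub>R ?f x \<partial>lborel)"
      using si[of "{0..}"] by (intro has_bochner_integral_integrable) (simp add: set_integrable_def)
    then have "has_bochner_integral lborel ?f (2 *\<^sub>R (\<integral>x. indicator {0..} x *\<^sub>R ?f x \<partial>lborel))"
      by (rule has_bochner_integral_even_function) (simp add: normal_density_def)
    then have "2 *\<^sub>R (\<integral>x. indicator {0..} x *\<^sub>R ?f x \<partial>lborel) = 1"
      using has_bochner_integral_integral_eq by fastforce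
    moreover have "(\<integral>x. indicator {..0} x *\<^sub>R ?f x \<partial>lborel) = (\<integral>x. indicator {0..} x *\<^sub>R ?f x \<partial>lborel)"
      by (subst lborel_integral_real_affine[where c = "-1" and t = 0])
        (auto simp: normal_density_def indicator_def intro!: Bochner_Integration.integral_cong)
    ultimately show ?thesis by (simp add: std_normal_cdf_def set_lebesgue_integral_def)
  qed
  have "((\<lambda>t. LINT x:{..t}|lborel. ?f x) \<longlongrightarrow> (\<integral>x. ?f x \<partial>lborel)) at_top"
    unfolding set_lebesgue_integral_def by (rule tendsto_integral_at_top) auto
  then have "(std_normal_cdf \<longlongrightarrow> 1) at_top" by (simp add: std_normal_cdf_def[abs_def])
  then have "\<forall>\<^sub>F t in at_top. p < std_normal_cdf t"
    using assms by (intro order_tendstoD) auto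
  then obtain T where T: "p < std_normal_cdf T" "0 \<le> T"
    using eventually_conj[OF _ eventually_ge_at_top[of 0]] eventually_happens'[OF trivial_limit_at_top_linorder] by blast
  obtain t where t: "0 \<le> t" "std_normal_cdf t = p"
    using IVT[of std_normal_cdf 0 p T] assms half T cont by auto
  have "normal_quantile p = t"
    unfolding normal_quantile_def
  proof (rule the_equality)
    show "std_normal_cdf t = p" by (rule t(2))
    fix u assume "std_normal_cdf u = p"
    then show "u = t" using strict[of u t] strict[of t u] t by (cases u t rule: linorder_cases) auto
  qed
  moreover have "t \<noteq> 0" using t half assms by auto
  ultimately show ?thesis using t by simp
qed

text \<open>If the essential supremum were smaller, continuity would give a nonempty open
  \<open>V\<close> inside \<open>\<Omega>\<close> on which \<open>h\<close> exceeds it, and a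
  nonempty open set is not negligible.\<close>

lemma le_esssup_of_isCont:
  fixes h :: "'a::euclidean_space \<Rightarrow> real"
  assumes h: "isCont h x\<^sub>0" and x0: "x\<^sub>0 \<in> interior \<Omega>" and [measurable]: "\<Omega> \<in> sets borel"
  shows "ereal (h x\<^sub>0) \<le> esssup (restrict_space lborel \<Omega>) (\<lambda>x. ereal (h x))"
proof (rule ccontr)
  assume "\<not> ?thesis"
  then obtain z where z: "esssup (restrict_space lborel \<Omega>) (\<lambda>x. ereal (h x)) < ereal z" "ereal z < ereal (h x\<^sub>0)"
    using ereal_dense2 by (metis not_le)
  from h z(2) have "\<forall>\<^sub>F x in nhds x\<^sub>0. z < h x"
    by (intro order_tendstoD(1)[where y = "h x\<^sub>0"]) (auto simp: isCont_def tendsto_nhds_iff)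
  then obtain U where U: "open U" "x\<^sub>0 \<in> U" "\<And>x. x \<in> U \<Longrightarrow> z < h x"
    unfolding eventually_nhds by blast
  define V where "V = U \<inter> interior \<Omega>"
  have V: "open V" "x\<^sub>0 \<in> V" "V \<subseteq> \<Omega>"
    using U x0 interior_subset by (auto simp: V_def)
  have "AE x in restrict_space lborel \<Omega>. ereal (h x) \<le> esssup (restrict_space lborel \<Omega>) (\<lambda>x. ereal (h x))"
    by (rule esssup_AE)
  then have "AE x in lborel. x \<in> \<Omega> \<longrightarrow> ereal (h x) \<le> esssup (restrict_space lborel \<Omega>) (\<lambda>x. ereal (h x))"
    by (subst (asm) AE_restrict_space_iff) auto
  then have "AE x in lborel. \<not> x \<in> V"
  proof eventually_elim
    case (elim x)
    show ?case
    proof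
      assume "x \<in> V"
      then have "ereal (h x) < ereal z" using elim V(3) z(1) by (meson le_less_trans subsetD)
      then show False using U(3)[of x] \<open>x \<in> V\<close> by (auto simp: V_def)
    qed
  qed
  then have "V \<in> null_sets lborel"
    using V(1) by (subst (asm) AE_iff_measurable[where N = V]) auto
  then have "negligible V"
    using V(1) by (simp add: negligible_iff_null_sets null_sets_completion_iff)
  then show False using open_not_negligible[OF V(1)] V(2) by auto
qed

section \<open>Interpolation error\<close>

context spectral_kernel
begin

text \<open>The kriging weights \<open>R^-1 r(x)\<close>. They do not involve the data, so the error
  at \<open>x\<close> becomes a fixed functional of \<open>f\<close>.\<close>

definition interp_weight :: "'a list \<Rightarrow> 'a \<Rightarrow> nat \<Rightarrow> real" where
  "interp_weight xs x = mat_inv_mult (length xs) (kmat \<Psi> xs) (kvec \<Psi> xs x)"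

text \<open>The error at \<open>x\<close> is encoded as one functional on
  \<open>length xs + 1\<close> nodes: the sample points carry minus the weights, and
  \<open>x\<close> sits at the last index \<open>length xs\<close> with coefficient 1.\<close>

definition error_node :: "'a list \<Rightarrow> 'a \<Rightarrow> nat \<Rightarrow> 'a" where
  "error_node xs x j = (if j < length xs then xs ! j else x)"

definition error_coeff :: "'a list \<Rightarrow> 'a \<Rightarrow> nat \<Rightarrow> real" where
  "error_coeff xs x j = (if j < length xs then - interp_weight xs x j else 1)"

lemma kmat_pos_def:
  assumes "distinct xs" "\<exists>k<length xs. c k \<noteq> 0"
  shows "0 < (\<Sum>j<length xs. \<Sum>k<length xs. c j * c k * kmat \<Psi> xs j k)"
proof -
  from assms(2) obtain k where k: "k < length xs" "c k \<noteq> 0" by blast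
  have "inj_on ((!) xs) {..<length xs}"
    using assms(1) by (intro inj_on_nth) auto
  then show ?thesis
    using kernel_form_pos[of "{..<length xs}" "(!) xs" k c] k by (simp add: kernel_form_def kmat_def)
qed

lemma interp_weight_solves:
  assumes "distinct xs" "j < length xs"
  shows "(\<Sum>k<length xs. \<Psi> (xs ! j - xs ! k) * interp_weight xs x k) = \<Psi> (x - xs ! j)"
  using mat_inv_mult_solves[where M = "kmat \<Psi> xs" and y = "kvec \<Psi> xs x", OF kmat_pos_def[OF assms(1)] assms(2)]
  by (simp add: interp_weight_def kmat_def kvec_def)

text \<open>The kernel matrix is symmetric, so its inverse moves from the data onto
  \<open>kvec\<close>.\<close>

lemma interpolant_eq_weights:
  assumes d: "distinct xs"
  shows "interpolant \<Psi> xs f x = (\<Sum>k<length xs. interp_weight xs x k * f (xs ! k))"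
proof -
  define n where "n = length xs"
  define c where "c = mat_inv_mult n (kmat \<Psi> xs) (\<lambda>k. f (xs ! k))"
  have c: "(\<Sum>k<n. \<Psi> (xs ! j - xs ! k) * c k) = f (xs ! j)" if "j < n" for j
    using mat_inv_mult_solves[where M = "kmat \<Psi> xs" and y = "\<lambda>k. f (xs ! k)", OF kmat_pos_def[OF d]] that
    by (simp add: c_def n_def kmat_def)
  have "interpolant \<Psi> xs f x = (\<Sum>j<n. \<Psi> (x - xs ! j) * c j)"
    by (simp add: interpolant_def Let_def kvec_def c_def n_def)
  also have "\<dots> = (\<Sum>j<n. \<Sum>k<n. interp_weight xs x k * (\<Psi> (xs ! k - xs ! j) * c j))"
  proof (intro sum.cong refl)
    fix j assume "j \<in> {..<n}"
    then have "\<Psi> (x - xs ! j) * c j = (\<Sum>k<n. \<Psi> (xs ! j - xs ! k) * interp_weight xs x k) * c j"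
      using interp_weight_solves[OF d, of j x] by (simp add: n_def)
    also have "\<dots> = (\<Sum>k<n. interp_weight xs x k * (\<Psi> (xs ! k - xs ! j) * c j))"
      unfolding sum_distrib_right by (intro sum.cong refl) (simp add: kernel_commute[of "xs ! j"])
    finally show "\<Psi> (x - xs ! j) * c j = (\<Sum>k<n. interp_weight xs x k * (\<Psi> (xs ! k - xs ! j) * c j))" .
  qed
  also have "\<dots> = (\<Sum>k<n. interp_weight xs x k * (\<Sum>j<n. \<Psi> (xs ! k - xs ! j) * c j))"
    by (subst sum.swap) (simp add: sum_distrib_left)
  finally show ?thesis using c by (simp add: n_def)
qed

lemma interpolation_error_eq:
  assumes "distinct xs"
  shows "f x - interpolant \<Psi> xs f x = (\<Sum>j<Suc (length xs). error_coeff xs x j * f (error_node xs x j))"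
  unfolding interpolant_eq_weights[OF assms]
  by (simp add: error_coeff_def error_node_def sum_negf)

text \<open>With kernel matrix \<open>R\<close> and weights \<open>w\<close>, the form expands to
  \<open>w R w - 2 w r + 1\<close>, and the defining equations \<open>R w = r\<close> collapse it to
  \<open>1 - w r\<close>.\<close>

lemma post_var_eq_kernel_form:
  assumes d: "distinct xs"
  shows "post_var \<Psi> xs x = kernel_form {..<Suc (length xs)} (error_coeff xs x) (error_node xs x)"
proof -
  define n where "n = length xs"
  define w where "w = interp_weight xs x"
  define r where "r = (\<Sum>j<n. w j * \<Psi> (x - xs ! j))"
  have "(\<Sum>j<n. \<Sum>k<n. w j * w k * \<Psi> (xs ! j - xs ! k)) = (\<Sum>j<n. w j * (\<Sum>k<n. \<Psi> (xs ! j - xs ! k) * w k))"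
    by (simp add: sum_distrib_left mult_ac)
  also have "\<dots> = r"
    using interp_weight_solves[OF d, of _ x] by (simp add: r_def w_def n_def)
  finally have ww: "(\<Sum>j<n. \<Sum>k<n. w j * w k * \<Psi> (xs ! j - xs ! k)) = r" .
  have "kernel_form {..<Suc n} (error_coeff xs x) (error_node xs x)
     = (\<Sum>j<n. \<Sum>k<n. w j * w k * \<Psi> (xs ! j - xs ! k)) - (\<Sum>j<n. w j * \<Psi> (xs ! j - x)) - (\<Sum>j<n. w j * \<Psi> (x - xs ! j)) + 1"
    by (simp add: kernel_form_def error_coeff_def error_node_def n_def w_def sum.distrib sum_negf sum_subtractf kernel_zero)
  also have "\<dots> = 1 - r"
    unfolding ww by (simp add: r_def kernel_commute[of _ x])
  also have "\<dots> = post_var \<Psi> xs x"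
    by (simp add: post_var_def Let_def kvec_def r_def w_def interp_weight_def n_def mult.commute)
  finally show ?thesis by (simp add: n_def)
qed

lemma post_var_nonneg: "distinct xs \<Longrightarrow> 0 \<le> post_var \<Psi> xs x"
  by (simp add: post_var_eq_kernel_form kernel_form_nonneg)

lemma post_var_pos:
  assumes "distinct xs" "x \<notin> set xs"
  shows "0 < post_var \<Psi> xs x"
proof -
  have "inj_on (error_node xs x) {..<Suc (length xs)}"
    using assms by (auto simp: inj_on_def error_node_def nth_eq_iff_index_eq less_Suc_eq)
  \<comment> \<open>The last coefficient, the one at \<open>x\<close>, is 1 and therefore a nonzero
    witness.\<close>
  then show ?thesis
    unfolding post_var_eq_kernel_form[OF assms(1)]
    by (rule kernel_form_pos[where k = "length xs", rotated]) (auto simp: error_coeff_def)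
qed

lemma continuous_on_interp_weight:
  assumes "distinct xs"
  shows "continuous_on UNIV (\<lambda>x. interp_weight xs x j)"
proof -
  let ?u = "\<lambda>i. mat_inv_mult (length xs) (kmat \<Psi> xs) (\<lambda>k. if k = i then 1 else 0) j"
  have "interp_weight xs x j = (\<Sum>i<length xs. \<Psi> (x - xs ! i) * ?u i)" for x
    unfolding interp_weight_def
    by (subst mat_inv_mult_linear[where M = "kmat \<Psi> xs", OF kmat_pos_def[OF assms]]) (simp_all add: kvec_def)
  then show ?thesis
    by (auto intro!: continuous_intros continuous_on_compose2[OF continuous_kernel])
qed

lemma continuous_on_interpolant:
  assumes "distinct xs"
  shows "continuous_on UNIV (interpolant \<Psi> xs f)"
  unfolding interpolant_eq_weights[OF assms, abs_def]
  by (intro continuous_intros continuous_on_interp_weight assms)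

lemma continuous_on_post_var:
  assumes "distinct xs"
  shows "continuous_on UNIV (post_var \<Psi> xs)"
proof -
  have "post_var \<Psi> xs = (\<lambda>x. 1 - (\<Sum>j<length xs. \<Psi> (x - xs ! j) * interp_weight xs x j))"
    by (simp add: fun_eq_iff post_var_def Let_def kvec_def interp_weight_def)
  then show ?thesis
    by (auto intro!: continuous_intros continuous_on_compose2[OF continuous_kernel] continuous_on_interp_weight assms)
qed

section \<open>Sharp error bounds on native balls\<close>

lemma interpolation_error_bound:
  assumes "distinct xs" "F \<in> native_space \<Psi>"
  shows "\<bar>F x - interpolant \<Psi> xs F x\<bar> \<le> native_norm \<Psi> F * sqrt (post_var \<Psi> xs x)"
  unfolding interpolation_error_eq[OF assms(1)] post_var_eq_kernel_form[OF assms(1)]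
  by (rule native_functional_bound[OF assms(2)]) simp

lemma native_norm_nonneg: "0 \<le> native_norm \<Psi> F"
  unfolding native_norm_def Let_def by simp

text \<open>The interpolant sees only values at sample points in \<open>\<Omega>\<close>, so each
  native extension of \<open>f\<close> yields a bound with its own norm; dividing by the posterior
  deviation allows passage to the infimum. At zero variance one extension already forces the error
  to be 0.\<close>

lemma interpolation_error_bound_on:
  assumes xs: "distinct xs" "set xs \<subseteq> \<Omega>" and f: "f \<in> native_ball \<Psi> \<Omega> a" and x: "x \<in> \<Omega>"
  shows "\<bar>f x - interpolant \<Psi> xs f x\<bar> \<le> a * sqrt (post_var \<Psi> xs x)"
proof -
  let ?N = "{native_norm \<Psi> F | F. F \<in> native_space \<Psi> \<and> (\<forall>x\<in>\<Omega>. F x = f x)}"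
  define e where "e = \<bar>f x - interpolant \<Psi> xs f x\<bar>"
  have ne: "?N \<noteq> {}" and le: "Inf ?N \<le> a"
    using f by (auto simp: native_ball_def in_native_on_def native_norm_on_def)
  have bound: "e \<le> N * sqrt (post_var \<Psi> xs x)" if "N \<in> ?N" for N
  proof -
    from that obtain F where F: "N = native_norm \<Psi> F" "F \<in> native_space \<Psi>" "\<And>x. x \<in> \<Omega> \<Longrightarrow> F x = f x" by blast
    have "interpolant \<Psi> xs F x = interpolant \<Psi> xs f x"
      unfolding interpolant_eq_weights[OF xs(1)] using xs(2) F(3) by (intro sum.cong refl) (auto simp: subset_iff)
    then show ?thesis
      using interpolation_error_bound[OF xs(1) F(2), of x] F(3)[OF x] by (simp add: F(1) e_def)
  qed
  show ?thesis
  proof (cases "post_var \<Psi> xs x = 0")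
    case True
    then show ?thesis using ne bound by (fastforce simp: e_def)
  next
    case False
    then have pv: "sqrt (post_var \<Psi> xs x) > 0" using post_var_nonneg[OF xs(1), of x] by simp
    have "e / sqrt (post_var \<Psi> xs x) \<le> Inf ?N"
      using bound pv by (intro cInf_greatest ne) (simp add: pos_divide_le_eq)
    then have "e / sqrt (post_var \<Psi> xs x) \<le> a" using le by (rule order_trans)
    then show ?thesis using pv by (simp add: pos_divide_le_eq e_def)
  qed
qed

text \<open>Functions in the ball are arbitrary outside \<open>\<Omega>\<close>, so measurability of
  the ratio on \<open>\<Omega>\<close> is inherited from a native extension
  \<open>F\<close>.\<close>

lemma ci_ratio_le:
  assumes xs: "distinct xs" "set xs \<subseteq> \<Omega>" and \<Omega>[measurable]: "\<Omega> \<in> sets borel"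
    and f: "f \<in> native_ball \<Psi> \<Omega> a" and a: "0 \<le> a" and q: "0 < normal_quantile (1 - \<beta> / 2)"
  shows "ci_ratio_Linf \<Psi> \<beta> \<Omega> xs f \<le> ereal (a / (2 * normal_quantile (1 - \<beta> / 2)))"
  unfolding ci_ratio_Linf_def
proof (rule esssup_I)
  define q where "q = normal_quantile (1 - \<beta> / 2)"
  from f obtain F where F: "F \<in> native_space \<Psi>" "\<And>x. x \<in> \<Omega> \<Longrightarrow> F x = f x"
    by (auto simp: native_ball_def in_native_on_def)
  have [measurable]: "F \<in> borel_measurable borel" using F(1) by (simp add: native_space_def)
  have [measurable]: "interpolant \<Psi> xs f \<in> borel_measurable borel" "post_var \<Psi> xs \<in> borel_measurable borel"
    by (intro borel_measurable_continuous_onI continuous_on_interpolant continuous_on_post_var xs)+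
  have "(\<lambda>x. ereal \<bar>(F x - interpolant \<Psi> xs f x) / CI_length \<Psi> \<beta> xs x\<bar>) \<in> borel_measurable (restrict_space lborel \<Omega>)"
    unfolding CI_length_def by (intro measurable_restrict_space1) measurable
  then show "(\<lambda>x. ereal \<bar>(f x - interpolant \<Psi> xs f x) / CI_length \<Psi> \<beta> xs x\<bar>) \<in> borel_measurable (restrict_space lborel \<Omega>)"
    by (rule measurable_cong[THEN iffD1, rotated]) (auto simp: space_restrict_space F(2))
  show "AE x in restrict_space lborel \<Omega>. ereal \<bar>(f x - interpolant \<Psi> xs f x) / CI_length \<Psi> \<beta> xs x\<bar>
      \<le> ereal (a / (2 * normal_quantile (1 - \<beta> / 2)))"
  proof (rule AE_I2)
    fix x assume "x \<in> space (restrict_space lborel \<Omega>)"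
    then have x: "x \<in> \<Omega>" by (simp add: space_restrict_space)
    show "ereal \<bar>(f x - interpolant \<Psi> xs f x) / CI_length \<Psi> \<beta> xs x\<bar> \<le> ereal (a / (2 * normal_quantile (1 - \<beta> / 2)))"
    proof (cases "post_var \<Psi> xs x = 0")
      case True
      \<comment> \<open>The interval has length 0 and the quotient takes the value 0, which is below
        the bound as \<open>a\<close> is nonnegative.\<close>
      then show ?thesis using a q by (simp add: CI_length_def)
    next
      case False
      then have pv: "sqrt (post_var \<Psi> xs x) > 0" using post_var_nonneg[OF xs(1), of x] by simp
      have "\<bar>(f x - interpolant \<Psi> xs f x) / CI_length \<Psi> \<beta> xs x\<bar>
          = \<bar>f x - interpolant \<Psi> xs f x\<bar> / (2 * q * sqrt (post_var \<Psi> xs x))"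
        using pv q by (simp add: CI_length_def abs_divide abs_mult q_def)
      also have "\<dots> \<le> (a * sqrt (post_var \<Psi> xs x)) / (2 * q * sqrt (post_var \<Psi> xs x))"
        using interpolation_error_bound_on[OF xs f x] pv q by (intro divide_right_mono) (auto simp: q_def)
      also have "\<dots> = a / (2 * q)" using pv by simp
      finally show ?thesis by (simp add: q_def)
    qed
  qed
qed

text \<open>The scaled residual of the kernel translate at \<open>x\<^sub>0\<close> vanishes at the nodes and attains
  the bound of \<open>ci_ratio_le\<close> at \<open>x\<^sub>0\<close>.\<close>

lemma ci_ratio_attained:
  assumes xs: "distinct xs" and \<Omega>: "\<Omega> \<in> sets borel"
    and x0: "x\<^sub>0 \<in> interior \<Omega>" "x\<^sub>0 \<notin> set xs" and a: "0 \<le> a" and q: "0 < normal_quantile (1 - \<beta> / 2)"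
  shows "\<exists>f\<in>native_ball \<Psi> \<Omega> a. ereal (a / (2 * normal_quantile (1 - \<beta> / 2))) \<le> ci_ratio_Linf \<Psi> \<beta> \<Omega> xs f"
proof -
  define v where "v = post_var \<Psi> xs x\<^sub>0"
  have v: "v > 0" unfolding v_def by (rule post_var_pos[OF xs x0(2)])
  \<comment> \<open>The unscaled residual has squared native norm \<open>v\<close> and value
    \<open>v\<close> at \<open>x\<^sub>0\<close>; the factor \<open>a / sqrt v\<close> turns these
    into norm \<open>a\<close> and value \<open>a * sqrt v\<close>.\<close>
  define A where "A = a / sqrt v"
  let ?I = "{..<Suc (length xs)}"
  define c where "c j = A * error_coeff xs x\<^sub>0 j" for j
  define f where "f x = (\<Sum>j\<in>?I. c j * \<Psi> (x - error_node xs x\<^sub>0 j))" for x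
  have f_eq: "f x = A * (\<Psi> (x - x\<^sub>0) - (\<Sum>k<length xs. interp_weight xs x\<^sub>0 k * \<Psi> (x - xs ! k)))" for x
    by (simp add: f_def c_def error_coeff_def error_node_def sum_negf sum_distrib_left algebra_simps)
  have "kernel_form ?I c (error_node xs x\<^sub>0) = A\<^sup>2 * v"
    unfolding v_def post_var_eq_kernel_form[OF xs] kernel_form_def c_def
    by (simp add: sum_distrib_left power2_eq_square mult_ac del: sum.lessThan_Suc)
  then have norm_f: "f \<in> native_space \<Psi>" "native_norm \<Psi> f = a"
    using kernel_combination_native[of ?I c "error_node xs x\<^sub>0"]
      native_norm_kernel_combination[of ?I c "error_node xs x\<^sub>0"] v a
    by (simp_all add: f_def[abs_def] A_def real_sqrt_mult power_divide del: sum.lessThan_Suc)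
  \<comment> \<open>\<open>f\<close> is an admissible extension of itself, and all norms are bounded
    below by 0.\<close>
  have "native_norm_on \<Psi> \<Omega> f \<le> a"
    unfolding native_norm_on_def using norm_f native_norm_nonneg
    by (intro cInf_lower bdd_belowI[where m = 0]) auto
  then have ball: "f \<in> native_ball \<Psi> \<Omega> a"
    using norm_f by (auto simp: native_ball_def in_native_on_def)
  have f0: "f (xs ! j) = 0" if "j < length xs" for j
  proof -
    have "(\<Sum>k<length xs. interp_weight xs x\<^sub>0 k * \<Psi> (xs ! j - xs ! k)) = \<Psi> (x\<^sub>0 - xs ! j)"
      using interp_weight_solves[OF xs that, of x\<^sub>0] by (simp add: mult.commute)
    then show ?thesis unfolding f_eq by (simp add: kernel_commute[of x\<^sub>0])
  qed
  have int0: "interpolant \<Psi> xs f x = 0" for x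
    unfolding interpolant_eq_weights[OF xs] using f0 by simp
  have fx0: "f x\<^sub>0 = A * v"
    unfolding f_eq v_def post_var_def Let_def kvec_def interp_weight_def
    by (simp add: kernel_zero mult.commute)
  let ?h = "\<lambda>x. \<bar>(f x - interpolant \<Psi> xs f x) / CI_length \<Psi> \<beta> xs x\<bar>"
  have "isCont ?h x\<^sub>0"
  proof -
    have "isCont f x\<^sub>0" "isCont (post_var \<Psi> xs) x\<^sub>0"
      using norm_f(1) continuous_on_post_var[OF xs] by (auto simp: native_space_def continuous_on_eq_continuous_at)
    \<comment> \<open>Positive variance at \<open>x\<^sub>0\<close> and a positive quantile keep the
      denominator away from 0.\<close>
    then show ?thesis
      unfolding int0 CI_length_def using v q by (intro continuous_intros) (auto simp: v_def)
  qed
  then have "ereal (?h x\<^sub>0) \<le> ci_ratio_Linf \<Psi> \<beta> \<Omega> xs f"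
    unfolding ci_ratio_Linf_def by (rule le_esssup_of_isCont[OF _ x0(1) \<Omega>])
  moreover have "?h x\<^sub>0 = a / (2 * normal_quantile (1 - \<beta> / 2))"
    unfolding int0 CI_length_def v_def[symmetric] using v q a by (simp add: fx0 A_def field_simps abs_mult abs_divide)
  ultimately show ?thesis using ball by auto
qed

end

text \<open>A convex set with empty interior is negligible, and a nonempty open set is
  infinite.\<close>

lemma exists_interior_not_in_finite:
  fixes \<Omega> :: "'a::euclidean_space set"
  assumes "convex \<Omega>" "\<Omega> \<in> sets borel" "emeasure lborel \<Omega> > 0" "finite S"
  obtains x where "x \<in> interior \<Omega>" "x \<notin> S"
proof -
  have "\<not> negligible \<Omega>"
    using assms by (auto simp: negligible_iff_null_sets null_sets_completion_iff null_sets_def)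
  then have "interior \<Omega> \<noteq> {}" using negligible_convex_interior[OF assms(1)] by simp
  then have "infinite (interior \<Omega>)" using finite_imp_not_open[of "interior \<Omega>"] by auto
  then have "\<not> interior \<Omega> \<subseteq> S" using assms(4) finite_subset by blast
  then show ?thesis using that by blast
qed

theorem theorem3p2:
  fixes \<Omega> :: "'a::euclidean_space set" and \<nu> \<beta> :: real
  assumes "convex \<Omega>" and "compact \<Omega>" and "emeasure lborel \<Omega> > 0"
    and "\<nu> > real DIM('a) / 2"
    and "0 < \<beta>" and "\<beta> < 1"
  shows "(\<forall>X. sampling_scheme \<Omega> X \<and> fill_condition \<Omega> X \<longrightarrow>
            (\<forall>n\<ge>1. (SUP f\<in>native_ball (matern \<nu>) \<Omega> 1. ci_ratio_Linf (matern \<nu>) \<beta> \<Omega> (X n) f)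
                      \<le> ereal (1 / (2 * normal_quantile (1 - \<beta> / 2)))))
       \<and> (\<forall>c1 c2. 0 < c1 \<longrightarrow> 0 < c2 \<longrightarrow>
            (\<exists>C>0. \<forall>X. sampling_scheme \<Omega> X \<and> fill_condition_with \<Omega> c1 c2 X \<longrightarrow>
               (\<forall>a::nat \<Rightarrow> real. incseq a \<and> filterlim a at_top sequentially \<and> (\<forall>n. 0 \<le> a n) \<longrightarrow>
                  (\<forall>n\<ge>1. (SUP f\<in>native_ball (matern \<nu>) \<Omega> (a n). ci_ratio_Linf (matern \<nu>) \<beta> \<Omega> (X n) f)
                           \<ge> ereal (C * a n)))))"
proof -
  interpret spectral_kernel "matern \<nu> :: 'a \<Rightarrow> real" "matern_density \<nu>"
    by (rule spectral_kernel_matern[OF assms(4)])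
  define q where "q = normal_quantile (1 - \<beta> / 2)"
  have q: "q > 0" unfolding q_def using assms(5,6) by (intro normal_quantile_pos) auto
  have \<Omega>: "\<Omega> \<in> sets borel" using assms(2) by (intro borel_closed compact_imp_closed)
  have upper: "(SUP f\<in>native_ball (matern \<nu>) \<Omega> 1. ci_ratio_Linf (matern \<nu>) \<beta> \<Omega> (X n) f) \<le> ereal (1 / (2 * q))"
    if "sampling_scheme \<Omega> X" "n \<ge> 1" for X n
    using that q \<Omega> unfolding q_def sampling_scheme_def by (intro SUP_least ci_ratio_le) auto
  \<comment> \<open>Proved for a single design and radius, with a factor depending only on
    \<open>\<beta>\<close>; hence \<open>C\<close> can be fixed before the scheme and the
    radii.\<close>
  have lower: "ereal (1 / (2 * q) * a) \<le> (SUP f\<in>native_ball (matern \<nu>) \<Omega> a. ci_ratio_Linf (matern \<nu>) \<beta> \<Omega> (X n) f)"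
    if X: "sampling_scheme \<Omega> X" "n \<ge> 1" and a: "0 \<le> a" for X n a
  proof -
    have xs: "distinct (X n)" using X by (simp add: sampling_scheme_def)
    obtain x\<^sub>0 where x0: "x\<^sub>0 \<in> interior \<Omega>" "x\<^sub>0 \<notin> set (X n)"
      using exists_interior_not_in_finite[OF assms(1) \<Omega> assms(3), of "set (X n)"] by auto
    obtain f where "f \<in> native_ball (matern \<nu>) \<Omega> a" "ereal (a / (2 * q)) \<le> ci_ratio_Linf (matern \<nu>) \<beta> \<Omega> (X n) f"
      using ci_ratio_attained[OF xs \<Omega> x0 a q[unfolded q_def]] by (auto simp: q_def)
    then show ?thesis by (auto intro: SUP_upper2)
  qed
  have "1 / (2 * q) > 0" using q by simp
  then show ?thesis using upper lower unfolding q_def[symmetric] by blast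
qed

end
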